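(* Let $C$ be an elliptic curve over $\mathbb{C}$ and $\pi\colon S_1\to C$ the stable ruled surface over $C$. Let $\mathbf{W}$ be the singular holomorphic $4$-web on $S_1$ formed by the $2$-web $\mathcal{W}$ of sections of self-intersection $+1$, the Riccati foliation $\mathrm{Ric}$ and the $\mathbb{P}^1$-bundle $\pi\colon S_1\to C$. Let $\Delta$ be the discriminant of $\mathcal{W}$. Then outside the discriminant locus $\Delta$ the $4$-web $\mathbf{W}$ is locally parallelizable.
   Context: Let $C$ be an elliptic curve over $\mathbb{C}$ with origin $p_\infty$. A ruled surface over $C$ is a $\mathbb{P}^1$-fibration $\pi\colon S\to C$. It is called stable if every section $\sigma$ has self-intersection $\sigma\cdot\sigma>0$. $S_1=\mathbb{P}(E_1)$, where $E_1$ is the unique nontrivial extension $0\to\mathcal{O}_C\to E_1\to\mathcal{O}_C(p_\infty)\to 0$; up to isomorphism it is the unique stable ruled surface over $C$. The minimal self-intersection of sections of $S_1$ is $1$; sections with self-intersection $1$ are called minimal sections. Through a generic point of $S_1$ there pass exactly two minimal sections, and through every point at least one and at most two; $\mathcal{W}$ is the singular $2$-web whose leaves are the minimal sections. Its discriminant $\Delta$ is the set of points of $S_1$ through which only one minimal section passes. The foliation $\mathrm{Ric}$: write $C=\mathbb{C}/\Lambda$ with $\Lambda=\mathbb{Z}+\tau\mathbb{Z}$, and let $\varrho\colon\Lambda\to \mathrm{PSL}_2(\mathbb{C})$ be given by $\varrho(1)=(z\mapsto -z)$, $\varrho(\tau)=(z\mapsto 1/z)$. Then $S_1$ is isomorphic,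 over $C$, to the quotient of $\mathbb{C}\times\mathbb{P}^1$ by the action $\lambda\cdot(x,z)=(x+\lambda,\varrho(\lambda)(z))$ of $\Lambda$, and $\mathrm{Ric}$ is the regular foliation transverse to the fibres of $\pi$ induced by the horizontal foliation of $\mathbb{C}\times\mathbb{P}^1$. A $4$-web is locally parallelizable if, near each point, in suitable holomorphic coordinates it is the superposition of four families of parallel straight lines. *)

theory Defs
  imports "HOL-Complex_Analysis.Complex_Analysis"
begin

section \<open>The elliptic curve\<close>

text \<open>The curve is the quotient of the complex plane by the lattice generated by \<open>1\<close> and \<open>\<tau>\<close>
  (with \<open>\<tau>\<close> not real); its points are cosets.\<close>

definition coset :: "complex \<Rightarrow> complex \<Rightarrow> complex set" where
  "coset \<tau> x = {x + of_int m + of_int n * \<tau> | m n. True}"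

definition curve :: "complex \<Rightarrow> complex set set" where
  "curve \<tau> = range (coset \<tau>)"


section \<open>The Riemann sphere\<close>

text \<open>\<open>Some z\<close> is the finite point \<open>z\<close> and \<open>None\<close> is infinity;
  \<open>proj u v\<close> is the point with homogeneous coordinates \<open>[u : v]\<close>.\<close>

type_synonym sphere = "complex option"

definition proj :: "complex \<Rightarrow> complex \<Rightarrow> sphere" where
  "proj u v = (if v = 0 then None else Some (u / v))"

definition mobius :: "complex \<Rightarrow> complex \<Rightarrow> complex \<Rightarrow> complex \<Rightarrow> sphere \<Rightarrow> sphere" where
  "mobius a b c d z =
     (case z of None \<Rightarrow> proj a c | Some w \<Rightarrow> proj (a * w + b) (c * w + d))"

definition holomorphic_to_sphere :: "(complex \<Rightarrow> sphere) \<Rightarrow> complex set \<Rightarrow> bool" where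
  "holomorphic_to_sphere f V \<longleftrightarrow>
     (\<forall>x\<in>V. \<exists>N u v. open N \<and> x \<in> N \<and> N \<subseteq> V \<and> u holomorphic_on N \<and> v holomorphic_on N \<and>
        (\<forall>y\<in>N. (u y, v y) \<noteq> (0, 0) \<and> f y = proj (u y) (v y)))"


section \<open>Ruled surfaces over the curve\<close>

text \<open>A local trivialization of \<open>\<pi> : S \<rightarrow> \<complex>/\<Lambda>\<close> is a pair \<open>(V, t)\<close>, where \<open>V\<close> is an open subset of the
  plane embedded into the curve and \<open>t x z\<close> is the point of the fibre over \<open>coset \<tau> x\<close> with fibre
  coordinate \<open>z\<close>. Values of \<open>t\<close> outside \<open>V\<close> are irrelevant.\<close>

type_synonym 'a triv = "complex set \<times> (complex \<Rightarrow> sphere \<Rightarrow> 'a)"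

definition local_triv :: "complex \<Rightarrow> 'a set \<Rightarrow> ('a \<Rightarrow> complex set) \<Rightarrow> 'a triv \<Rightarrow> bool" where
  "local_triv \<tau> S \<pi> T \<longleftrightarrow>
     (case T of (V, t) \<Rightarrow> open V \<and> inj_on (coset \<tau>) V \<and>
        (\<forall>x\<in>V. bij_betw (t x) UNIV {q \<in> S. \<pi> q = coset \<tau> x}))"

text \<open>Changes of trivialization are given locally by invertible \<open>2 \<times> 2\<close> matrices of holomorphic
  functions on the curve.\<close>

definition compatible_triv :: "complex \<Rightarrow> 'a triv \<Rightarrow> 'a triv \<Rightarrow> bool" where
  "compatible_triv \<tau> T T' \<longleftrightarrow>
     (case (T, T') of ((V, t), (V', t')) \<Rightarrow>
        (\<forall>x\<in>V. \<forall>x'\<in>V'. coset \<tau> x = coset \<tau> x' \<longrightarrow>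
          (\<exists>N a b c d. open N \<and> x \<in> N \<and> N \<subseteq> V \<and>
             a holomorphic_on N \<and> b holomorphic_on N \<and> c holomorphic_on N \<and> d holomorphic_on N \<and>
             (\<forall>y\<in>N. a y * d y - b y * c y \<noteq> 0 \<and> y + (x' - x) \<in> V' \<and>
                (\<forall>z. t y z = t' (y + (x' - x)) (mobius (a y) (b y) (c y) (d y) z))))))"

text \<open>A ruled surface (holomorphic bundle of projective lines) is given by its maximal atlas of
  local trivializations; this atlas also carries the topology and the complex structure of \<open>S\<close>.\<close>

definition ruled_surface ::
    "complex \<Rightarrow> 'a set \<Rightarrow> ('a \<Rightarrow> complex set) \<Rightarrow> 'a triv set \<Rightarrow> bool" where
  "ruled_surface \<tau> S \<pi> A \<longleftrightarrow>
     \<pi> ` S \<subseteq> curve \<tau> \<and>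
     (\<forall>T\<in>A. local_triv \<tau> S \<pi> T) \<and>
     (\<forall>T\<in>A. \<forall>T'\<in>A. compatible_triv \<tau> T T') \<and>
     (\<forall>x. \<exists>(V, t)\<in>A. x \<in> V) \<and>
     (\<forall>T. local_triv \<tau> S \<pi> T \<and> (\<forall>T'\<in>A. compatible_triv \<tau> T T' \<and> compatible_triv \<tau> T' T)
        \<longrightarrow> T \<in> A)"


section \<open>Sections and their self-intersection\<close>

text \<open>The fibre coordinate of the section \<open>s\<close> over \<open>x\<close>, in the trivialization \<open>t\<close>.\<close>

definition fibre_coord ::
    "complex \<Rightarrow> (complex set \<Rightarrow> 'a) \<Rightarrow> (complex \<Rightarrow> sphere \<Rightarrow> 'a) \<Rightarrow> complex \<Rightarrow> sphere" where
  "fibre_coord \<tau> s t x = inv (t x) (s (coset \<tau> x))"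

definition holomorphic_section ::
    "complex \<Rightarrow> 'a set \<Rightarrow> ('a \<Rightarrow> complex set) \<Rightarrow> 'a triv set \<Rightarrow> (complex set \<Rightarrow> 'a) \<Rightarrow> bool" where
  "holomorphic_section \<tau> S \<pi> A s \<longleftrightarrow>
     (\<forall>c\<in>curve \<tau>. s c \<in> S \<and> \<pi> (s c) = c) \<and>
     (\<forall>(V, t)\<in>A. holomorphic_to_sphere (fibre_coord \<tau> s t) V)"

text \<open>The self-intersection of a section is the degree of the normal bundle of its image. As the
  image is transverse to the fibres, its normal bundle is the restriction of the vertical tangent
  bundle. In a trivialization in which the section avoids infinity, a section of that line bundle is
  \<open>v \<partial>/\<partial>z\<close> with \<open>v\<close> a function of the base point; under change of trivialization, \<open>v\<close> gets
  multiplied by the derivative of the fibrewise transition map. Trivializations in which the section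
  avoids infinity exist near each point because the atlas is maximal.\<close>

definition finite_trivs ::
    "complex \<Rightarrow> 'a triv set \<Rightarrow> (complex set \<Rightarrow> 'a) \<Rightarrow> 'a triv set" where
  "finite_trivs \<tau> A s = {(V, t) \<in> A. \<forall>x\<in>V. fibre_coord \<tau> s t x \<noteq> None}"

text \<open>The derivative at the section of the transition map from the fibre of \<open>t\<close> over \<open>x\<close> to the
  fibre of \<open>t'\<close> over \<open>x'\<close>, where \<open>x\<close> and \<open>x'\<close> represent the same point of the curve.\<close>

definition transition_deriv ::
    "complex \<Rightarrow> (complex set \<Rightarrow> 'a) \<Rightarrow> (complex \<Rightarrow> sphere \<Rightarrow> 'a) \<Rightarrow> complex \<Rightarrow>
     (complex \<Rightarrow> sphere \<Rightarrow> 'a) \<Rightarrow> complex \<Rightarrow> complex" where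
  "transition_deriv \<tau> s t x t' x' =
     deriv (\<lambda>w. the (inv (t' x') (t x (Some w)))) (the (fibre_coord \<tau> s t x))"

text \<open>Meromorphic sections of the normal bundle that are not identically zero. Identities are only
  required on punctured neighbourhoods, since a meromorphic function has no meaningful value at a
  pole.\<close>

definition meromorphic_normal_field ::
    "complex \<Rightarrow> 'a triv set \<Rightarrow> (complex set \<Rightarrow> 'a) \<Rightarrow> ('a triv \<Rightarrow> complex \<Rightarrow> complex) \<Rightarrow> bool" where
  "meromorphic_normal_field \<tau> A s v \<longleftrightarrow>
     (\<forall>(V, t) \<in> finite_trivs \<tau> A s.
        v (V, t) meromorphic_on V \<and> (\<forall>x\<in>V. eventually (\<lambda>y. v (V, t) y \<noteq> 0) (at x))) \<and>
     (\<forall>(V, t) \<in> finite_trivs \<tau> A s. \<forall>(V', t') \<in> finite_trivs \<tau> A s.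
        \<forall>x\<in>V. \<forall>x'\<in>V'. coset \<tau> x = coset \<tau> x' \<longrightarrow>
          eventually (\<lambda>y. v (V', t') (y + (x' - x)) =
             transition_deriv \<tau> s t y t' (y + (x' - x)) * v (V, t) y) (at x))"

definition normal_field_order ::
    "complex \<Rightarrow> 'a triv set \<Rightarrow> (complex set \<Rightarrow> 'a) \<Rightarrow> ('a triv \<Rightarrow> complex \<Rightarrow> complex) \<Rightarrow>
     complex set \<Rightarrow> int" where
  "normal_field_order \<tau> A s v c =
     (THE n. \<exists>(V, t) \<in> finite_trivs \<tau> A s. \<exists>x\<in>V. coset \<tau> x = c \<and> zorder (v (V, t)) x = n)"

definition normal_field_degree ::
    "complex \<Rightarrow> 'a triv set \<Rightarrow> (complex set \<Rightarrow> 'a) \<Rightarrow> ('a triv \<Rightarrow> complex \<Rightarrow> complex) \<Rightarrow> int" where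
  "normal_field_degree \<tau> A s v =
     (\<Sum>c | c \<in> curve \<tau> \<and> normal_field_order \<tau> A s v c \<noteq> 0. normal_field_order \<tau> A s v c)"

definition self_intersection ::
    "complex \<Rightarrow> 'a triv set \<Rightarrow> (complex set \<Rightarrow> 'a) \<Rightarrow> int" where
  "self_intersection \<tau> A s =
     (THE d. \<exists>v. meromorphic_normal_field \<tau> A s v \<and> normal_field_degree \<tau> A s v = d)"

definition stable_ruled_surface ::
    "complex \<Rightarrow> 'a set \<Rightarrow> ('a \<Rightarrow> complex set) \<Rightarrow> 'a triv set \<Rightarrow> bool" where
  "stable_ruled_surface \<tau> S \<pi> A \<longleftrightarrow>
     ruled_surface \<tau> S \<pi> A \<and>
     (\<forall>s. holomorphic_section \<tau> S \<pi> A s \<longrightarrow> self_intersection \<tau> A s > 0)"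


section \<open>The families of leaves\<close>

text \<open>Each foliation or web on \<open>S\<close> is represented by the set of its leaves, these being subsets
  of \<open>S\<close>; superposition is union.\<close>

definition minimal_sections ::
    "complex \<Rightarrow> 'a set \<Rightarrow> ('a \<Rightarrow> complex set) \<Rightarrow> 'a triv set \<Rightarrow> 'a set set" where
  "minimal_sections \<tau> S \<pi> A =
     {s ` curve \<tau> | s. holomorphic_section \<tau> S \<pi> A s \<and> self_intersection \<tau> A s = 1}"

definition discriminant ::
    "complex \<Rightarrow> 'a set \<Rightarrow> ('a \<Rightarrow> complex set) \<Rightarrow> 'a triv set \<Rightarrow> 'a set" where
  "discriminant \<tau> S \<pi> A = {q \<in> S. \<exists>!L. L \<in> minimal_sections \<tau> S \<pi> A \<and> q \<in> L}"

definition fibres :: "complex \<Rightarrow> 'a set \<Rightarrow> ('a \<Rightarrow> complex set) \<Rightarrow> 'a set set" where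
  "fibres \<tau> S \<pi> = {{q \<in> S. \<pi> q = c} | c. c \<in> curve \<tau>}"

text \<open>The monodromy representation evaluated at \<open>m + n * \<tau>\<close>. The images \<open>z \<mapsto> -z\<close> of \<open>1\<close> and
  \<open>z \<mapsto> 1/z\<close> of \<open>\<tau>\<close> are commuting involutions, so only the parities of \<open>m\<close> and \<open>n\<close> matter.\<close>

definition monodromy :: "int \<Rightarrow> int \<Rightarrow> sphere \<Rightarrow> sphere" where
  "monodromy m n z =
     (if even m then id else mobius (-1) 0 0 1) ((if even n then id else mobius 0 1 1 0) z)"

text \<open>The suspension: the points are the orbits of the lattice acting on the product of the plane
  and the sphere, and the projection of such an orbit is its first projection, a coset.\<close>

definition orbit :: "complex \<Rightarrow> complex \<Rightarrow> sphere \<Rightarrow> (complex \<times> sphere) set" where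
  "orbit \<tau> x z = {(x + of_int m + of_int n * \<tau>, monodromy m n z) | m n. True}"

definition suspension :: "complex \<Rightarrow> (complex \<times> sphere) set set" where
  "suspension \<tau> = {orbit \<tau> x z | x z. True}"

definition suspension_proj :: "(complex \<times> sphere) set \<Rightarrow> complex set" where
  "suspension_proj Q = fst ` Q"

definition suspension_atlas :: "complex \<Rightarrow> (complex \<times> sphere) set triv set" where
  "suspension_atlas \<tau> =
     {T. local_triv \<tau> (suspension \<tau>) suspension_proj T \<and>
         (\<forall>U. open U \<and> inj_on (coset \<tau>) U \<longrightarrow>
            compatible_triv \<tau> T (U, orbit \<tau>) \<and> compatible_triv \<tau> (U, orbit \<tau>) T)}"

text \<open>Isomorphisms over the curve.\<close>

definition ruled_iso ::
    "'a set \<Rightarrow> ('a \<Rightarrow> complex set) \<Rightarrow> 'a triv set \<Rightarrow>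
     'b set \<Rightarrow> ('b \<Rightarrow> complex set) \<Rightarrow> 'b triv set \<Rightarrow> ('a \<Rightarrow> 'b) \<Rightarrow> bool" where
  "ruled_iso S \<pi> A S' \<pi>' A' \<Phi> \<longleftrightarrow>
     bij_betw \<Phi> S S' \<and> (\<forall>q\<in>S. \<pi>' (\<Phi> q) = \<pi> q) \<and>
     (\<forall>(V, t)\<in>A. (V, \<lambda>x z. \<Phi> (t x z)) \<in> A') \<and>
     (\<forall>(V, t)\<in>A'. (V, \<lambda>x z. inv_into S \<Phi> (t x z)) \<in> A)"

text \<open>\<open>R\<close> is the set of leaves of the foliation of \<open>S\<close> induced by the horizontal foliation through
  an isomorphism with the suspension.\<close>

definition riccati_foliation ::
    "complex \<Rightarrow> 'a set \<Rightarrow> ('a \<Rightarrow> complex set) \<Rightarrow> 'a triv set \<Rightarrow> 'a set set \<Rightarrow> bool" where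
  "riccati_foliation \<tau> S \<pi> A R \<longleftrightarrow>
     (\<exists>\<Phi>. ruled_iso S \<pi> A (suspension \<tau>) suspension_proj (suspension_atlas \<tau>) \<Phi> \<and>
          R = {{q \<in> S. \<exists>x. \<Phi> q = orbit \<tau> x z} | z. True})"


section \<open>Local parallelizability\<close>

text \<open>\<open>finite_points (V, t) U\<close> is \<open>U\<close> read in the holomorphic chart of \<open>S\<close> given by the base
  coordinate in \<open>V\<close> and the finite values of the fibre coordinate. As the atlas is maximal, these
  charts cover \<open>S\<close>.\<close>

definition finite_points :: "'a triv \<Rightarrow> 'a set \<Rightarrow> (complex \<times> complex) set" where
  "finite_points T U = (case T of (V, t) \<Rightarrow> {(x, w). x \<in> V \<and> t x (Some w) \<in> U})"

definition surface_open :: "'a set \<Rightarrow> 'a triv set \<Rightarrow> 'a set \<Rightarrow> bool" where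
  "surface_open S A U \<longleftrightarrow> U \<subseteq> S \<and> (\<forall>T\<in>A. open (finite_points T U))"

definition holomorphic2_on ::
    "(complex \<times> complex \<Rightarrow> complex \<times> complex) \<Rightarrow> (complex \<times> complex) set \<Rightarrow> bool" where
  "holomorphic2_on g D \<longleftrightarrow>
     (\<forall>q\<in>D. \<exists>L. (g has_derivative L) (at q) \<and>
        (\<forall>c u w. L (c * u, c * w) = (c * fst (L (u, w)), c * snd (L (u, w)))))"

definition biholomorphic2_on ::
    "(complex \<times> complex \<Rightarrow> complex \<times> complex) \<Rightarrow> (complex \<times> complex) set \<Rightarrow> bool" where
  "biholomorphic2_on g D \<longleftrightarrow>
     open D \<and> open (g ` D) \<and> inj_on g D \<and>
     holomorphic2_on g D \<and> holomorphic2_on (inv_into D g) (g ` D)"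

definition holomorphic_coordinates ::
    "'a set \<Rightarrow> 'a triv set \<Rightarrow> 'a set \<Rightarrow> ('a \<Rightarrow> complex \<times> complex) \<Rightarrow> bool" where
  "holomorphic_coordinates S A U \<phi> \<longleftrightarrow>
     surface_open S A U \<and> inj_on \<phi> U \<and> open (\<phi> ` U) \<and>
     (\<forall>(V, t)\<in>A. biholomorphic2_on (\<lambda>(x, w). \<phi> (t x (Some w))) (finite_points (V, t) U))"

definition parallel_lines :: "complex \<times> complex \<Rightarrow> (complex \<times> complex) set set" where
  "parallel_lines d = {{(u + c * fst d, w + c * snd d) | c. True} | u w. True}"

text \<open>The leaves of the restriction of a family of curves to the domain of the coordinates \<open>\<phi>\<close>, read
  in these coordinates, are the connected components of the traces of the curves.\<close>

definition local_leaves :: "'b::topological_space set set \<Rightarrow> 'b set set" where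
  "local_leaves F = (\<Union>L\<in>F. components L)"

definition locally_parallelizable_on ::
    "nat \<Rightarrow> 'a set \<Rightarrow> 'a triv set \<Rightarrow> 'a set \<Rightarrow> 'a set set \<Rightarrow> bool" where
  "locally_parallelizable_on k S A X W \<longleftrightarrow>
     (\<forall>q\<in>X. \<exists>U \<phi> d.
        q \<in> U \<and> U \<subseteq> X \<and> holomorphic_coordinates S A U \<phi> \<and>
        (\<forall>i<k. d i \<noteq> (0, 0)) \<and>
        (\<forall>i<k. \<forall>j<k. i \<noteq> j \<longrightarrow> fst (d i) * snd (d j) \<noteq> snd (d i) * fst (d j)) \<and>
        local_leaves {\<phi> ` (L \<inter> U) | L. L \<in> W} =
        local_leaves {l \<inter> \<phi> ` U | l i. i < k \<and> l \<in> parallel_lines (d i)})"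

end

theory Submission
  imports Defs
begin

text \<open>
  On the universal cover \<open>\<complex> \<times> P\<^sup>1\<close> of the suspension a section is a meromorphic function \<open>f\<close> with
  \<open>f (x + 1) = - f x\<close> and \<open>f (x + \<tau>) = 1 / f x\<close>. Its derivative is a meromorphic section of the normal
  bundle, so that the self-intersection is the number of critical points of \<open>f\<close> modulo the lattice.
  A quotient \<open>f0 = u / v\<close> of theta functions is such a function, with a single simple critical point
  at \<open>0\<close>. Any other one, \<open>f\<close>, is a translate of it: the cross-ratio-like quotient
  \<open>(f - h)\<^sup>2 / (f' h')\<close> of two sections is elliptic; with \<open>h x = f (- x)\<close> it shows that \<open>f\<close> is even, which
  determines \<open>f\<close> at the half periods, and with \<open>h = f0\<close> it then shows \<open>f = f0\<close> up to a translation by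
  the lattice. Hence the minimal sections are the graphs of \<open>x \<mapsto> f0 (x - a)\<close>.

  The function \<open>f0\<close> is even, has degree two modulo \<open>2\<Lambda>\<close>, and is ramified exactly over the
  discriminant. In the coordinates \<open>(x, y)\<close> with \<open>z = f0 y\<close> the minimal sections are therefore the lines
  \<open>y = \<plusminus>(x - a)\<close> modulo \<open>2\<Lambda>\<close>, the Riccati foliation is \<open>y\<close> constant and the fibration is \<open>x\<close> constant.
\<close>

section \<open>Elliptic functions\<close>

text \<open>The derivative of a section is a normal field because the surface is flat: lattice
  translations act on the fibre coordinate of \<open>F\<close> by Moebius maps that do not depend on
  the base point, so differentiating along the base creates no extra term. Self-intersection is
  defined through an arbitrary meromorphic normal field; that quotients of such fields are elliptic
  functions of degree zero turns it into a count of critical points. With a section written as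
  [p : q] for entire \<open>p\<close> and \<open>q\<close>, these are zeros of a Wronskian, and
  finite values and poles are treated alike. The theta quotient is built so that its Wronskian is
  again a theta function, of degree one; this is why there is exactly one critical point modulo the
  lattice. Since \<open>f0\<close> is even, the minimal sections through (x, y) have the parameters
  x - y and x + y. They coincide exactly when 2y lies in 2\<Lambda>, that is, at the ramification
  points of \<open>f0\<close>, where y stops being a coordinate. Theta series require Im \<tau> > 0.
  The other sign is reduced to it by passing to -\<tau>, which generates the same lattice together
  with 1 and has the same monodromy, z -> 1/z being an involution.\<close>

definition lattice :: "complex \<Rightarrow> complex set" where
  "lattice \<tau> = {of_int m + of_int n * \<tau> | m n. True}"

lemma latticeI: "of_int m + of_int n * \<tau> \<in> lattice \<tau>"
  unfolding lattice_def by blast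

lemma lattice_simps [simp]: "0 \<in> lattice \<tau>" "1 \<in> lattice \<tau>" "\<tau> \<in> lattice \<tau>"
  using latticeI[of 0 0 \<tau>] latticeI[of 1 0 \<tau>] latticeI[of 0 1 \<tau>] by auto

lemma lattice_add:
  assumes "x \<in> lattice \<tau>" "y \<in> lattice \<tau>" shows "x + y \<in> lattice \<tau>"
proof -
  obtain a b c d where "x = of_int a + of_int b * \<tau>" "y = of_int c + of_int d * \<tau>"
    using assms unfolding lattice_def by blast
  then have "x + y = of_int (a + c) + of_int (b + d) * \<tau>" by (simp add: algebra_simps)
  then show ?thesis using latticeI by metis
qed

lemma lattice_minus: 
  assumes "x \<in> lattice \<tau>" shows "- x \<in> lattice \<tau>"
proof -
  obtain a b where "x = of_int a + of_int b * \<tau>"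
    using assms unfolding lattice_def by blast
  then have "- x = of_int (- a) + of_int (- b) * \<tau>" by (simp add: algebra_simps)
  then show ?thesis using latticeI by metis
qed

lemma lattice_minus_iff [simp]: "- x \<in> lattice \<tau> \<longleftrightarrow> x \<in> lattice \<tau>"
  using lattice_minus by fastforce

lemma lattice_diff: "x \<in> lattice \<tau> \<Longrightarrow> y \<in> lattice \<tau> \<Longrightarrow> x - y \<in> lattice \<tau>"
  using lattice_add[of x \<tau> "- y"] lattice_minus by simp

lemma coset_eq_iff: "coset \<tau> x = coset \<tau> y \<longleftrightarrow> y - x \<in> lattice \<tau>"
proof
  assume "coset \<tau> x = coset \<tau> y"
  moreover have "y \<in> coset \<tau> y"
    unfolding coset_def by (rule CollectI, rule exI[of _ 0], rule exI[of _ 0]) simp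
  ultimately have "y \<in> coset \<tau> x" by simp
  then show "y - x \<in> lattice \<tau>" unfolding coset_def lattice_def by force
next
  have *: "coset \<tau> x = {x + l | l. l \<in> lattice \<tau>}" for x
    unfolding coset_def lattice_def by (auto simp: add.assoc)
  assume l: "y - x \<in> lattice \<tau>"
  have "x + k \<in> coset \<tau> y" if "k \<in> lattice \<tau>" for k
    using lattice_diff[OF that l] unfolding * by (force simp: algebra_simps)
  moreover have "y + k \<in> coset \<tau> x" if "k \<in> lattice \<tau>" for k
    using lattice_add[OF that l] unfolding * by (force simp: algebra_simps)
  ultimately show "coset \<tau> x = coset \<tau> y" unfolding *[of x] *[of y] by blast
qed

lemma coset_uminus_period: "coset (- \<tau>) = coset \<tau>"
proof
  fix x
  have "{x + of_int m + of_int n * - \<tau> |m n. True} = {x + of_int m + of_int n * \<tau> |m n. True}"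
  proof (intro equalityI subsetI)
    fix y assume "y \<in> {x + of_int m + of_int n * - \<tau> |m n. True}"
    then obtain m n where "y = x + of_int m + of_int n * - \<tau>" by blast
    then have "y = x + of_int m + of_int (- n) * \<tau>" by simp
    then show "y \<in> {x + of_int m + of_int n * \<tau> |m n. True}" by blast
  next
    fix y assume "y \<in> {x + of_int m + of_int n * \<tau> |m n. True}"
    then obtain m n where "y = x + of_int m + of_int n * \<tau>" by blast
    then have "y = x + of_int m + of_int (- n) * - \<tau>" by simp
    then show "y \<in> {x + of_int m + of_int n * - \<tau> |m n. True}" by blast
  qed
  then show "coset (- \<tau>) x = coset \<tau> x" unfolding coset_def .
qed

lemma curve_iff: "c \<in> curve \<tau> \<longleftrightarrow> (\<exists>x. c = coset \<tau> x)"
  unfolding curve_def by auto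

section \<open>Real coordinates of the plane with respect to the basis 1, \<tau>\<close>

definition coord1 :: "complex \<Rightarrow> complex \<Rightarrow> real" where
  "coord1 \<tau> x = Re x - Im x / Im \<tau> * Re \<tau>"

definition coord2 :: "complex \<Rightarrow> complex \<Rightarrow> real" where
  "coord2 \<tau> x = Im x / Im \<tau>"

lemma linear_coord: "linear (coord1 \<tau>)" "linear (coord2 \<tau>)"
  by (auto simp: linear_iff coord1_def coord2_def algebra_simps add_divide_distrib)

lemma coord_add: "coord1 \<tau> (x + y) = coord1 \<tau> x + coord1 \<tau> y" "coord2 \<tau> (x + y) = coord2 \<tau> x + coord2 \<tau> y"
  by (simp_all add: linear_add linear_coord)

lemma coord_diff: "coord1 \<tau> (x - y) = coord1 \<tau> x - coord1 \<tau> y" "coord2 \<tau> (x - y) = coord2 \<tau> x - coord2 \<tau> y"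
  by (simp_all add: linear_diff linear_coord)

lemma coord_eq:
  assumes "Im \<tau> \<noteq> 0"
  shows "x = of_real (coord1 \<tau> x) + of_real (coord2 \<tau> x) * \<tau>"
  using assms by (simp add: complex_eq_iff coord1_def coord2_def)

lemma coord_of [simp]:
  assumes "Im \<tau> \<noteq> 0"
  shows "coord1 \<tau> (of_real s + of_real t * \<tau>) = s" "coord2 \<tau> (of_real s + of_real t * \<tau>) = t"
  using assms by (simp_all add: coord1_def coord2_def)

lemma coord_lattice:
  assumes "Im \<tau> \<noteq> 0"
  shows "x \<in> lattice \<tau> \<longleftrightarrow> coord1 \<tau> x \<in> \<int> \<and> coord2 \<tau> x \<in> \<int>"
proof
  assume "x \<in> lattice \<tau>"
  then obtain m n where "x = of_int m + of_int n * \<tau>" unfolding lattice_def by blast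
  then have "x = of_real (of_int m) + of_real (of_int n) * \<tau>" by simp
  then show "coord1 \<tau> x \<in> \<int> \<and> coord2 \<tau> x \<in> \<int>" using assms coord_of by (metis Ints_of_int)
next
  assume "coord1 \<tau> x \<in> \<int> \<and> coord2 \<tau> x \<in> \<int>"
  then obtain m n where "coord1 \<tau> x = of_int m" "coord2 \<tau> x = of_int n"
    by (auto elim!: Ints_cases)
  then have "x = of_int m + of_int n * \<tau>" using coord_eq[OF assms, of x] by simp
  then show "x \<in> lattice \<tau>" using latticeI by metis
qed

lemma lattice_reduce:
  assumes "Im \<tau> \<noteq> 0"
  obtains l where "l \<in> lattice \<tau>" "0 \<le> coord1 \<tau> (x + l)" "coord1 \<tau> (x + l) < 1"
    "0 \<le> coord2 \<tau> (x + l)" "coord2 \<tau> (x + l) < 1"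
proof -
  define m n where "m = - \<lfloor>coord1 \<tau> x\<rfloor>" and "n = - \<lfloor>coord2 \<tau> x\<rfloor>"
  define l where "l = of_real (of_int m) + of_real (of_int n) * \<tau>"
  have l: "l \<in> lattice \<tau>" using latticeI[of m n \<tau>] by (simp add: l_def)
  have "coord1 \<tau> (x + l) = coord1 \<tau> x + of_int m"
    by (simp only: l_def coord_add(1)[of \<tau> x] coord_of[OF assms])
  moreover have "coord2 \<tau> (x + l) = coord2 \<tau> x + of_int n"
    by (simp only: l_def coord_add(2)[of \<tau> x] coord_of[OF assms])
  ultimately show ?thesis
    by (intro that[OF l]) (simp_all add: m_def n_def, linarith+)
qed

lemma continuous_coord: "continuous_on A (coord1 \<tau>)" "continuous_on A (coord2 \<tau>)"
  using linear_coord linear_continuous_on linear_conv_bounded_linear by blast+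

lemma bounded_coord_box:
  assumes "Im \<tau> \<noteq> 0"
  shows "bounded {x. coord1 \<tau> x \<in> {a..b} \<and> coord2 \<tau> x \<in> {c..d}}"
proof -
  have "continuous_on ({a..b} \<times> {c..d}) (\<lambda>(s, t). of_real s + of_real t * \<tau>)"
    by (auto intro!: continuous_intros simp: case_prod_unfold)
  then have "compact ((\<lambda>(s, t). of_real s + of_real t * \<tau>) ` ({a..b} \<times> {c..d}))"
    by (intro compact_continuous_image compact_Times) auto
  moreover have "{x. coord1 \<tau> x \<in> {a..b} \<and> coord2 \<tau> x \<in> {c..d}}
      \<subseteq> (\<lambda>(s, t). of_real s + of_real t * \<tau>) ` ({a..b} \<times> {c..d})"
    using coord_eq[OF assms] by force
  ultimately show ?thesis using bounded_subset compact_imp_bounded by blast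
qed

lemma compact_coord_box:
  assumes "Im \<tau> \<noteq> 0"
  shows "compact {x. coord1 \<tau> x \<in> {a..b} \<and> coord2 \<tau> x \<in> {c..d}}"
proof -
  have "{x. coord1 \<tau> x \<in> {a..b} \<and> coord2 \<tau> x \<in> {c..d}} = coord1 \<tau> -` {a..b} \<inter> coord2 \<tau> -` {c..d}"
    by auto
  moreover have "closed (coord1 \<tau> -` {a..b} \<inter> coord2 \<tau> -` {c..d})"
    by (intro closed_Int closed_vimage continuous_coord closed_atLeastAtMost)
  ultimately show ?thesis using bounded_coord_box[OF assms] compact_eq_bounded_closed by metis
qed

text \<open>With \<open>c = 0\<close> this bounds the length of nonzero periods from below; with
  \<open>c\<close> off the lattice it bounds the distance from \<open>c\<close> to the lattice. Both
  kinds of radius enter the choice of charts.\<close>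

lemma lattice_bounded_away:
  assumes "Im \<tau> \<noteq> 0"
  obtains r where "r > 0" "\<And>l. l \<in> lattice \<tau> \<Longrightarrow> l \<noteq> c \<Longrightarrow> r \<le> dist l c"
proof -
  have fin: "finite (lattice \<tau> \<inter> cball c 1)"
  proof -
    have "\<exists>B. \<forall>x\<in>cball c 1. \<bar>coord1 \<tau> x\<bar> \<le> B \<and> \<bar>coord2 \<tau> x\<bar> \<le> B"
    proof -
      have "compact (coord1 \<tau> ` cball c 1)" "compact (coord2 \<tau> ` cball c 1)"
        by (auto intro!: compact_continuous_image continuous_coord)
      then obtain B1 B2 where "\<forall>x\<in>coord1 \<tau> ` cball c 1. norm x \<le> B1" "\<forall>x\<in>coord2 \<tau> ` cball c 1. norm x \<le> B2"
        using compact_imp_bounded bounded_iff by metis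
      then show ?thesis by (intro exI[of _ "max B1 B2"]) (auto simp: le_max_iff_disj)
    qed
    then obtain B where B: "\<And>x. x \<in> cball c 1 \<Longrightarrow> \<bar>coord1 \<tau> x\<bar> \<le> B \<and> \<bar>coord2 \<tau> x\<bar> \<le> B" by blast
    define I where "I = {-\<lceil>B\<rceil>..\<lceil>B\<rceil>}"
    have "lattice \<tau> \<inter> cball c 1 \<subseteq> (\<lambda>(m, n). of_int m + of_int n * \<tau>) ` (I \<times> I)"
    proof
      fix x assume x: "x \<in> lattice \<tau> \<inter> cball c 1"
      then obtain m n where mn: "x = of_int m + of_int n * \<tau>" unfolding lattice_def by blast
      then have "x = of_real (of_int m) + of_real (of_int n) * \<tau>" by simp
      then have "coord1 \<tau> x = of_int m" "coord2 \<tau> x = of_int n" using coord_of[OF assms] by metis+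
      then have "\<bar>real_of_int m\<bar> \<le> B" "\<bar>real_of_int n\<bar> \<le> B" using B[of x] x by auto
      then have "m \<in> I" "n \<in> I" unfolding I_def by (auto simp: abs_le_iff) linarith+
      then show "x \<in> (\<lambda>(m, n). of_int m + of_int n * \<tau>) ` (I \<times> I)" using mn by force
    qed
    then show ?thesis by (rule finite_subset) (simp add: I_def)
  qed
  \<comment> \<open>Inserting \<open>1\<close> keeps the minimum defined when no other lattice point
    is within distance 1, and it takes care of all points farther away.\<close>
  define r where "r = Min (insert 1 ((\<lambda>l. dist l c) ` (lattice \<tau> \<inter> cball c 1 - {c})))"
  have "r > 0" unfolding r_def using fin by (subst Min_gr_iff) auto
  moreover have "r \<le> dist l c" if "l \<in> lattice \<tau>" "l \<noteq> c" for l
  proof (cases "dist l c \<le> 1")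
    case True
    then show ?thesis unfolding r_def using fin that
      by (intro Min_le) (auto simp: dist_commute)
  next
    case False
    have "r \<le> 1" unfolding r_def using fin by (intro Min_le) auto
    then show ?thesis using False by simp
  qed
  ultimately show ?thesis using that by blast
qed

text \<open>The value type is arbitrary because the lemma is also applied to orders of vanishing, to
  predicates such as \<open>is_pole h\<close>, and to families of points of the surface.\<close>

lemma lattice_periodic:
  fixes f :: "complex \<Rightarrow> 'b"
  assumes "\<And>x. f (x + 1) = f x" "\<And>x. f (x + \<tau>) = f x" "l \<in> lattice \<tau>"
  shows "f (x + l) = f x"
proof -
  have natp: "f (x + of_nat k * w) = f x" if "\<And>x. f (x + w) = f x" for k x w
  proof (induction k)
    case (Suc k)
    have "x + of_nat (Suc k) * w = (x + of_nat k * w) + w" by (simp add: algebra_simps)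
    then show ?case using Suc that by metis
  qed simp
  have int: "f (x + of_int m * w) = f x" if w: "\<And>x. f (x + w) = f x" for m x w
  proof (cases "m \<ge> 0")
    case True
    then show ?thesis using natp[OF w, of x "nat m"] by simp
  next
    case False
    then have "(of_int m :: complex) + of_nat (nat (- m)) = 0" by simp
    moreover have "x + of_int m * w + of_nat (nat (- m)) * w = x + (of_int m + of_nat (nat (- m))) * w"
      by (simp only: distrib_right add.assoc)
    ultimately have "x + of_int m * w + of_nat (nat (- m)) * w = x" by simp
    then show ?thesis using natp[OF w, of "x + of_int m * w" "nat (- m)"] by (simp only:)
  qed
  obtain m n where l: "l = of_int m + of_int n * \<tau>" using assms(3) unfolding lattice_def by blast
  have "f (x + l) = f ((x + of_int n * \<tau>) + of_int m * 1)" by (simp add: l algebra_simps)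
  also have "\<dots> = f x" using int[OF assms(1)] int[OF assms(2)] by simp
  finally show ?thesis .
qed

text \<open>Every value is attained on one compact period parallelogram, so the function is bounded
  and Liouville's theorem applies.\<close>

lemma doubly_periodic_entire_constant:
  assumes "Im \<tau> \<noteq> 0" "f holomorphic_on UNIV" "\<And>x. f (x + 1) = f x" "\<And>x. f (x + \<tau>) = f x"
  shows "f x = f y"
proof -
  define K where "K = {x. coord1 \<tau> x \<in> {0..1} \<and> coord2 \<tau> x \<in> {0..1}}"
  have "compact K" unfolding K_def by (rule compact_coord_box[OF assms(1)])
  then have "compact (f ` K)"
    using assms(2) by (meson compact_continuous_image continuous_on_subset holomorphic_on_imp_continuous_on subset_UNIV)
  moreover have "range f \<subseteq> f ` K"
  proof safe
    fix x
    obtain l where "l \<in> lattice \<tau>" "x + l \<in> K"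
      using lattice_reduce[OF assms(1), of x] unfolding K_def by (smt (verit) atLeastAtMost_iff mem_Collect_eq)
    then show "f x \<in> f ` K" using lattice_periodic[OF assms(3,4)] by (metis imageI)
  qed
  ultimately have "bounded (range f)" using compact_imp_bounded bounded_subset by blast
  then have "f constant_on UNIV" using Liouville_theorem[OF assms(2)] by blast
  then show ?thesis unfolding constant_on_def by (metis UNIV_I)
qed

text \<open>Reduction modulo the lattice only lands in a half-open parallelogram. As
  \<open>Z\<close> misses the lines carrying the sides, the representative falls into the open one,
  the region enclosed by the path of integration.\<close>

lemma coset_representative:
  assumes "Im \<tau> \<noteq> 0" "\<And>z. z \<in> Z \<Longrightarrow> coord1 \<tau> z - s \<notin> \<int>" "\<And>z. z \<in> Z \<Longrightarrow> coord2 \<tau> z - t \<notin> \<int>"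
    and "x \<in> Z" "\<And>l. l \<in> lattice \<tau> \<Longrightarrow> x + l \<in> Z"
  obtains y where "y \<in> Z" "coset \<tau> y = coset \<tau> x"
    "coord1 \<tau> y \<in> {s<..<s + 1}" "coord2 \<tau> y \<in> {t<..<t + 1}"
proof -
  define b where "b = of_real s + of_real t * \<tau>"
  obtain l where l: "l \<in> lattice \<tau>" "0 \<le> coord1 \<tau> (x - b + l)" "coord1 \<tau> (x - b + l) < 1"
    "0 \<le> coord2 \<tau> (x - b + l)" "coord2 \<tau> (x - b + l) < 1"
    by (rule lattice_reduce[OF assms(1), of "x - b"])
  have eq: "x - b + l = (x + l) - b" by simp
  have *: "coord1 \<tau> (x - b + l) = coord1 \<tau> (x + l) - s" "coord2 \<tau> (x - b + l) = coord2 \<tau> (x + l) - t"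
    unfolding eq coord_diff by (simp_all only: b_def coord_of[OF assms(1)])
  have Z: "x + l \<in> Z" using assms(5) l(1) .
  have "coord1 \<tau> (x + l) - s \<noteq> 0" "coord2 \<tau> (x + l) - t \<noteq> 0"
    using assms(2,3)[OF Z] by (metis Ints_0)+
  with l * show ?thesis
    by (intro that[OF Z]) (auto simp: coset_eq_iff)
qed

lemma coset_inj_open_box:
  assumes "Im \<tau> \<noteq> 0" "coord1 \<tau> x \<in> {s<..<s + 1}" "coord2 \<tau> x \<in> {t<..<t + 1}"
    "coord1 \<tau> y \<in> {s<..<s + 1}" "coord2 \<tau> y \<in> {t<..<t + 1}" "coset \<tau> x = coset \<tau> y"
  shows "x = y"
proof -
  have "coord1 \<tau> (y - x) \<in> \<int>" "coord2 \<tau> (y - x) \<in> \<int>"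
    using assms(6) coord_lattice[OF assms(1)] unfolding coset_eq_iff by auto
  moreover have "\<bar>coord1 \<tau> (y - x)\<bar> < 1" "\<bar>coord2 \<tau> (y - x)\<bar> < 1"
    using assms(2-5) by (auto simp: coord_diff)
  ultimately have "coord1 \<tau> (y - x) = 0" "coord2 \<tau> (y - x) = 0"
    using Ints_nonzero_abs_less1 by blast+
  then show ?thesis using coord_eq[OF assms(1), of "y - x"] by simp
qed

text \<open>This places the corner of the period parallelogram: countably many zeros and poles leave
  room for a parallelogram whose sides, with all their lattice translates, avoid them.\<close>

lemma avoid_countable_mod_Ints:
  assumes "countable (A :: real set)"
  obtains s where "\<And>z. z \<in> A \<Longrightarrow> z - s \<notin> \<int>"
proof -
  have "countable ((\<lambda>(z, m). z - of_int m) ` (A \<times> (UNIV :: int set)))"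
    using assms by (intro countable_image countable_SIGMA) auto
  then obtain s where s: "s \<notin> (\<lambda>(z, m). z - of_int m) ` (A \<times> (UNIV :: int set))"
    using uncountable_UNIV_real by (metis UNIV_eq_I)
  have "z - s \<notin> \<int>" if "z \<in> A" for z
  proof
    assume "z - s \<in> \<int>"
    then obtain m where "z - s = of_int m" by (rule Ints_cases)
    then have "s = (\<lambda>(z, m). z - of_int m) (z, m)" by simp
    with s that show False by blast
  qed
  then show ?thesis using that by blast
qed

section \<open>Integration around a period parallelogram\<close>

definition parallelogram_path :: "complex \<Rightarrow> complex \<Rightarrow> real \<Rightarrow> complex" where
  "parallelogram_path \<tau> b = linepath b (b + 1) +++ linepath (b + 1) (b + 1 + \<tau>) +++
     linepath (b + 1 + \<tau>) (b + \<tau>) +++ linepath (b + \<tau>) b"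

lemma parallelogram_path_simps [simp]:
  "valid_path (parallelogram_path \<tau> b)" "path (parallelogram_path \<tau> b)"
  "pathfinish (parallelogram_path \<tau> b) = pathstart (parallelogram_path \<tau> b)"
  by (auto simp: parallelogram_path_def intro!: valid_path_imp_path valid_path_join)

lemma path_image_parallelogram:
  "path_image (parallelogram_path \<tau> b) = closed_segment b (b + 1) \<union> closed_segment (b + 1) (b + 1 + \<tau>) \<union>
     closed_segment (b + 1 + \<tau>) (b + \<tau>) \<union> closed_segment (b + \<tau>) b"
  by (simp add: parallelogram_path_def path_image_join Un_assoc)

lemma coord_parallelogram:
  assumes "Im \<tau> \<noteq> 0" "x \<in> path_image (parallelogram_path \<tau> b)"
  shows "coord1 \<tau> x - coord1 \<tau> b \<in> {0..1}" "coord2 \<tau> x - coord2 \<tau> b \<in> {0..1}"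
    "coord1 \<tau> x - coord1 \<tau> b \<in> {0, 1} \<or> coord2 \<tau> x - coord2 \<tau> b \<in> {0, 1}"
proof -
  have c: "coord1 \<tau> 1 = 1" "coord2 \<tau> 1 = 0" "coord1 \<tau> \<tau> = 0" "coord2 \<tau> \<tau> = 1"
    using assms(1) by (simp_all add: coord1_def coord2_def)
  have **: "\<exists>u\<in>{0..1}. coord1 \<tau> x - coord1 \<tau> b = (1 - u) * coord1 \<tau> v + u * coord1 \<tau> w \<and>
      coord2 \<tau> x - coord2 \<tau> b = (1 - u) * coord2 \<tau> v + u * coord2 \<tau> w"
    if x: "x \<in> closed_segment (b + v) (b + w)" for v w
  proof -
    obtain u where u: "x = (1 - u) *\<^sub>R (b + v) + u *\<^sub>R (b + w)" "0 \<le> u" "u \<le> 1"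
      using x unfolding closed_segment_def by blast
    have "f x - f b = (1 - u) * f v + u * f w" if "linear f" for f :: "complex \<Rightarrow> real"
    proof -
      have "f x = (1 - u) * (f b + f v) + u * (f b + f w)"
        by (simp only: u(1) linear_add[OF that] linear_scale[OF that] real_scaleR_def)
      then show ?thesis by (simp add: algebra_simps)
    qed
    then show ?thesis using u linear_coord by (intro bexI[of _ u]) auto
  qed
  have c': "coord1 \<tau> (1 + \<tau>) = 1" "coord2 \<tau> (1 + \<tau>) = 1" "coord1 \<tau> 0 = 0" "coord2 \<tau> 0 = 0"
    using c by (simp_all add: coord_add linear_0 linear_coord)
  have "x \<in> closed_segment (b + 0) (b + 1) \<or> x \<in> closed_segment (b + 1) (b + (1 + \<tau>)) \<or>
     x \<in> closed_segment (b + (1 + \<tau>)) (b + \<tau>) \<or> x \<in> closed_segment (b + \<tau>) (b + 0)"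
    using assms(2) unfolding path_image_parallelogram by (auto simp: add.assoc)
  then have "coord1 \<tau> x - coord1 \<tau> b \<in> {0..1} \<and> coord2 \<tau> x - coord2 \<tau> b \<in> {0..1} \<and>
    (coord1 \<tau> x - coord1 \<tau> b \<in> {0, 1} \<or> coord2 \<tau> x - coord2 \<tau> b \<in> {0, 1})"
    using c c' by (elim disjE) (drule **; clarsimp simp: c c')+
  then show "coord1 \<tau> x - coord1 \<tau> b \<in> {0..1}" "coord2 \<tau> x - coord2 \<tau> b \<in> {0..1}"
    "coord1 \<tau> x - coord1 \<tau> b \<in> {0, 1} \<or> coord2 \<tau> x - coord2 \<tau> b \<in> {0, 1}" by blast+
qed

lemma convex_coord_box:
  assumes "convex I" "convex J"
  shows "convex {x. coord1 \<tau> x \<in> I \<and> coord2 \<tau> x \<in> J}"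
proof -
  have "{x. coord1 \<tau> x \<in> I \<and> coord2 \<tau> x \<in> J} = coord1 \<tau> -` I \<inter> coord2 \<tau> -` J" by auto
  then show ?thesis
    using convex_linear_vimage[OF linear_coord(1) assms(1)] convex_linear_vimage[OF linear_coord(2) assms(2)]
    by (simp add: convex_Int)
qed

lemma open_coord_box:
  assumes "open I" "open J"
  shows "open {x. coord1 \<tau> x \<in> I \<and> coord2 \<tau> x \<in> J}"
proof -
  have "{x. coord1 \<tau> x \<in> I \<and> coord2 \<tau> x \<in> J} = coord1 \<tau> -` I \<inter> coord2 \<tau> -` J" by auto
  then show ?thesis
    using assms by (simp add: open_Int open_vimage continuous_coord)
qed

text \<open>For Im \<tau> > 0 the path runs counterclockwise and the centre lies to the left of all
  four sides. Each side therefore contributes a positive real part, and the sum cannot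
  vanish.\<close>

lemma winding_number_parallelogram_centre:
  assumes "Im \<tau> > 0" 
  shows "b + (1 + \<tau>) / 2 \<notin> path_image (parallelogram_path \<tau> b)"
    "winding_number (parallelogram_path \<tau> b) (b + (1 + \<tau>) / 2) \<noteq> 0"
proof -
  let ?z = "b + (1 + \<tau>) / 2"
  have tau: "Im \<tau> \<noteq> 0" using assms by simp
  have half: "b + (1 + \<tau>) / 2 = b + (of_real (1/2) + of_real (1/2) * \<tau>)" by (simp add: field_simps)
  show nin: "?z \<notin> path_image (parallelogram_path \<tau> b)"
    using coord_parallelogram(3)[OF tau, of ?z b]
    unfolding half coord_add[of \<tau> b] coord_of[OF tau]
    by auto
  then have n: "?z \<notin> closed_segment b (b + 1)" "?z \<notin> closed_segment (b + 1) (b + 1 + \<tau>)"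
     "?z \<notin> closed_segment (b + 1 + \<tau>) (b + \<tau>)" "?z \<notin> closed_segment (b + \<tau>) b"
    unfolding path_image_parallelogram by auto
  have "winding_number (parallelogram_path \<tau> b) ?z = winding_number (linepath b (b + 1)) ?z +
     (winding_number (linepath (b + 1) (b + 1 + \<tau>)) ?z + (winding_number (linepath (b + 1 + \<tau>) (b + \<tau>)) ?z +
      winding_number (linepath (b + \<tau>) b) ?z))"
    unfolding parallelogram_path_def using n by (simp add: winding_number_join path_image_join)
  moreover have "0 < Re (winding_number (linepath b (b + 1)) ?z)"
    by (rule winding_number_linepath_pos_lt) (use assms in \<open>simp add: field_simps\<close>)
  moreover have "0 < Re (winding_number (linepath (b + 1) (b + 1 + \<tau>)) ?z)"
    by (rule winding_number_linepath_pos_lt) (use assms in \<open>simp add: field_simps\<close>)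
  moreover have "0 < Re (winding_number (linepath (b + 1 + \<tau>) (b + \<tau>)) ?z)"
    by (rule winding_number_linepath_pos_lt) (use assms in \<open>simp add: field_simps\<close>)
  moreover have "0 < Re (winding_number (linepath (b + \<tau>) b) ?z)"
    by (rule winding_number_linepath_pos_lt) (use assms in \<open>simp add: field_simps\<close>)
  ultimately have "0 < Re (winding_number (parallelogram_path \<tau> b) ?z)" by simp
  then show "winding_number (parallelogram_path \<tau> b) ?z \<noteq> 0" by auto
qed

lemma contour_integral_linepath_shift:
  "contour_integral (linepath (x + d) (y + d)) f = contour_integral (linepath x y) (\<lambda>z. f (z + d))"
proof -
  have "linepath (x + d) (y + d) t = linepath x y t + d" for t
    by (simp add: linepath_def algebra_simps)
  then have "(f has_contour_integral i) (linepath (x + d) (y + d)) \<longleftrightarrow>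
     ((\<lambda>z. f (z + d)) has_contour_integral i) (linepath x y)" for i
    by (simp add: has_contour_integral_linepath)
  then show ?thesis unfolding contour_integral_def contour_integrable_on_def by simp
qed

text \<open>Opposite sides cancel up to the increment \<open>\<beta>\<close> under translation by
  \<tau>. It is integrated over a side of length 1, and the translated side is traversed backwards,
  whence \<open>- \<beta>\<close>.\<close>

lemma contour_integral_parallelogram:
  assumes cont: "continuous_on (path_image (parallelogram_path \<tau> b)) f"
    and p1: "\<And>x. x \<in> path_image (parallelogram_path \<tau> b) \<Longrightarrow> f (x + 1) = f x"
    and p2: "\<And>x. x \<in> path_image (parallelogram_path \<tau> b) \<Longrightarrow> f (x + \<tau>) = f x + \<beta>"
  shows "contour_integral (parallelogram_path \<tau> b) f = - \<beta>"
proof -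
  have c: "continuous_on (closed_segment b (b + 1)) f" "continuous_on (closed_segment (b + 1) (b + 1 + \<tau>)) f"
    "continuous_on (closed_segment (b + 1 + \<tau>) (b + \<tau>)) f" "continuous_on (closed_segment (b + \<tau>) b) f"
    using cont unfolding path_image_parallelogram by (auto elim: continuous_on_subset)
  note i = contour_integrable_continuous_linepath[OF c(1)] contour_integrable_continuous_linepath[OF c(2)]
    contour_integrable_continuous_linepath[OF c(3)] contour_integrable_continuous_linepath[OF c(4)]
  have "contour_integral (parallelogram_path \<tau> b) f = contour_integral (linepath b (b + 1)) f +
     (contour_integral (linepath (b + 1) (b + 1 + \<tau>)) f + (contour_integral (linepath (b + 1 + \<tau>) (b + \<tau>)) f +
      contour_integral (linepath (b + \<tau>) b) f))"
    unfolding parallelogram_path_def using i by (simp add: contour_integral_join valid_path_join contour_integrable_joinI)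
  also have "contour_integral (linepath (b + 1) (b + 1 + \<tau>)) f = contour_integral (linepath b (b + \<tau>)) f"
  proof -
    have "contour_integral (linepath (b + 1) (b + 1 + \<tau>)) f
        = contour_integral (linepath b (b + \<tau>)) (\<lambda>z. f (z + 1))"
      using contour_integral_linepath_shift[of b 1 "b + \<tau>" f] by (simp add: ac_simps)
    also have "\<dots> = contour_integral (linepath b (b + \<tau>)) f"
      by (rule contour_integral_eq)
         (use p1 in \<open>auto simp: path_image_parallelogram closed_segment_commute[of b]\<close>)
    finally show ?thesis .
  qed
  also have "contour_integral (linepath (b + 1 + \<tau>) (b + \<tau>)) f = - contour_integral (linepath b (b + 1)) f - \<beta>"
  proof -
    have "contour_integral (linepath (b + 1 + \<tau>) (b + \<tau>)) f
        = - contour_integral (linepath (b + \<tau>) (b + 1 + \<tau>)) f"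
      using contour_integral_reversepath[of "linepath (b + \<tau>) (b + 1 + \<tau>)" f] by simp
    also have "contour_integral (linepath (b + \<tau>) (b + 1 + \<tau>)) f
        = contour_integral (linepath b (b + 1)) (\<lambda>z. f (z + \<tau>))"
      using contour_integral_linepath_shift[of b \<tau> "b + 1" f] by simp
    also have "\<dots> = contour_integral (linepath b (b + 1)) (\<lambda>z. f z + \<beta>)"
      by (rule contour_integral_eq) (use p2 in \<open>auto simp: path_image_parallelogram\<close>)
    also have "\<dots> = contour_integral (linepath b (b + 1)) f + \<beta>"
      by (subst contour_integral_add) (use i(1) in \<open>simp_all add: contour_integrable_continuous_linepath\<close>)
    finally show ?thesis by simp
  qed
  also have "contour_integral (linepath (b + \<tau>) b) f = - contour_integral (linepath b (b + \<tau>)) f"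
    using contour_integral_reversepath[of "linepath b (b + \<tau>)" f] by simp
  finally show ?thesis by simp
qed

text \<open>The logarithmic derivative turns the automorphy factor \<open>exp (b * x + g)\<close>
  into the additive constant \<open>b\<close>, the increment in the contour integral.\<close>

lemma logderiv_quasi_periodic:
  assumes per: "\<And>x. h (x + w) = exp (b * x + g) * h x"
    and "h x \<noteq> 0" "h field_differentiable at x"
  shows "deriv h (x + w) / h (x + w) = deriv h x / h x + b"
proof -
  have "((\<lambda>y. exp (b * y + g) * h y) has_field_derivative
      (b * exp (b * x + g) * h x + deriv h x * exp (b * x + g))) (at x)"
    using assms(3) by (auto intro!: derivative_eq_intros simp: DERIV_deriv_iff_field_differentiable)
  then have "((\<lambda>y. h (y + w)) has_field_derivative
      (b * exp (b * x + g) * h x + deriv h x * exp (b * x + g))) (at x)"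
    unfolding per .
  then have "deriv h (x + w) = b * exp (b * x + g) * h x + deriv h x * exp (b * x + g)"
    using DERIV_shift DERIV_imp_deriv by blast
  then show ?thesis unfolding per using assms(2) by (simp add: field_simps)
qed

text \<open>The integer \<open>w\<close> below is the winding number of the boundary of a period parallelogram around an
  inner point. Only its integrality and \<open>w \<noteq> 0\<close> are needed, so it is never computed.\<close>

theorem quasi_periodic_degree:
  fixes n :: "complex set \<Rightarrow> int"
  assumes tau: "Im \<tau> > 0" and nice: "h nicely_meromorphic_on UNIV" and nz: "\<exists>x. h x \<noteq> 0"
    and per1: "\<And>x. h (x + 1) = exp g0 * h x"
    and per2: "\<And>x. h (x + \<tau>) = exp (b * x + g) * h x"
    and n: "\<And>x. n (coset \<tau> x) = zorder h x"
  shows "finite {c \<in> curve \<tau>. n c \<noteq> 0}"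
    "\<exists>w::int. w \<noteq> 0 \<and> 2 * pi * \<i> * of_int (w * (\<Sum>c | c \<in> curve \<tau> \<and> n c \<noteq> 0. n c)) = - b"
proof -
  have tau': "Im \<tau> \<noteq> 0" using tau by simp
  \<comment> \<open>A nicely meromorphic function has the value 0 at its poles, so \<open>Z\<close>
    contains the poles along with the zeros.\<close>
  define Z where "Z = {x. h x = 0}"
  have mero: "h meromorphic_on UNIV" using nice unfolding nicely_meromorphic_on_def by blast
  have cosp: "eventually (\<lambda>x. h x \<noteq> 0) (cosparse UNIV)"
    using nicely_meromorphic_imp_constant_or_avoid[OF nice open_UNIV connected_UNIV, of 0] nz by auto
  then have sparse: "Z sparse_in UNIV" unfolding Z_def eventually_cosparse by simp
  have ev: "eventually (\<lambda>x. h x \<noteq> 0) (at x)" for x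
    using cosp by (auto simp: eventually_cosparse_open_eq)
  have analytic: "h analytic_on {x}" if "x \<notin> Z" for x
    using nicely_meromorphic_on_imp_analytic_at[OF nice] is_pole_zero_at_nicely_mero[OF nice] that
    unfolding Z_def by blast
  have zorder0: "zorder h x \<noteq> 0 \<longleftrightarrow> x \<in> Z" for x
  proof
    assume "zorder h x \<noteq> 0"
    then show "x \<in> Z" using analytic zorder_eq_0I Z_def by blast
  next
    assume "x \<in> Z"
    then consider "isolated_zero h x" | "is_pole h x"
      using zero_or_pole[OF nice UNIV_I _ ev] unfolding Z_def by blast
    then show "zorder h x \<noteq> 0"
    proof cases
      case 1
      have "not_essential h x" "isolated_singularity_at h x"
        using mero meromorphic_at_iff meromorphic_on_subset by blast+
      then have "zorder h x > 0" using 1 zorder_isolated_zero_pos' by blast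
      then show ?thesis by simp
    next
      case 2
      then show ?thesis
        using isolated_pole_imp_neg_zorder mero meromorphic_at_iff meromorphic_on_subset
        by (metis less_irrefl subset_UNIV)
    qed
  qed
  have nZ: "n (coset \<tau> x) \<noteq> 0 \<longleftrightarrow> x \<in> Z" for x
    unfolding n zorder0 ..
  have Z_lattice: "x + l \<in> Z" if "x \<in> Z" "l \<in> lattice \<tau>" for x l
  proof -
    have "coset \<tau> (x + l) = coset \<tau> x" using that lattice_minus by (simp add: coset_eq_iff)
    then show ?thesis using nZ that by metis
  qed
  have countable: "countable Z" using sparse_imp_countable[OF open_UNIV sparse] by simp
  obtain s where s: "\<And>z. z \<in> coord1 \<tau> ` Z \<Longrightarrow> z - s \<notin> \<int>"
    using avoid_countable_mod_Ints countable by (metis countable_image)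
  obtain t where t: "\<And>z. z \<in> coord2 \<tau> ` Z \<Longrightarrow> z - t \<notin> \<int>"
    using avoid_countable_mod_Ints countable by (metis countable_image)
  define a where "a = of_real s + of_real t * \<tau>"
  have a: "coord1 \<tau> a = s" "coord2 \<tau> a = t" unfolding a_def using coord_of[OF tau'] by auto
  define \<gamma> where "\<gamma> = parallelogram_path \<tau> a"
  \<comment> \<open>The argument principle wants an open connected set around the path.
    \<open>S\<close> enlarges the closed parallelogram \<open>P\<close> by one period on each side
    and still contains only finitely many points of \<open>Z\<close>.\<close>
  define S where "S = {x. coord1 \<tau> x \<in> {s - 1<..<s + 2} \<and> coord2 \<tau> x \<in> {t - 1<..<t + 2}}"
  define Q where "Q = {x. coord1 \<tau> x \<in> {s<..<s + 1} \<and> coord2 \<tau> x \<in> {t<..<t + 1}}"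
  define P where "P = {x. coord1 \<tau> x \<in> {s..s + 1} \<and> coord2 \<tau> x \<in> {t..t + 1}}"
  have S: "open S" "convex S" unfolding S_def by (intro open_coord_box convex_coord_box; simp)+
  have "S \<subseteq> {x. coord1 \<tau> x \<in> {s - 1..s + 2} \<and> coord2 \<tau> x \<in> {t - 1..t + 2}}" unfolding S_def by auto
  then have finS: "finite (S \<inter> Z)"
    using sparse_in_compact_finite[OF sparse_in_subset[OF sparse subset_UNIV] compact_coord_box[OF tau'], of "s - 1" "s + 2" "t - 1" "t + 2"]
    by (meson Int_mono finite_subset order_refl)
  have im: "x \<in> P" "x \<notin> Q" "x \<notin> Z" if "x \<in> path_image \<gamma>" for x
  proof -
    note c = coord_parallelogram[OF tau' that[unfolded \<gamma>_def], unfolded a]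
    show "x \<in> P" using c(1,2) unfolding P_def by auto
    show "x \<notin> Q" using c(3) unfolding Q_def by auto
    show "x \<notin> Z" using c(3) s t by (metis Ints_0 Ints_1 empty_iff imageI insert_iff)
  qed
  have PS: "P \<subseteq> S" "Q \<subseteq> P" unfolding P_def S_def Q_def by auto
  define m where "m = a + (1 + \<tau>) / 2"
  have half: "m = a + (of_real (1/2) + of_real (1/2) * \<tau>)" unfolding m_def by (simp add: field_simps)
  have "coord1 \<tau> m = s + 1/2" "coord2 \<tau> m = t + 1/2"
    unfolding half coord_add[of \<tau> a] a coord_of[OF tau'] by (rule refl)+
  then have mQ: "m \<in> Q" unfolding Q_def by simp
  have "pathfinish \<gamma> = pathstart \<gamma>" unfolding \<gamma>_def by simp
  then have "winding_number \<gamma> m \<in> \<int>"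
    unfolding \<gamma>_def m_def using winding_number_parallelogram_centre(1)[OF tau]
    by (intro integer_winding_number) auto
  then obtain w where w: "winding_number \<gamma> m = of_int w" by (rule Ints_cases)
  have w0: "w \<noteq> 0"
    using winding_number_parallelogram_centre(2)[OF tau, of a] w unfolding \<gamma>_def m_def by auto
  have wQ: "winding_number \<gamma> x = of_int w" if "x \<in> Q" for x
  proof -
    have "connected Q" unfolding Q_def by (intro convex_connected convex_coord_box convex_real_interval)
    moreover have "Q \<inter> path_image \<gamma> = {}" using im by blast
    ultimately have "winding_number \<gamma> x = winding_number \<gamma> m"
      using that mQ by (intro winding_number_eq[of \<gamma> _ Q]) (auto simp: \<gamma>_def)
    then show ?thesis using w by simp
  qed
  have wout: "winding_number \<gamma> x = 0" if "x \<notin> P" for x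
  proof (rule winding_number_zero_outside[of _ P])
    show "convex P" unfolding P_def by (intro convex_coord_box convex_real_interval)
  qed (use that im in \<open>auto simp: \<gamma>_def\<close>)
  define poles where "poles = {x. is_pole h x}"
  have pz: "{x \<in> S. h x = 0 \<or> x \<in> poles} = S \<inter> Z"
    unfolding poles_def Z_def using is_pole_zero_at_nicely_mero[OF nice] by auto
  \<comment> \<open>The factors \<open>1\<close> are the weight function of the general argument
    principle.\<close>
  have "contour_integral \<gamma> (\<lambda>x. deriv h x * 1 / h x) = 2 * pi * \<i> *
          (\<Sum>p\<in>{x \<in> S. h x = 0 \<or> x \<in> poles}. winding_number \<gamma> p * 1 * zorder h p)"
  proof (rule argument_principle)
    show "h holomorphic_on S - poles"
      using nicely_meromorphic_on_imp_analytic_at[OF nice] unfolding poles_def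
      by (intro analytic_imp_holomorphic) (use analytic_on_analytic_at in blast)
    show "path_image \<gamma> \<subseteq> S - {x \<in> S. h x = 0 \<or> x \<in> poles}"
      unfolding pz using im PS by blast
    show "\<forall>z. z \<notin> S \<longrightarrow> winding_number \<gamma> z = 0" using wout PS by blast
    show "finite {x \<in> S. h x = 0 \<or> x \<in> poles}" unfolding pz by (rule finS)
  qed (use S in \<open>auto simp: poles_def \<gamma>_def intro: convex_connected\<close>)
  also have "(\<Sum>p\<in>{x \<in> S. h x = 0 \<or> x \<in> poles}. winding_number \<gamma> p * 1 * zorder h p)
      = (\<Sum>p\<in>Q \<inter> Z. of_int w * of_int (zorder h p) :: complex)"
    unfolding pz
  proof (rule sum.mono_neutral_cong_right[OF finS])
    \<comment> \<open>By the choice of the corner no point of \<open>Z\<close> lies on the boundary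
      of \<open>P\<close>. A point of \<open>Z\<close> outside \<open>Q\<close> is therefore outside
      the convex set \<open>P\<close>, where the winding number is 0.\<close>
    show "\<forall>i\<in>S \<inter> Z - Q \<inter> Z. winding_number \<gamma> i * 1 * of_int (zorder h i) = 0"
    proof
      fix i assume i: "i \<in> S \<inter> Z - Q \<inter> Z"
      have "i \<notin> P"
      proof
        assume "i \<in> P"
        then have "coord1 \<tau> i - s \<in> {0, 1} \<or> coord2 \<tau> i - t \<in> {0, 1}"
          using i unfolding P_def Q_def by force
        then show False using s t i by (metis DiffD1 IntD2 Ints_0 Ints_1 empty_iff imageI insert_iff)
      qed
      then show "winding_number \<gamma> i * 1 * of_int (zorder h i) = 0" using wout by simp
    qed
  qed (use PS wQ in auto)
  also have "\<dots> = of_int (w * (\<Sum>p\<in>Q \<inter> Z. zorder h p))" by (simp add: sum_distrib_left)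
  finally have I: "contour_integral \<gamma> (\<lambda>x. deriv h x * 1 / h x)
      = 2 * pi * \<i> * of_int (w * (\<Sum>p\<in>Q \<inter> Z. zorder h p))" .
  have diffble: "h field_differentiable at x" if "x \<notin> Z" for x
    using analytic[OF that] analytic_on_imp_differentiable_at by blast
  have holo: "(\<lambda>x. deriv h x * 1 / h x) holomorphic_on path_image \<gamma>"
  proof -
    have "(\<lambda>x. deriv h x * 1 / h x) analytic_on path_image \<gamma>"
    proof (subst analytic_on_analytic_at, intro ballI)
      fix x assume "x \<in> path_image \<gamma>"
      then have "x \<notin> Z" using im by blast
      then show "(\<lambda>x. deriv h x * 1 / h x) analytic_on {x}"
        using analytic unfolding Z_def by (auto intro!: analytic_intros)
    qed
    then show ?thesis by (rule analytic_imp_holomorphic)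
  qed
  have "contour_integral \<gamma> (\<lambda>x. deriv h x * 1 / h x) = - b"
    unfolding \<gamma>_def
  proof (rule contour_integral_parallelogram)
    show "continuous_on (path_image (parallelogram_path \<tau> a)) (\<lambda>x. deriv h x * 1 / h x)"
      using holo \<gamma>_def holomorphic_on_imp_continuous_on by blast
    fix x assume "x \<in> path_image (parallelogram_path \<tau> a)"
    then have x: "x \<notin> Z" using im \<gamma>_def by blast
    show "deriv h (x + 1) * 1 / h (x + 1) = deriv h x * 1 / h x"
      using logderiv_quasi_periodic[of h 1 0 g0 x] per1 diffble[OF x] x unfolding Z_def by simp
    show "deriv h (x + \<tau>) * 1 / h (x + \<tau>) = deriv h x * 1 / h x + b"
      using logderiv_quasi_periodic[of h \<tau> b g x] per2 diffble[OF x] x unfolding Z_def by simp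
  qed
  with I have eq: "2 * pi * \<i> * of_int (w * (\<Sum>p\<in>Q \<inter> Z. zorder h p)) = - b" by simp
  \<comment> \<open>The open parallelogram contains exactly one representative of each coset in the
    support of \<open>n\<close>; the sum over points becomes a sum over the curve.\<close>
  have bij: "bij_betw (coset \<tau>) (Q \<inter> Z) {c \<in> curve \<tau>. n c \<noteq> 0}"
  proof (rule bij_betw_imageI)
    show "inj_on (coset \<tau>) (Q \<inter> Z)"
      using coset_inj_open_box[OF tau'] unfolding inj_on_def Q_def by blast
    show "coset \<tau> ` (Q \<inter> Z) = {c \<in> curve \<tau>. n c \<noteq> 0}"
    proof (intro equalityI subsetI)
      fix c assume "c \<in> {c \<in> curve \<tau>. n c \<noteq> 0}"
      then obtain x where x: "c = coset \<tau> x" "x \<in> Z" using nZ by (auto simp: curve_iff)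
      obtain y where "y \<in> Z" "coset \<tau> y = coset \<tau> x" "coord1 \<tau> y \<in> {s<..<s + 1}" "coord2 \<tau> y \<in> {t<..<t + 1}"
        by (rule coset_representative[OF tau', of Z s t x]) (use s t x Z_lattice in auto)
      then show "c \<in> coset \<tau> ` (Q \<inter> Z)" unfolding x Q_def by (intro image_eqI[of _ _ y]) simp_all
    qed (use nZ in \<open>auto simp: curve_iff\<close>)
  qed
  have "finite (Q \<inter> Z)" using finS PS by (rule_tac finite_subset[of _ "S \<inter> Z"]) auto
  then show "finite {c \<in> curve \<tau>. n c \<noteq> 0}" using bij bij_betw_finite by blast
  have "(\<Sum>c | c \<in> curve \<tau> \<and> n c \<noteq> 0. n c) = (\<Sum>p\<in>Q \<inter> Z. zorder h p)"
    using sum.reindex_bij_betw[OF bij, of n] n by simp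
  then show "\<exists>w::int. w \<noteq> 0 \<and> 2 * pi * \<i> * of_int (w * (\<Sum>c | c \<in> curve \<tau> \<and> n c \<noteq> 0. n c)) = - b"
    using eq w0 by (intro exI[of _ w]) simp
qed

lemma coset_in_curve [simp]: "coset \<tau> x \<in> curve \<tau>"
  unfolding curve_def by simp

section \<open>Orders of vanishing and zeros of theta functions\<close>

lemma entire_eventually_nonzero:
  assumes "h holomorphic_on UNIV" "h z0 \<noteq> 0"
  shows "eventually (\<lambda>x. h x \<noteq> 0) (at x)"
  using non_zero_neighbour_alt[OF assms(1) open_UNIV connected_UNIV UNIV_I UNIV_I assms(2)]
  by (rule eventually_mono) blast

lemma entire_analytic: "h holomorphic_on UNIV \<Longrightarrow> h analytic_on A"
  using analytic_on_open analytic_on_subset open_UNIV by blast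

lemma entire_deriv: "h holomorphic_on UNIV \<Longrightarrow> (h has_field_derivative deriv h x) (at x)"
  using holomorphic_derivI open_UNIV by blast

lemma zorder_ge_2:
  assumes "h holomorphic_on UNIV" "h z0 \<noteq> 0" "h x = 0" "deriv h x = 0"
  shows "zorder h x \<ge> 2"
proof -
  have "int 2 \<le> zorder h x"
  proof (rule zorder_geI[OF entire_analytic[OF assms(1)] assms(1) open_UNIV connected_UNIV UNIV_I UNIV_I assms(2)])
    show "(deriv ^^ k) h x = 0" if "k < 2" for k
      using that assms(3,4) by (cases k) (auto simp: less_Suc_eq numeral_2_eq_2)
  qed
  then show ?thesis by simp
qed

lemma zorder_quasi_periodic:
  assumes "h meromorphic_on UNIV" "\<And>x. eventually (\<lambda>x. h x \<noteq> 0) (at x)"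
    and "\<And>x. h (x + w) = exp (b * x + g) * h x"
  shows "zorder h (x + w) = zorder h x"
proof -
  have m: "h meromorphic_on {x}" using assms(1) meromorphic_on_subset by blast
  have an: "(\<lambda>x. exp (b * x + g)) analytic_on {x}" by (intro analytic_intros)
  have "zorder h (x + w) = zorder (\<lambda>x. h (x + w)) x"
    using zorder_shift[of h "x + w"] zorder_shift[of "\<lambda>x. h (x + w)" x] by (simp add: ac_simps)
  also have "\<dots> = zorder (\<lambda>x. exp (b * x + g) * h x) x" unfolding assms(3) ..
  also have "\<dots> = zorder (\<lambda>x. exp (b * x + g)) x + zorder h x"
    using m an assms(2)[of x]
    by (intro zorder_mult) (auto intro!: analytic_on_imp_meromorphic_on eventually_frequently)
  also have "zorder (\<lambda>x. exp (b * x + g)) x = 0" by (rule zorder_eq_0I[OF an]) simp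
  finally show ?thesis by simp
qed

text \<open>A quasi-periodic function does not descend to the curve, but its order of vanishing
  does, since the automorphy factor has no zeros.\<close>

lemma order_on_curve:
  fixes h :: "complex \<Rightarrow> complex"
  assumes "\<And>x. zorder h (x + 1) = zorder h x" "\<And>x. zorder h (x + \<tau>) = zorder h x"
  obtains n where "\<And>x. n (coset \<tau> x) = zorder h x"
proof
  fix x
  define n where "n c = zorder h (SOME x. c = coset \<tau> x)" for c
  define y where "y = (SOME y. coset \<tau> x = coset \<tau> y)"
  have "coset \<tau> x = coset \<tau> y" unfolding y_def by (rule someI[of _ x]) simp
  then have "y - x \<in> lattice \<tau>" by (simp add: coset_eq_iff)
  then have "zorder h (x + (y - x)) = zorder h x"
    by (rule lattice_periodic[of "zorder h", OF assms])
  then show "zorder h (SOME y. coset \<tau> x = coset \<tau> y) = zorder h x" unfolding y_def by simp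
qed

text \<open>The degree formula gives \<open>w * s = d\<close> with an unknown nonzero integer
  \<open>w\<close>. An entire function has no negative orders, so \<open>s \<ge> 0\<close>; as
  \<open>d > 0\<close>, both factors are positive and \<open>0 < s \<le> d\<close>. The later zero
  counts rest on this upper bound and on the existence of a zero.\<close>

lemma theta_function_zeros:
  assumes tau: "Im \<tau> > 0" and h: "h holomorphic_on UNIV" and nz: "\<exists>x. h x \<noteq> 0"
    and per1: "\<And>x. h (x + 1) = exp g0 * h x"
    and per2: "\<And>x. h (x + \<tau>) = exp (- (2 * pi * \<i> * of_nat d) * x + g) * h x" and "d > 0"
  obtains n :: "complex set \<Rightarrow> int" where
    "\<And>x. n (coset \<tau> x) = zorder h x" "\<And>c. c \<in> curve \<tau> \<Longrightarrow> n c \<ge> 0"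
    "\<And>B. finite B \<Longrightarrow> B \<subseteq> curve \<tau> \<Longrightarrow> (\<Sum>c\<in>B. n c) \<le> d"
    "\<exists>x. h x = 0"
proof -
  obtain z0 where z0: "h z0 \<noteq> 0" using nz by blast
  note ev = entire_eventually_nonzero[OF h z0]
  note an = entire_analytic[OF h]
  obtain n where n: "\<And>x. n (coset \<tau> x) = zorder h x"
  proof (rule order_on_curve)
    show "zorder h (x + 1) = zorder h x" for x
      by (rule zorder_quasi_periodic[of h 1 0 g0]) (use an ev per1 in \<open>auto intro: analytic_on_imp_meromorphic_on\<close>)
    show "zorder h (x + \<tau>) = zorder h x" for x
      by (rule zorder_quasi_periodic[OF _ _ per2]) (use an ev in \<open>auto intro: analytic_on_imp_meromorphic_on\<close>)
  qed blast
  note deg = quasi_periodic_degree[OF tau analytic_on_imp_nicely_meromorphic_on[OF an] nz per1 per2 n]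
  obtain w where w: "2 * pi * \<i> * of_int (w * (\<Sum>c | c \<in> curve \<tau> \<and> n c \<noteq> 0. n c)) = 2 * pi * \<i> * of_nat d"
    using deg(2) by auto
  define s where "s = (\<Sum>c | c \<in> curve \<tau> \<and> n c \<noteq> 0. n c)"
  have "(of_int (w * s) :: complex) = of_int (int d)" using w unfolding s_def by simp
  then have ws: "w * s = int d" using of_int_eq_iff by blast
  have n0: "n c \<ge> 0" if "c \<in> curve \<tau>" for c
    using that n zorder_ge_0[OF an eventually_frequently[OF _ ev]] by (auto simp: curve_iff)
  then have s0: "s \<ge> 0" unfolding s_def by (intro sum_nonneg) auto
  moreover have "s \<noteq> 0" using ws assms(6) by auto
  ultimately have spos: "s > 0" by simp
  have "w > 0"
  proof (rule ccontr)
    assume "\<not> w > 0"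
    then have "w * s \<le> 0" using s0 by (simp add: mult_nonpos_nonneg)
    then show False using ws assms(6) by simp
  qed
  then have "s \<le> d" using ws s0 by (metis mult_le_cancel_right1 int_one_le_iff_zero_less mult.commute not_less order_trans)
  have le: "(\<Sum>c\<in>B. n c) \<le> d" if "finite B" "B \<subseteq> curve \<tau>" for B
  proof -
    have "(\<Sum>c\<in>B. n c) = (\<Sum>c\<in>B \<inter> {c \<in> curve \<tau>. n c \<noteq> 0}. n c)"
      using that by (intro sum.mono_neutral_right) auto
    also have "\<dots> \<le> s" unfolding s_def using n0 deg(1) by (intro sum_mono2) auto
    finally show ?thesis using \<open>s \<le> d\<close> by simp
  qed
  have "\<exists>x. h x = 0"
  proof (rule ccontr)
    assume "\<nexists>x. h x = 0"
    then have "n c = 0" if "c \<in> curve \<tau>" for c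
      using that n zorder_eq_0I[OF an] by (auto simp: curve_iff)
    then have "s = 0" unfolding s_def by simp
    then show False using spos by simp
  qed
  then show ?thesis using that n n0 le by blast
qed

section \<open>Theta functions\<close>

text \<open>One half of Jacobi's theta series. Keeping only the exponents \<open>n \<ge> 0\<close>
  gives, for |q| < 1, an everywhere convergent power series in \<open>w\<close>.\<close>

definition theta_series :: "complex \<Rightarrow> complex \<Rightarrow> complex" where
  "theta_series q w = (\<Sum>n. q ^ (n * n) * w ^ n)"

lemma theta_series_summable:
  assumes "norm q < 1"
  shows "summable (\<lambda>n. q ^ (n * n) * (w :: complex) ^ n)"
proof -
  have "(\<lambda>n. norm q ^ n * norm w) \<longlonglongrightarrow> 0 * norm w"
    using assms by (intro tendsto_intros LIMSEQ_power_zero) auto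
  then have "eventually (\<lambda>n. norm q ^ n * norm w < 1 / 2) sequentially"
    by (rule order_tendstoD) simp
  then have "eventually (\<lambda>n. norm (q ^ (n * n) * w ^ n) \<le> (1 / 2) ^ n) sequentially"
  proof eventually_elim
    case (elim n)
    have "norm (q ^ (n * n) * w ^ n) = (norm q ^ n * norm w) ^ n"
      by (simp add: norm_mult norm_power power_mult power_mult_distrib)
    also have "\<dots> \<le> (1 / 2) ^ n" using elim by (intro power_mono) auto
    finally show ?case .
  qed
  then show ?thesis
    by (rule summable_comparison_test_ev) (auto intro: summable_geometric)
qed

lemma theta_series_holomorphic:
  assumes "norm q < 1"
  shows "theta_series q holomorphic_on UNIV"
proof (rule holomorphic_onI)
  fix x
  have "((\<lambda>x. \<Sum>n. q ^ (n * n) * x ^ n) has_field_derivative (\<Sum>n. diffs (\<lambda>n. q ^ (n * n)) n * x ^ n)) (at x)"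
    by (rule termdiffs_strong_converges_everywhere[OF theta_series_summable[OF assms]])
  then show "theta_series q field_differentiable at x within UNIV"
    unfolding theta_series_def field_differentiable_def by auto
qed

text \<open>Shift of the summation index: (n + 1)^2 = n^2 + 2n + 1, so one factor
  \<open>q * w\<close> splits off and \<open>w\<close> is rescaled by q^2.\<close>

lemma theta_series_rec:
  assumes "norm q < 1"
  shows "theta_series q w = 1 + q * w * theta_series q (q\<^sup>2 * w)"
proof -
  have "theta_series q w = 1 + (\<Sum>n. q ^ (Suc n * Suc n) * w ^ Suc n)"
    unfolding theta_series_def using suminf_split_head[OF theta_series_summable[OF assms], of w] by simp
  also have "(\<lambda>n. q ^ (Suc n * Suc n) * w ^ Suc n) = (\<lambda>n. q * w * (q ^ (n * n) * (q\<^sup>2 * w) ^ n))"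
  proof
    fix n :: nat
    have "Suc n * Suc n = n * n + n + n + 1" by simp
    then show "q ^ (Suc n * Suc n) * w ^ Suc n = q * w * (q ^ (n * n) * (q\<^sup>2 * w) ^ n)"
      by (simp only: power_add power_mult_distrib power2_eq_square power_one_right power_Suc mult.assoc mult.left_commute mult.commute)
  qed
  finally show ?thesis
    unfolding theta_series_def by (simp only: suminf_mult[OF theta_series_summable[OF assms]])
qed

lemma theta_series_0 [simp]: "theta_series q 0 = 1"
  unfolding theta_series_def using powser_zero[of "\<lambda>n. q ^ (n * n)"] by simp

text \<open>In classical notation \<open>u\<close> and \<open>v\<close> can be taken to be
  \<theta>_2(\<pi> x | 2\<tau>) and \<theta>_3(\<pi> x | 2\<tau>). The common factor in the two
  \<tau>-rules cancels in the quotient u/v, which thus changes sign under x + 1 and is inverted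
  under x + \<tau>.\<close>

locale theta_pair =
  fixes \<tau> :: complex and u v :: "complex \<Rightarrow> complex"
  assumes tau: "Im \<tau> > 0"
    and u_hol: "u holomorphic_on UNIV" and v_hol: "v holomorphic_on UNIV"
    and u_1: "u (x + 1) = - u x" and v_1: "v (x + 1) = v x"
    and u_tau: "u (x + \<tau>) = exp (- (pi * \<i> * \<tau> / 2) - pi * \<i> * x) * v x"
    and v_tau: "v (x + \<tau>) = exp (- (pi * \<i> * \<tau> / 2) - pi * \<i> * x) * u x"
    and u_even: "u (- x) = u x" and v_even: "v (- x) = v x"
    and v_nz: "\<exists>x. v x \<noteq> 0"

lemma theta_pair_exists:
  assumes "Im \<tau> > 0"
  obtains u v where "theta_pair \<tau> u v"
proof -
  \<comment> \<open>The nome of the period 2\<tau>: translation by \<tau> has to exchange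
    \<open>u\<close> and \<open>v\<close>, so that each of them alone is quasi-periodic under
    2\<tau>.\<close>
  define q where "q = exp (2 * pi * \<i> * \<tau>)"
  have q: "norm q < 1" unfolding q_def using assms by (simp add: norm_exp)
  have q0: "q \<noteq> 0" unfolding q_def by simp
  \<comment> \<open>The two-sided theta series. Both halves contain the term of index 0, hence the
    \<open>- 1\<close>.\<close>
  define L where "L w = theta_series q w + theta_series q (1 / w) - 1" for w
  define v where "v x = L (exp (2 * pi * \<i> * x))" for x
  \<comment> \<open>Forced by the rule for \<open>v (x + \<tau>)\<close>, solved for
    \<open>u x\<close>.\<close>
  define u where "u x = exp (pi * \<i> * \<tau> / 2 + pi * \<i> * x) * v (x + \<tau>)" for x
  have L_rec: "q * w * L (q\<^sup>2 * w) = L w" if "w \<noteq> 0" for w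
  proof -
    have "theta_series q (1 / (q\<^sup>2 * w)) = 1 + q * (1 / (q\<^sup>2 * w)) * theta_series q (1 / w)"
      using theta_series_rec[OF q, of "1 / (q\<^sup>2 * w)"] q0 by simp
    then show ?thesis using theta_series_rec[OF q, of w] that q0 unfolding L_def
      by (simp add: field_simps power2_eq_square)
  qed
  have L_sym: "L (1 / w) = L w" for w unfolding L_def by simp
  have v_hol: "v holomorphic_on UNIV"
  proof -
    have "(\<lambda>x. theta_series q (exp (2 * pi * \<i> * x))) holomorphic_on UNIV"
         "(\<lambda>x. theta_series q (1 / exp (2 * pi * \<i> * x))) holomorphic_on UNIV"
      by (rule holomorphic_on_compose[OF _ holomorphic_on_subset[OF theta_series_holomorphic[OF q]], unfolded o_def];
          (intro holomorphic_intros)?; simp)+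
    then show ?thesis unfolding v_def L_def by (intro holomorphic_intros)
  qed
  have u_hol: "u holomorphic_on UNIV"
    unfolding u_def
    by (intro holomorphic_intros holomorphic_on_compose[OF _ holomorphic_on_subset[OF v_hol], unfolded o_def]) auto
  have v_1: "v (x + 1) = v x" for x
    unfolding v_def by (simp add: distrib_left exp_add)
  have v_even: "v (- x) = v x" for x
    unfolding v_def using L_sym[of "exp (2 * pi * \<i> * x)"] by (simp add: exp_minus inverse_eq_divide)
  have v_2tau: "v (x + 2 * \<tau>) = exp (- (2 * pi * \<i> * \<tau>) - 2 * pi * \<i> * x) * v x" for x
  proof -
    have "2 * pi * \<i> * (x + 2 * \<tau>) = 2 * pi * \<i> * \<tau> + 2 * pi * \<i> * \<tau> + 2 * pi * \<i> * x"
      by (simp add: algebra_simps)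
    then have "exp (2 * pi * \<i> * (x + 2 * \<tau>)) = q\<^sup>2 * exp (2 * pi * \<i> * x)"
      unfolding q_def power2_eq_square by (simp only: exp_add)
    then have *: "q * exp (2 * pi * \<i> * x) * v (x + 2 * \<tau>) = v x"
      unfolding v_def using L_rec[of "exp (2 * pi * \<i> * x)"] by simp
    have "exp (- (2 * pi * \<i> * \<tau>) - 2 * pi * \<i> * x) * (q * exp (2 * pi * \<i> * x)) = 1"
      unfolding q_def by (simp add: mult_exp_exp)
    then have "exp (- (2 * pi * \<i> * \<tau>) - 2 * pi * \<i> * x) * (q * exp (2 * pi * \<i> * x)) * v (x + 2 * \<tau>) = v (x + 2 * \<tau>)"
      by simp
    then show ?thesis using * by (simp only: mult.assoc)
  qed
  \<comment> \<open>If \<open>L\<close> vanished away from 0, then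
    \<open>theta_series q w = 1 - theta_series q (1 / w)\<close> would tend to 0 at infinity.
    Liouville's theorem would make the series vanish, against its value 1 at 0.\<close>
  have v_nz: "\<exists>x. v x \<noteq> 0"
  proof (rule ccontr)
    assume "\<nexists>x. v x \<noteq> 0"
    then have v0: "v x = 0" for x by blast
    have L0: "L w = 0" if "w \<noteq> 0" for w
    proof -
      have "exp (2 * pi * \<i> * (Ln w / (2 * pi * \<i>))) = w" using that by simp
      then show ?thesis using v0[of "Ln w / (2 * pi * \<i>)"] unfolding v_def by metis
    qed
    have "((\<lambda>w. 1 - theta_series q (inverse w)) \<longlongrightarrow> 1 - theta_series q 0) at_infinity"
    proof (intro tendsto_intros)
      have "isCont (theta_series q) 0"
        using theta_series_holomorphic[OF q] holomorphic_on_imp_differentiable_at field_differentiable_imp_continuous_at by blast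
      then show "((\<lambda>w. theta_series q (inverse w)) \<longlongrightarrow> theta_series q 0) at_infinity"
        using isCont_tendsto_compose tendsto_inverse_0 by blast
    qed
    moreover have "eventually (\<lambda>w. 1 - theta_series q (inverse w) = theta_series q w) at_infinity"
    proof -
      have "eventually (\<lambda>w::complex. norm w \<ge> 1) at_infinity" by (rule eventually_at_infinityI) auto
      then show ?thesis
      proof eventually_elim
        case (elim w)
        then have "w \<noteq> 0" by auto
        then show ?case using L0[of w] unfolding L_def by (simp add: inverse_eq_divide algebra_simps)
      qed
    qed
    ultimately have "(theta_series q \<longlongrightarrow> 0) at_infinity"
      using Lim_transform_eventually by fastforce
    then have "theta_series q 0 = 0" using Liouville_weak_0[OF theta_series_holomorphic[OF q]] by blast
    then show False by simp
  qed
  have "theta_pair \<tau> u v"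
  proof
    show "u (x + 1) = - u x" for x
    proof -
      have "u (x + 1) = exp (pi * \<i> * \<tau> / 2 + pi * \<i> * x + pi * \<i>) * v (x + \<tau> + 1)"
        unfolding u_def by (simp add: algebra_simps)
      then show ?thesis unfolding v_1 u_def by (simp add: exp_add)
    qed
    show "v (x + \<tau>) = exp (- (pi * \<i> * \<tau> / 2) - pi * \<i> * x) * u x" for x
      unfolding u_def by (simp add: mult_exp_exp flip: mult.assoc)
    show "u (x + \<tau>) = exp (- (pi * \<i> * \<tau> / 2) - pi * \<i> * x) * v x" for x
    proof -
      have "u (x + \<tau>) = exp (pi * \<i> * \<tau> / 2 + pi * \<i> * (x + \<tau>)) * v (x + 2 * \<tau>)"
        unfolding u_def by (simp add: algebra_simps)
      also have "\<dots> = exp (pi * \<i> * \<tau> / 2 + pi * \<i> * (x + \<tau>) + (- (2 * pi * \<i> * \<tau>) - 2 * pi * \<i> * x)) * v x"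
        unfolding v_2tau by (simp only: exp_add mult.assoc)
      also have "pi * \<i> * \<tau> / 2 + pi * \<i> * (x + \<tau>) + (- (2 * pi * \<i> * \<tau>) - 2 * pi * \<i> * x) = - (pi * \<i> * \<tau> / 2) - pi * \<i> * x"
        by (simp add: field_simps)
      finally show ?thesis .
    qed
    show "u (- x) = u x" for x
    proof -
      have "v (x + \<tau>) = v ((x - \<tau>) + 2 * \<tau>)" by (simp add: add.commute)
      also have "\<dots> = exp (- (2 * pi * \<i> * \<tau>) - 2 * pi * \<i> * (x - \<tau>)) * v (x - \<tau>)" by (rule v_2tau)
      also have "v (x - \<tau>) = v (- x + \<tau>)" using v_even[of "x - \<tau>"] by simp
      finally have "u x = exp (pi * \<i> * \<tau> / 2 + pi * \<i> * x + (- (2 * pi * \<i> * \<tau>) - 2 * pi * \<i> * (x - \<tau>))) * v (- x + \<tau>)"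
        unfolding u_def by (simp only: exp_add mult.assoc)
      also have "pi * \<i> * \<tau> / 2 + pi * \<i> * x + (- (2 * pi * \<i> * \<tau>) - 2 * pi * \<i> * (x - \<tau>)) = pi * \<i> * \<tau> / 2 + pi * \<i> * (- x)"
        by (simp add: field_simps)
      finally show ?thesis unfolding u_def by simp
    qed
  qed fact+
  then show ?thesis using that by blast
qed


text \<open>The numerator of the derivative of p/q. It detects the critical points of [p : q] both
  at finite values and at poles.\<close>

definition wronskian :: "(complex \<Rightarrow> complex) \<Rightarrow> (complex \<Rightarrow> complex) \<Rightarrow> complex \<Rightarrow> complex" where
  "wronskian p q x = deriv p x * q x - p x * deriv q x"

lemma wronskian_holomorphic:
  "p holomorphic_on UNIV \<Longrightarrow> q holomorphic_on UNIV \<Longrightarrow> wronskian p q holomorphic_on UNIV"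
  unfolding wronskian_def by (intro holomorphic_intros holomorphic_deriv) auto

text \<open>Near a point with \<open>q \<noteq> 0\<close> the quotient has derivative 0 and is
  constant; the identity theorem spreads the relation over the plane.\<close>

lemma wronskian_zero_imp_proportional:
  assumes "p holomorphic_on UNIV" "q holomorphic_on UNIV" "q x0 \<noteq> 0" "\<And>x. wronskian p q x = 0"
  obtains c where "\<And>x. p x = c * q x"
proof -
  have "eventually (\<lambda>x. q x \<noteq> 0) (nhds x0)"
  proof (rule tendsto_imp_eventually_ne)
    show "(q \<longlongrightarrow> q x0) (nhds x0)"
      using assms(2) continuous_on_tendsto_compose holomorphic_on_imp_continuous_on
      by (metis UNIV_I continuous_on_eq_continuous_at isCont_def open_UNIV tendsto_at_iff_tendsto_nhds)
  qed fact
  then obtain r where r: "r > 0" "\<And>x. x \<in> ball x0 r \<Longrightarrow> q x \<noteq> 0"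
    unfolding eventually_nhds_metric by (auto simp: dist_commute)
  have "\<exists>c. \<forall>x\<in>ball x0 r. p x / q x = c"
  proof (rule has_field_derivative_zero_constant)
    fix x assume "x \<in> ball x0 r"
    then have "((\<lambda>x. p x / q x) has_field_derivative wronskian p q x / (q x * q x)) (at x)"
      using r entire_deriv[OF assms(1)] entire_deriv[OF assms(2)] unfolding wronskian_def
      by (intro DERIV_divide) auto
    then show "((\<lambda>x. p x / q x) has_field_derivative 0) (at x within ball x0 r)"
      unfolding assms(4) by (simp add: has_field_derivative_at_within)
  qed auto
  then obtain c where c: "\<And>x. x \<in> ball x0 r \<Longrightarrow> p x - c * q x = 0"
    using r(2) by (auto simp: field_simps)
  have "p x - c * q x = 0" for x
  proof (rule ccontr)
    assume nz: "p x - c * q x \<noteq> 0"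
    have "eventually (\<lambda>x. p x - c * q x \<noteq> 0) (at x0)"
      by (rule entire_eventually_nonzero[of _ x]) (use assms nz in \<open>auto intro!: holomorphic_intros\<close>)
    moreover have "eventually (\<lambda>x. x \<in> ball x0 r) (at x0)"
      using r(1) by (intro eventually_at_in_open') auto
    ultimately have "eventually (\<lambda>x. False) (at x0)" by eventually_elim (use c in auto)
    then show False by simp
  qed
  then show ?thesis using that by (metis eq_iff_diff_eq_0)
qed

lemma proj_eq_iff:
  assumes "(a, b) \<noteq> (0, 0)" "(c, d) \<noteq> (0, 0)"
  shows "proj a b = proj c d \<longleftrightarrow> a * d = c * b"
  using assms unfolding proj_def by (auto simp: field_simps)

section \<open>The theta quotient \<open>f0\<close>: critical points, periods and fibres\<close>

context theta_pair
begin

definition E where "E x = exp (- (pi * \<i> * \<tau> / 2) - pi * \<i> * x)"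

abbreviation W where "W \<equiv> wronskian u v"

lemma E_nz [simp]: "E x \<noteq> 0" unfolding E_def by simp

lemma u_shift: "u (x + \<tau>) = E x * v x" and v_shift: "v (x + \<tau>) = E x * u x"
  using u_tau v_tau unfolding E_def by auto

lemma u_2: "u (x + 2) = u x" and v_2: "v (x + 2) = v x"
  using u_1[of "x + 1"] u_1[of x] v_1[of "x + 1"] v_1[of x] by (simp_all add: add.assoc)

lemma u_2tau: "u (x + 2 * \<tau>) = E (x + \<tau>) * E x * u x" and v_2tau: "v (x + 2 * \<tau>) = E (x + \<tau>) * E x * v x"
proof -
  have *: "x + 2 * \<tau> = (x + \<tau>) + \<tau>" by simp
  show "u (x + 2 * \<tau>) = E (x + \<tau>) * E x * u x" "v (x + 2 * \<tau>) = E (x + \<tau>) * E x * v x"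
    unfolding * u_shift[of "x + \<tau>"] v_shift[of "x + \<tau>"] unfolding u_shift v_shift by (simp_all only: mult.assoc)
qed

lemma u_nz: "\<exists>x. u x \<noteq> 0"
  using v_nz u_shift E_nz by (metis mult_eq_0_iff)

lemma W_hol: "W holomorphic_on UNIV" using wronskian_holomorphic u_hol v_hol by blast

lemma W_1: "W (x + 1) = - W x"
proof -
  have "((\<lambda>x. u (x + 1)) has_field_derivative - deriv u x) (at x)"
    unfolding u_1 by (intro derivative_intros entire_deriv[OF u_hol])
  then have 1: "deriv u (x + 1) = - deriv u x" using DERIV_shift DERIV_imp_deriv by blast
  have "((\<lambda>x. v (x + 1)) has_field_derivative deriv v x) (at x)"
    unfolding v_1 by (intro derivative_intros entire_deriv[OF v_hol])
  then have 2: "deriv v (x + 1) = deriv v x" using DERIV_shift DERIV_imp_deriv by blast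
  show ?thesis unfolding wronskian_def 1 2 u_1 v_1 by simp
qed

text \<open>The derivative of the automorphy factor \<open>E\<close> cancels in the Wronskian and
  leaves the multiplier -E^2, of degree one. The minus sign, due to the exchange of \<open>u\<close>
  and \<open>v\<close>, is absorbed into the exponent as \<open>pi * \<i>\<close>.\<close>

lemma W_tau: "W (x + \<tau>) = exp (- (2 * pi * \<i>) * x + (pi * \<i> - pi * \<i> * \<tau>)) * W x"
proof -
  have E: "(E has_field_derivative (- pi * \<i> * E x)) (at x)"
    unfolding E_def[abs_def] by (auto intro!: derivative_eq_intros)
  have "((\<lambda>x. u (x + \<tau>)) has_field_derivative - pi * \<i> * E x * v x + deriv v x * E x) (at x)"
    unfolding u_shift by (intro DERIV_mult E entire_deriv[OF v_hol])
  then have 1: "deriv u (x + \<tau>) = - pi * \<i> * E x * v x + deriv v x * E x"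
    using DERIV_shift DERIV_imp_deriv by blast
  have "((\<lambda>x. v (x + \<tau>)) has_field_derivative - pi * \<i> * E x * u x + deriv u x * E x) (at x)"
    unfolding v_shift by (intro DERIV_mult E entire_deriv[OF u_hol])
  then have 2: "deriv v (x + \<tau>) = - pi * \<i> * E x * u x + deriv u x * E x"
    using DERIV_shift DERIV_imp_deriv by blast
  have "W (x + \<tau>) = - (E x * E x) * W x"
    unfolding wronskian_def 1 2 u_shift v_shift by (simp add: algebra_simps)
  also have "E x * E x = exp (- (pi * \<i> * \<tau>) - 2 * pi * \<i> * x)"
  proof -
    have "(- (a / 2) - b) + (- (a / 2) - b) = - a - 2 * b" for a b :: complex by simp
    from this[of "pi * \<i> * \<tau>" "pi * \<i> * x"] show ?thesis
      unfolding E_def mult_exp_exp by (simp add: ac_simps)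
  qed
  also have "- \<dots> = exp (pi * \<i> + (- (pi * \<i> * \<tau>) - 2 * pi * \<i> * x))" by (simp only: exp_add exp_pi_i mult_minus_left mult_1_left)
  also have "pi * \<i> + (- (pi * \<i> * \<tau>) - 2 * pi * \<i> * x) = - (2 * pi * \<i>) * x + (pi * \<i> - pi * \<i> * \<tau>)"
    by simp
  finally show ?thesis .
qed

text \<open>If \<open>u = c * v\<close>, the sign change of \<open>u\<close> under translation by 1
  gives \<open>c = - c\<close>.\<close>

lemma W_nz: "\<exists>x. W x \<noteq> 0"
proof (rule ccontr)
  assume "\<nexists>x. W x \<noteq> 0"
  moreover obtain x0 where x0: "v x0 \<noteq> 0" using v_nz by blast
  ultimately obtain c where c: "\<And>x. u x = c * v x"
    using wronskian_zero_imp_proportional[OF u_hol v_hol x0] by metis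
  have "- (c * v x0) = c * v x0" using u_1[of x0] v_1[of x0] c by metis
  then have "c = 0" using x0 by simp
  then show False using c u_nz by simp
qed

lemma deriv_even_0:
  assumes "f holomorphic_on UNIV" "\<And>x. f (- x) = f x"
  shows "deriv f 0 = 0"
proof -
  have "((\<lambda>x. f (- x)) has_field_derivative deriv f (- 0) * (- 1)) (at 0)"
    by (rule DERIV_chain2[where f = f and g = uminus]) (auto intro!: entire_deriv assms derivative_eq_intros)
  then have "deriv f 0 = - deriv f 0" unfolding assms(2) by (auto dest: DERIV_imp_deriv)
  then show ?thesis by simp
qed

text \<open>Evenness of \<open>u\<close> and \<open>v\<close> makes \<open>W\<close> vanish at 0,
  and degree one leaves no room for another zero modulo the lattice or for a higher order.\<close>

lemma W_zorder: "zorder W x = (if x \<in> lattice \<tau> then 1 else 0)"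
proof -
  have W0: "W 0 = 0"
    unfolding wronskian_def using deriv_even_0[OF u_hol u_even] deriv_even_0[OF v_hol v_even] by simp
  obtain z0 where z0: "W z0 \<noteq> 0" using W_nz by blast
  obtain n where n: "\<And>x. n (coset \<tau> x) = zorder W x" "\<And>c. c \<in> curve \<tau> \<Longrightarrow> n c \<ge> 0"
    "\<And>B. finite B \<Longrightarrow> B \<subseteq> curve \<tau> \<Longrightarrow> (\<Sum>c\<in>B. n c) \<le> int 1"
    by (rule theta_function_zeros[OF tau W_hol W_nz, of "pi * \<i>" 1 "pi * \<i> - pi * \<i> * \<tau>"])
       (use W_1 W_tau in auto)
  have "zorder W 0 > 0"
    using W0 zorder_pos_iff'[OF entire_analytic[OF W_hol] eventually_frequently[OF _ entire_eventually_nonzero[OF W_hol z0]]] by simp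
  then have 0: "n (coset \<tau> 0) \<ge> 1" using n(1) by simp
  have 1: "n (coset \<tau> 0) \<le> 1" using n(3)[of "{coset \<tau> 0}"] by simp
  show ?thesis
  proof (cases "x \<in> lattice \<tau>")
    case True
    then have "coset \<tau> 0 = coset \<tau> x" by (simp add: coset_eq_iff)
    then show ?thesis using True 0 1 n(1) by (metis order_antisym)
  next
    case False
    then have ne: "coset \<tau> 0 \<noteq> coset \<tau> x" by (simp add: coset_eq_iff)
    then have "n (coset \<tau> 0) + n (coset \<tau> x) \<le> 1"
      using n(3)[of "{coset \<tau> 0, coset \<tau> x}"] by simp
    moreover have "n (coset \<tau> x) \<ge> 0" using n(2) by (auto simp: curve_iff)
    ultimately have "n (coset \<tau> x) = 0" using 0 by linarith
    then show ?thesis using False n(1) by simp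
  qed
qed

lemma W_eq_0_iff: "W x = 0 \<longleftrightarrow> x \<in> lattice \<tau>"
proof -
  obtain z0 where z0: "W z0 \<noteq> 0" using W_nz by blast
  show ?thesis
    using zorder_eq_0_iff[OF entire_analytic[OF W_hol] eventually_frequently[OF _ entire_eventually_nonzero[OF W_hol z0]], of x]
      W_zorder[of x] by (auto split: if_splits)
qed

lemma deriv_W_0: "deriv W 0 \<noteq> 0"
proof
  assume "deriv W 0 = 0"
  moreover obtain z0 where z0: "W z0 \<noteq> 0" using W_nz by blast
  moreover have "W 0 = 0" using W_eq_0_iff by simp
  ultimately have "zorder W 0 \<ge> 2" using zorder_ge_2[OF W_hol z0] by blast
  then show False using W_zorder[of 0] by simp
qed

text \<open>A common zero of \<open>u\<close> and \<open>v\<close> would be a zero of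
  \<open>W\<close> of order at least two, but all zeros of \<open>W\<close> are simple.\<close>

lemma no_common_zero: "(u x, v x) \<noteq> (0, 0)"
proof
  assume "(u x, v x) = (0, 0)"
  then have uv: "u x = 0" "v x = 0" by auto
  have "(W has_field_derivative (deriv (deriv u) x * v x + deriv v x * deriv u x
      - (deriv u x * deriv v x + deriv (deriv v) x * u x))) (at x)"
    unfolding wronskian_def[abs_def]
    by (intro DERIV_diff DERIV_mult entire_deriv u_hol v_hol holomorphic_deriv) auto
  then have "deriv W x = 0" using uv by (auto dest: DERIV_imp_deriv simp: mult.commute)
  moreover have "W x = 0" using uv unfolding wronskian_def by simp
  moreover obtain z0 where z0: "W z0 \<noteq> 0" using W_nz by blast
  ultimately have "zorder W x \<ge> 2" using zorder_ge_2[OF W_hol z0] by blast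
  then show False using W_zorder[of x] by (simp split: if_splits)
qed

definition f0 :: "complex \<Rightarrow> sphere" where "f0 x = proj (u x) (v x)"

lemma f0_eq_iff: "f0 x = f0 y \<longleftrightarrow> u x * v y = u y * v x"
  unfolding f0_def by (rule proj_eq_iff[OF no_common_zero no_common_zero])

text \<open>The zeros of \<open>fibre_theta a b\<close> are the halves of the points where \<open>f0\<close> takes the value \<open>[a : b]\<close>; the factor
  \<open>2\<close> turns the lattice \<open>2\<Lambda>\<close> of periods of \<open>f0\<close> into \<open>\<Lambda>\<close>.\<close>

definition fibre_theta where "fibre_theta a b x = u (2 * x) * b - v (2 * x) * a"

lemma fibre_theta_props:
  assumes "(a, b) \<noteq> (0, 0)"
  shows "fibre_theta a b holomorphic_on UNIV" "\<exists>x. fibre_theta a b x \<noteq> 0"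
    "fibre_theta a b (x + 1) = exp 0 * fibre_theta a b x"
    "fibre_theta a b (x + \<tau>) = exp (- (2 * pi * \<i> * of_nat 2) * x + (- (2 * pi * \<i> * \<tau>))) * fibre_theta a b x"
proof -
  show "fibre_theta a b holomorphic_on UNIV"
    unfolding fibre_theta_def
    by (intro holomorphic_intros holomorphic_on_compose[OF _ holomorphic_on_subset[OF u_hol], unfolded o_def]
      holomorphic_on_compose[OF _ holomorphic_on_subset[OF v_hol], unfolded o_def]) auto
  show "\<exists>x. fibre_theta a b x \<noteq> 0"
  proof (rule ccontr)
    assume "\<nexists>x. fibre_theta a b x \<noteq> 0"
    then have *: "u x * b = v x * a" for x
      using fibre_theta_def[of a b "x / 2"] by auto
    \<comment> \<open>Translation by 1 flips the sign of \<open>u\<close> only, which separates the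
      two terms.\<close>
    then have **: "- u x * b = v x * a" for x using *[of "x + 1"] unfolding u_1 v_1 by simp
    have "u x * b = 0" for x using trans[OF **[of x] *[of x, symmetric]] by auto
    moreover from this have "v x * a = 0" for x using * by simp
    ultimately show False using u_nz v_nz assms by auto
  qed
  show "fibre_theta a b (x + 1) = exp 0 * fibre_theta a b x"
    unfolding fibre_theta_def distrib_left using u_2 v_2 by simp
  have "E (y + \<tau>) * E y = exp (- (2 * pi * \<i> * y) + (- (2 * pi * \<i> * \<tau>)))" for y
  proof -
    have "(- (a / 2) - (b + a)) + (- (a / 2) - b) = - (2 * b) + - (2 * a)" for a b :: complex by simp
    from this[of "pi * \<i> * \<tau>" "pi * \<i> * y"] show ?thesis
      unfolding E_def mult_exp_exp distrib_left by (simp only: mult.assoc of_real_mult of_real_numeral)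
  qed
  from this[of "2 * x"] have E2: "E (2 * x + \<tau>) * E (2 * x) = exp (- (2 * pi * \<i> * of_nat 2) * x + (- (2 * pi * \<i> * \<tau>)))"
    by (simp add: algebra_simps)
  have "fibre_theta a b (x + \<tau>) = E (2 * x + \<tau>) * E (2 * x) * fibre_theta a b x"
    unfolding fibre_theta_def distrib_left u_2tau v_2tau by (simp add: algebra_simps)
  then show "fibre_theta a b (x + \<tau>) = exp (- (2 * pi * \<i> * of_nat 2) * x + (- (2 * pi * \<i> * \<tau>))) * fibre_theta a b x"
    unfolding E2 .
qed

lemma f0_surj:
  obtains x where "f0 x = z"
proof -
  obtain a b where ab: "(a, b) \<noteq> (0, 0)" "proj a b = z"
    by (cases z) (auto simp: proj_def intro: that[of 1 0] that[of _ 1])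
  note k = fibre_theta_props[OF ab(1)]
  obtain n x where "\<And>x. n (coset \<tau> x) = zorder (fibre_theta a b) x" "fibre_theta a b x = 0"
    by (rule theta_function_zeros[OF tau k]) auto
  then have "u (2 * x) * b = a * v (2 * x)" unfolding fibre_theta_def by (simp add: mult.commute)
  then have "f0 (2 * x) = z"
    unfolding f0_def ab(2)[symmetric] using proj_eq_iff[OF no_common_zero ab(1)] by blast
  then show ?thesis using that by blast
qed

lemma f0_uminus [simp]: "f0 (- x) = f0 x"
  unfolding f0_def u_even v_even ..

lemma f0_2lattice:
  assumes "l \<in> lattice \<tau>" shows "f0 (x + 2 * l) = f0 x"
proof -
  define g where "g y = f0 (2 * y)" for y
  have "g (y + 1) = g y" "g (y + \<tau>) = g y" for y
  proof -
    show "g (y + 1) = g y" unfolding g_def f0_def distrib_left using u_2 v_2 by simp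
    show "g (y + \<tau>) = g y" unfolding g_def f0_eq_iff distrib_left u_2tau v_2tau by simp
  qed
  from lattice_periodic[of g, OF this assms, of "x / 2"] show ?thesis unfolding g_def distrib_left by simp
qed

text \<open>A zero count: \<open>fibre_theta (u y) (v y)\<close> has at most two zeros modulo the
  lattice, and \<open>y / 2\<close> and \<open>- y / 2\<close> already are zeros. Any other point
  with the same value would give a third one.\<close>

lemma f0_eq_lattice_iff:
  "f0 x = f0 y \<longleftrightarrow> (\<exists>l\<in>lattice \<tau>. x = y + 2 * l \<or> x = - y + 2 * l)"
proof
  assume "\<exists>l\<in>lattice \<tau>. x = y + 2 * l \<or> x = - y + 2 * l"
  then show "f0 x = f0 y" using f0_2lattice f0_uminus by metis
next
  assume eq: "f0 x = f0 y"
  note k = fibre_theta_props[OF no_common_zero[of y]]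
  let ?k = "fibre_theta (u y) (v y)"
  obtain z0 where z0: "?k z0 \<noteq> 0" using k(2) by blast
  obtain n where n: "\<And>x. n (coset \<tau> x) = zorder ?k x" 
    "\<And>B. finite B \<Longrightarrow> B \<subseteq> curve \<tau> \<Longrightarrow> (\<Sum>c\<in>B. n c) \<le> int 2"
    by (rule theta_function_zeros[OF tau k]) auto
  have pos: "n (coset \<tau> z) \<ge> 1" if "?k z = 0" for z
    using that n(1) zorder_pos_iff'[OF entire_analytic[OF k(1)] eventually_frequently[OF _ entire_eventually_nonzero[OF k(1) z0]], of z]
    by simp
  have zeros: "?k (x / 2) = 0" "?k (y / 2) = 0" "?k (- y / 2) = 0"
    using eq f0_eq_iff[of x y] u_even[of y] v_even[of y] unfolding fibre_theta_def by (simp_all add: mult.commute)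
  show "\<exists>l\<in>lattice \<tau>. x = y + 2 * l \<or> x = - y + 2 * l"
  proof (cases "coset \<tau> (y / 2) = coset \<tau> (x / 2) \<or> coset \<tau> (- y / 2) = coset \<tau> (x / 2)")
    case True
    then show ?thesis
    proof
      assume "coset \<tau> (y / 2) = coset \<tau> (x / 2)"
      then have "x / 2 - y / 2 \<in> lattice \<tau>" by (simp add: coset_eq_iff)
      then show ?thesis by (intro bexI[of _ "x / 2 - y / 2"]) (simp_all add: field_simps)
    next
      assume "coset \<tau> (- y / 2) = coset \<tau> (x / 2)"
      then have "x / 2 + y / 2 \<in> lattice \<tau>" by (simp add: coset_eq_iff)
      then show ?thesis by (intro bexI[of _ "x / 2 + y / 2"]) (simp_all add: field_simps)
    qed
  next
    case False
    then have ne: "coset \<tau> (y / 2) \<noteq> coset \<tau> (x / 2)" "coset \<tau> (- y / 2) \<noteq> coset \<tau> (x / 2)" by auto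
    then have "n (coset \<tau> (y / 2)) + n (coset \<tau> (x / 2)) \<le> 2"
      using n(2)[of "{coset \<tau> (y / 2), coset \<tau> (x / 2)}"] by simp
    moreover have "n (coset \<tau> (x / 2)) \<ge> 1" using pos zeros by blast
    ultimately have y1: "n (coset \<tau> (y / 2)) \<le> 1" by simp
    \<comment> \<open>For a lattice point \<open>y\<close> the zeros \<open>y / 2\<close> and
      \<open>- y / 2\<close> coincide modulo the lattice, but then \<open>W y = 0\<close> makes the
      zero double, which exceeds the count as well.\<close>
    have "y \<notin> lattice \<tau>"
    proof
      assume "y \<in> lattice \<tau>"
      then have W: "W y = 0" by (simp add: W_eq_0_iff)
      have "(?k has_field_derivative (deriv u (2 * (y / 2)) * 2 * v y - deriv v (2 * (y / 2)) * 2 * u y)) (at (y / 2))"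
        unfolding fibre_theta_def[abs_def]
        by (intro DERIV_diff DERIV_cmult_right DERIV_chain2[where f = u] DERIV_chain2[where f = v] entire_deriv u_hol v_hol)
           (auto intro!: derivative_eq_intros)
      then have "deriv ?k (y / 2) = 2 * W y" unfolding wronskian_def by (auto dest!: DERIV_imp_deriv)
      then have "zorder ?k (y / 2) \<ge> 2" using zorder_ge_2[OF k(1) z0 zeros(2)] W by simp
      then show False using y1 n(1) by simp
    qed
    then have "coset \<tau> (y / 2) \<noteq> coset \<tau> (- y / 2)"
      unfolding coset_eq_iff by simp
    then have "n (coset \<tau> (y / 2)) + n (coset \<tau> (- y / 2)) + n (coset \<tau> (x / 2)) \<le> 2"
      using n(2)[of "{coset \<tau> (y / 2), coset \<tau> (- y / 2), coset \<tau> (x / 2)}"] ne by simp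
    then show ?thesis using pos[OF zeros(1)] pos[OF zeros(2)] pos[OF zeros(3)] by simp
  qed
qed

end

section \<open>Equivariant maps with one simple critical point\<close>

lemma remove_sings_shift: "remove_sings f (x + w) = remove_sings (\<lambda>y. f (y + w)) x"
  using remove_sings_shift_0[of f "x + w"] remove_sings_shift_0[of "\<lambda>y. f (y + w)" x]
  by (simp add: ac_simps)

text \<open>After removal of its singularities the function is entire and doubly periodic, hence
  constant, and the limit at \<open>a\<close> identifies the constant. Since \<open>h\<close> may
  have arbitrary values at its singularities, the conclusion speaks of punctured
  neighbourhoods.\<close>

lemma elliptic_without_poles_zero:
  assumes "Im \<tau> \<noteq> 0" "h meromorphic_on UNIV" "\<And>x. h (x + 1) = h x" "\<And>x. h (x + \<tau>) = h x"
    and "\<And>x. \<not> is_pole h x" "(h \<longlongrightarrow> 0) (at a)"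
  shows "eventually (\<lambda>y. h y = 0) (at x)"
proof -
  have iso: "isolated_singularity_at h x" and ess: "not_essential h x" for x
    using assms(2) meromorphic_at_iff meromorphic_on_subset by blast+
  have "remove_sings h analytic_on {x}" for x
  proof -
    obtain c where "(h \<longlongrightarrow> c) (at x)" using ess[of x] assms(5)[of x] unfolding not_essential_def by blast
    then show ?thesis using iso remove_sings_analytic_at by blast
  qed
  then have hol: "remove_sings h holomorphic_on UNIV"
    using analytic_imp_holomorphic analytic_on_analytic_at by blast
  have "remove_sings h x = remove_sings h a" for x
    by (rule doubly_periodic_entire_constant[OF assms(1) hol]) (simp_all add: remove_sings_shift assms(3,4))
  moreover have "remove_sings h a = 0" using assms(6) by (rule remove_sings_eqI)
  ultimately have "remove_sings h = (\<lambda>_. 0)" by auto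
  then show ?thesis using eventually_remove_sings_eq_at[OF iso, of x] by simp
qed

lemma entire_meromorphic: "h holomorphic_on UNIV \<Longrightarrow> h meromorphic_on A"
  using entire_analytic analytic_on_imp_meromorphic_on by blast

lemma entire_factor_zero:
  assumes "f holomorphic_on UNIV" "f 0 = 0"
  obtains g where "g holomorphic_on UNIV" "\<And>x. f x = x * g x" "g 0 = deriv f 0"
proof -
  define g where "g x = (if x = 0 then deriv f 0 else f x / x)" for x
  have "g holomorphic_on UNIV"
    by (rule pole_theorem_0[OF assms(1), of 0]) (use assms(2) in \<open>auto simp: g_def\<close>)
  then show ?thesis
    by (rule that) (use assms(2) in \<open>auto simp: g_def\<close>)
qed

lemma wronskian_shift:
  assumes "p holomorphic_on UNIV" "q holomorphic_on UNIV"
  shows "wronskian (\<lambda>x. p (x + w)) (\<lambda>x. q (x + w)) x = wronskian p q (x + w)"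
proof -
  have "deriv (\<lambda>x. f (x + w)) x = deriv f (x + w)" if "f holomorphic_on UNIV" for f
    using entire_deriv[OF that, of "x + w"] DERIV_shift DERIV_imp_deriv by blast
  then show ?thesis using assms unfolding wronskian_def by simp
qed

lemma holomorphic_shift: "p holomorphic_on UNIV \<Longrightarrow> (\<lambda>x. p (x + w)) holomorphic_on (UNIV :: complex set)"
  by (rule holomorphic_on_compose[of "\<lambda>x. x + w" UNIV p, unfolded o_def])
     (auto intro!: holomorphic_intros elim: holomorphic_on_subset)

lemma holomorphic_reflect: "p holomorphic_on UNIV \<Longrightarrow> (\<lambda>x. p (- x)) holomorphic_on (UNIV :: complex set)"
  by (rule holomorphic_on_compose[of "\<lambda>x. - x" UNIV p, unfolded o_def])
     (auto intro!: holomorphic_intros elim: holomorphic_on_subset)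

text \<open>Two lifts of the same map to the sphere differ by a factor \<open>l\<close>, and the
  derivative of that factor drops out of the Wronskian. Working at a single point with the
  differentiated relation Pq = pQ avoids the question whether \<open>l\<close> is holomorphic across
  zeros of \<open>q\<close>.\<close>

lemma wronskian_rescale:
  assumes hol: "p holomorphic_on UNIV" "q holomorphic_on UNIV" "P holomorphic_on UNIV" "Q holomorphic_on UNIV"
    and nz: "(p x, q x) \<noteq> (0, 0)" "(P x, Q x) \<noteq> (0, 0)" and eq: "\<And>y. P y * q y = p y * Q y"
  obtains l where "l \<noteq> 0" "P x = l * p x" "Q x = l * q x" "wronskian P Q x = l\<^sup>2 * wronskian p q x"
proof -
  have "((\<lambda>y. P y * q y) has_field_derivative deriv P x * q x + deriv q x * P x) (at x)"
    by (intro DERIV_mult entire_deriv hol)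
  moreover have "((\<lambda>y. p y * Q y) has_field_derivative deriv p x * Q x + deriv Q x * p x) (at x)"
    by (intro DERIV_mult entire_deriv hol)
  ultimately have D: "deriv P x * q x + deriv q x * P x = deriv p x * Q x + deriv Q x * p x"
    unfolding eq by (rule DERIV_unique)
  show ?thesis
  proof (cases "q x = 0")
    case False
    define l where "l = Q x / q x"
    have Q: "Q x = l * q x" using False by (simp add: l_def)
    have P: "P x = l * p x" using eq[of x] False by (simp add: l_def field_simps)
    have "wronskian P Q x = l * (deriv P x * q x - deriv Q x * p x)"
      unfolding wronskian_def P Q by (simp add: algebra_simps)
    also have "deriv P x * q x - deriv Q x * p x = deriv p x * Q x - deriv q x * P x"
      using D by (simp add: algebra_simps)
    also have "l * (deriv p x * Q x - deriv q x * P x) = l\<^sup>2 * wronskian p q x"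
      unfolding wronskian_def P Q by (simp add: algebra_simps power2_eq_square)
    finally show ?thesis using that[of l] P Q nz(2) by auto
  next
    case True
    then have p: "p x \<noteq> 0" using nz by auto
    then have Q0: "Q x = 0" using eq[of x] True by simp
    define l where "l = P x / p x"
    have P: "P x = l * p x" using p by (simp add: l_def)
    have "deriv Q x = l * deriv q x" using D True Q0 p by (simp add: l_def field_simps)
    then have "wronskian P Q x = l\<^sup>2 * wronskian p q x"
      unfolding wronskian_def True Q0 P by (simp add: power2_eq_square)
    then show ?thesis using that[of l] P Q0 True nz(2) by auto
  qed
qed

text \<open>Homogeneous coordinates \<open>[p : q]\<close> of a map \<open>f\<close> to the sphere with \<open>f (x + 1) = - f x\<close> and
  \<open>f (x + \<tau>) = 1 / f x\<close>; its critical points are the zeros of the Wronskian.\<close>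

definition equivariant_lift :: "complex \<Rightarrow> (complex \<Rightarrow> complex) \<Rightarrow> (complex \<Rightarrow> complex) \<Rightarrow> bool" where
  "equivariant_lift \<tau> p q \<longleftrightarrow> p holomorphic_on UNIV \<and> q holomorphic_on UNIV \<and>
     (\<forall>x. (p x, q x) \<noteq> (0, 0)) \<and> (\<forall>x. p (x + 1) * q x = - p x * q (x + 1)) \<and>
     (\<forall>x. p (x + \<tau>) * p x = q x * q (x + \<tau>))"

lemma wronskian_swap: "wronskian q p x = - wronskian p q x"
  unfolding wronskian_def by simp

lemma wronskian_uminus1:
  assumes "p holomorphic_on UNIV"
  shows "wronskian (\<lambda>x. - p x) q x = - wronskian p q x"
proof -
  have "deriv (\<lambda>x. - p x) x = - deriv p x"
    by (intro DERIV_imp_deriv derivative_intros entire_deriv assms)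
  then show ?thesis unfolding wronskian_def by simp
qed

text \<open>The translated lift is compared with \<open>(- p, q)\<close>, a lift of the transformed
  map. The sign in the Wronskian is the determinant of z -> -z; for \<tau> it is that of z ->
  1/z.\<close>

lemma equivariant_lift_1:
  assumes "equivariant_lift \<tau> p q"
  obtains l where "l \<noteq> 0" "p (x + 1) = - l * p x" "q (x + 1) = l * q x" "wronskian p q (x + 1) = - l\<^sup>2 * wronskian p q x"
proof -
  have hol: "p holomorphic_on UNIV" "q holomorphic_on UNIV" and nz: "\<And>x. (p x, q x) \<noteq> (0, 0)"
    and eq: "\<And>x. p (x + 1) * q x = - p x * q (x + 1)"
    using assms unfolding equivariant_lift_def by auto
  obtain l where "l \<noteq> 0" "p (x + 1) = l * - p x" "q (x + 1) = l * q x"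
    "wronskian (\<lambda>x. p (x + 1)) (\<lambda>x. q (x + 1)) x = l\<^sup>2 * wronskian (\<lambda>x. - p x) q x"
    by (rule wronskian_rescale[of "\<lambda>x. - p x" q "\<lambda>x. p (x + 1)" "\<lambda>x. q (x + 1)" x])
       (use hol nz eq in \<open>auto intro: holomorphic_intros holomorphic_shift\<close>)
  then show ?thesis
    using that[of l] hol by (simp add: wronskian_shift wronskian_uminus1)
qed

lemma equivariant_lift_tau:
  assumes "equivariant_lift \<tau> p q"
  obtains l where "l \<noteq> 0" "p (x + \<tau>) = l * q x" "q (x + \<tau>) = l * p x" "wronskian p q (x + \<tau>) = - l\<^sup>2 * wronskian p q x"
proof -
  have hol: "p holomorphic_on UNIV" "q holomorphic_on UNIV" and nz: "\<And>x. (p x, q x) \<noteq> (0, 0)"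
    and eq: "\<And>x. p (x + \<tau>) * p x = q x * q (x + \<tau>)"
    using assms unfolding equivariant_lift_def by auto
  have nz': "(q x, p x) \<noteq> (0, 0)" using nz[of x] by auto
  obtain l where "l \<noteq> 0" "p (x + \<tau>) = l * q x" "q (x + \<tau>) = l * p x"
    "wronskian (\<lambda>x. p (x + \<tau>)) (\<lambda>x. q (x + \<tau>)) x = l\<^sup>2 * wronskian q p x"
    using wronskian_rescale[OF hol(2,1) holomorphic_shift[OF hol(1)] holomorphic_shift[OF hol(2)] nz' nz eq] .
  then show ?thesis
    using that[of l] hol by (simp add: wronskian_shift wronskian_swap[of q p])
qed

text \<open>For \<open>f = p / q\<close> and \<open>h = a / b\<close> this is \<open>(f - h)\<^sup>2 / (f' h')\<close>, which is unchanged when the same Moebius map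
  is applied to \<open>f\<close> and \<open>h\<close>.\<close>

definition comparison ::
    "(complex \<Rightarrow> complex) \<Rightarrow> (complex \<Rightarrow> complex) \<Rightarrow> (complex \<Rightarrow> complex) \<Rightarrow> (complex \<Rightarrow> complex) \<Rightarrow> complex \<Rightarrow> complex" where
  "comparison p q a b x = (p x * b x - q x * a x)\<^sup>2 / (wronskian p q x * wronskian a b x)"

text \<open>The rescaling factors of numerator and denominator agree, and the signs from the two
  Wronskians cancel.\<close>

lemma comparison_periodic:
  assumes "equivariant_lift \<tau> p q" "equivariant_lift \<tau> a b"
  shows "comparison p q a b (x + 1) = comparison p q a b x"
    "comparison p q a b (x + \<tau>) = comparison p q a b x"
proof -
  have scale: "(l * m)\<^sup>2 * A / ((- l\<^sup>2 * B) * (- m\<^sup>2 * C)) = A / (B * C)" if "l \<noteq> 0" "m \<noteq> 0" for l m A B C :: complex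
    using that by (simp add: power_mult_distrib)
  show "comparison p q a b (x + 1) = comparison p q a b x"
  proof -
    obtain l where l: "l \<noteq> 0" "p (x + 1) = - l * p x" "q (x + 1) = l * q x"
      "wronskian p q (x + 1) = - l\<^sup>2 * wronskian p q x"
      by (rule equivariant_lift_1[OF assms(1)])
    obtain m where m: "m \<noteq> 0" "a (x + 1) = - m * a x" "b (x + 1) = m * b x"
      "wronskian a b (x + 1) = - m\<^sup>2 * wronskian a b x"
      by (rule equivariant_lift_1[OF assms(2)])
    have "(p (x + 1) * b (x + 1) - q (x + 1) * a (x + 1))\<^sup>2 = (l * m)\<^sup>2 * (p x * b x - q x * a x)\<^sup>2"
      unfolding l m by (simp add: algebra_simps power2_eq_square)
    then show ?thesis unfolding comparison_def l(4) m(4) using scale[OF l(1) m(1)] by simp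
  qed
  show "comparison p q a b (x + \<tau>) = comparison p q a b x"
  proof -
    obtain l where l: "l \<noteq> 0" "p (x + \<tau>) = l * q x" "q (x + \<tau>) = l * p x"
      "wronskian p q (x + \<tau>) = - l\<^sup>2 * wronskian p q x"
      by (rule equivariant_lift_tau[OF assms(1)])
    obtain m where m: "m \<noteq> 0" "a (x + \<tau>) = m * b x" "b (x + \<tau>) = m * a x"
      "wronskian a b (x + \<tau>) = - m\<^sup>2 * wronskian a b x"
      by (rule equivariant_lift_tau[OF assms(2)])
    have "(p (x + \<tau>) * b (x + \<tau>) - q (x + \<tau>) * a (x + \<tau>))\<^sup>2 = (l * m)\<^sup>2 * (p x * b x - q x * a x)\<^sup>2"
      unfolding l m by (simp add: algebra_simps power2_eq_square)
    then show ?thesis unfolding comparison_def l(4) m(4) using scale[OF l(1) m(1)] by simp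
  qed
qed

section \<open>Rigidity of maps with one simple critical point\<close>

lemma is_pole_periodic:
  fixes h :: "complex \<Rightarrow> complex"
  assumes "\<And>x. h (x + w) = h x" shows "is_pole h (x + w) \<longleftrightarrow> is_pole h x"
proof -
  have "h \<circ> (+) w = h" using assms by (auto simp: add.commute)
  then show ?thesis using is_pole_shift_iff[of h w x] by simp
qed

text \<open>The normal form of a lift of a section of self-intersection 1: the critical point has
  been translated to 0, and the nonzero derivative of the Wronskian says that it is simple.\<close>

definition simple_critical :: "complex \<Rightarrow> (complex \<Rightarrow> complex) \<Rightarrow> (complex \<Rightarrow> complex) \<Rightarrow> bool" where
  "simple_critical \<tau> p q \<longleftrightarrow> equivariant_lift \<tau> p q \<and>
     (\<forall>x. wronskian p q x = 0 \<longleftrightarrow> x \<in> lattice \<tau>) \<and> deriv (wronskian p q) 0 \<noteq> 0"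

lemma simple_critical_wronskian_factor:
  assumes "simple_critical \<tau> p q"
  obtains w where "w holomorphic_on UNIV" "\<And>x. wronskian p q x = x * w x" "w 0 \<noteq> 0"
proof -
  have "wronskian p q holomorphic_on UNIV" "wronskian p q 0 = 0" "deriv (wronskian p q) 0 \<noteq> 0"
    using assms wronskian_holomorphic unfolding simple_critical_def equivariant_lift_def by auto
  then show ?thesis using entire_factor_zero[of "wronskian p q"] that by metis
qed

lemma entire_isCont: "f holomorphic_on UNIV \<Longrightarrow> isCont f x"
  using holomorphic_on_imp_continuous_on continuous_on_eq_continuous_at open_UNIV by blast

lemma half_not_in_lattice:
  assumes "Im \<tau> \<noteq> 0"
  shows "1 / 2 \<notin> lattice \<tau>" "\<tau> / 2 \<notin> lattice \<tau>" "\<tau> / 2 + 1 / 2 \<notin> lattice \<tau>"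
proof -
  have h: "(1 / 2 :: real) \<notin> \<int>" using fraction_not_in_Ints[of 2 1] by simp
  have "coord1 \<tau> (1 / 2) = 1 / 2" "coord2 \<tau> (\<tau> / 2) = 1 / 2" "coord2 \<tau> (\<tau> / 2 + 1 / 2) = 1 / 2"
    using assms by (simp_all add: coord1_def coord2_def)
  then show "1 / 2 \<notin> lattice \<tau>" "\<tau> / 2 \<notin> lattice \<tau>" "\<tau> / 2 + 1 / 2 \<notin> lattice \<tau>"
    using h unfolding coord_lattice[OF assms] by metis+
qed

text \<open>Compare [p : q] with its reflection [a : b]. The numerator \<open>N\<close> vanishes at
  0 together with its derivative, which is \<open>2 * wronskian p q 0\<close>, so its square has
  order at least 4 there, while the denominator has order 2. The comparison function then has no
  poles and tends to 0 at 0, so it vanishes.\<close>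

lemma simple_critical_even:
  assumes tau: "Im \<tau> \<noteq> 0" and crit: "simple_critical \<tau> p q"
  shows "p x * q (- x) = q x * p (- x)"
proof -
  have hol: "p holomorphic_on UNIV" "q holomorphic_on UNIV" and nz: "\<And>x. (p x, q x) \<noteq> (0, 0)"
    and eq: "\<And>x. p (x + 1) * q x = - p x * q (x + 1)" "\<And>x. p (x + \<tau>) * p x = q x * q (x + \<tau>)"
    and lift: "equivariant_lift \<tau> p q" and W0: "\<And>x. wronskian p q x = 0 \<longleftrightarrow> x \<in> lattice \<tau>"
    using crit unfolding simple_critical_def equivariant_lift_def by auto
  define a b where "a x = p (- x)" and "b x = q (- x)" for x
  have hol': "a holomorphic_on UNIV" "b holomorphic_on UNIV"
    unfolding a_def b_def using hol by (auto intro: holomorphic_reflect)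
  have lift': "equivariant_lift \<tau> a b"
    unfolding equivariant_lift_def
  proof (intro conjI allI hol')
    fix x
    show "(a x, b x) \<noteq> (0, 0)" using nz unfolding a_def b_def by blast
    show "a (x + 1) * b x = - a x * b (x + 1)"
      using eq(1)[of "- x - 1"] unfolding a_def b_def by simp
    show "a (x + \<tau>) * a x = b x * b (x + \<tau>)"
      using eq(2)[of "- x - \<tau>"] unfolding a_def b_def by (simp add: mult.commute)
  qed
  have da: "deriv a x = - deriv p (- x)" "deriv b x = - deriv q (- x)" for x
  proof -
    have "((\<lambda>x. f (- x)) has_field_derivative deriv f (- x) * (- 1)) (at x)" if "f holomorphic_on UNIV" for f
      by (rule DERIV_chain2[where f = f and g = uminus]) (auto intro!: entire_deriv that derivative_eq_intros)
    then show "deriv a x = - deriv p (- x)" "deriv b x = - deriv q (- x)"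
      using hol unfolding a_def[abs_def] b_def[abs_def] by (auto intro!: DERIV_imp_deriv)
  qed
  have W': "wronskian a b x = - wronskian p q (- x)" for x
    unfolding wronskian_def da by (simp add: a_def b_def)
  define N where "N x = p x * b x - q x * a x" for x
  have N_hol: "N holomorphic_on UNIV" unfolding N_def by (intro holomorphic_intros hol hol')
  have N0: "N 0 = 0" unfolding N_def a_def b_def by simp
  have "(N has_field_derivative (deriv p 0 * b 0 + deriv b 0 * p 0) - (deriv q 0 * a 0 + deriv a 0 * q 0)) (at 0)"
    unfolding N_def[abs_def] by (intro DERIV_diff DERIV_mult entire_deriv hol hol')
  then have "deriv N 0 = 2 * wronskian p q 0"
    unfolding da wronskian_def by (auto dest!: DERIV_imp_deriv simp: a_def b_def algebra_simps)
  then have dN0: "deriv N 0 = 0" using W0[of 0] by simp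
  obtain N1 where N1: "N1 holomorphic_on UNIV" "\<And>x. N x = x * N1 x" "N1 0 = deriv N 0"
    using entire_factor_zero[OF N_hol N0] by metis
  obtain N2 where N2: "N2 holomorphic_on UNIV" "\<And>x. N1 x = x * N2 x"
    using entire_factor_zero[OF N1(1)] N1(3) dN0 by metis
  obtain w where w: "w holomorphic_on UNIV" "\<And>x. wronskian p q x = x * w x" "w 0 \<noteq> 0"
    using simple_critical_wronskian_factor[OF crit] by blast
  define h where "h = comparison p q a b"
  have h: "h x = (N x)\<^sup>2 / (wronskian p q x * wronskian a b x)" for x
    unfolding h_def comparison_def N_def ..
  have W_hol: "wronskian p q holomorphic_on UNIV" "wronskian a b holomorphic_on UNIV"
    using hol hol' wronskian_holomorphic by blast+
  have "h meromorphic_on UNIV"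
    unfolding h
    by (intro meromorphic_on_mult meromorphic_on_divide meromorphic_on_power entire_meromorphic N_hol W_hol)
  note per = comparison_periodic[OF lift lift', folded h_def]
  have lim0: "(h \<longlongrightarrow> 0) (at 0)"
  proof -
    \<comment> \<open>The comparison function with the factor x^2 of the denominator cancelled
      against the x^4 in the numerator.\<close>
    define k where "k x = x\<^sup>2 * (N2 x)\<^sup>2 / (w x * w (- x))" for x
    have "isCont k 0"
      unfolding k_def using w(3)
      by (intro continuous_intros entire_isCont[OF N2(1)] entire_isCont[OF w(1)]
          entire_isCont[OF holomorphic_reflect[OF w(1)]]) auto
    then have "(k \<longlongrightarrow> k 0) (at 0)" by (simp add: isCont_def)
    moreover have "eventually (\<lambda>x. k x = h x) (at 0)"
    proof -
      have "eventually (\<lambda>x::complex. x \<noteq> 0) (at 0)" by (simp add: eventually_at_filter)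
      then show ?thesis
      proof eventually_elim
        case (elim x)
        then show ?case unfolding k_def h W' N1 N2 w(2) by (simp add: power2_eq_square)
      qed
    qed
    ultimately show ?thesis using Lim_transform_eventually unfolding k_def by fastforce
  qed
  have nopole: "\<not> is_pole h x" for x
  proof (cases "x \<in> lattice \<tau>")
    case True
    have "is_pole h (0 + x) \<longleftrightarrow> is_pole h 0"
      using lattice_periodic[of "is_pole h", OF _ _ True, of 0] is_pole_periodic[of h] per by blast
    moreover have "\<not> is_pole h 0"
      using not_tendsto_and_filterlim_at_infinity[OF at_neq_bot lim0] unfolding is_pole_def by blast
    ultimately show ?thesis by simp
  next
    case False
    then have "- x \<notin> lattice \<tau>" by simp
    then have "wronskian p q x * wronskian a b x \<noteq> 0" using False W0 W' by simp
    then have "h analytic_on {x}"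
      unfolding h
      by (intro analytic_on_divide analytic_on_mult analytic_on_power entire_analytic[OF N_hol]
          entire_analytic[OF W_hol(1)] entire_analytic[OF W_hol(2)]) auto
    then show ?thesis using analytic_at_imp_no_pole by blast
  qed
  have "eventually (\<lambda>y. h y = 0) (at 0)"
    by (rule elliptic_without_poles_zero[OF tau \<open>h meromorphic_on UNIV\<close> per nopole lim0])
  moreover have "eventually (\<lambda>y. wronskian p q y \<noteq> 0) (at 0)" "eventually (\<lambda>y. wronskian a b y \<noteq> 0) (at 0)"
  proof -
    have "wronskian p q (1 / 2) \<noteq> 0" "wronskian a b (- (1 / 2)) \<noteq> 0"
      using W0 W' half_not_in_lattice[OF tau] by auto
    then show "eventually (\<lambda>y. wronskian p q y \<noteq> 0) (at 0)" "eventually (\<lambda>y. wronskian a b y \<noteq> 0) (at 0)"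
      using entire_eventually_nonzero W_hol by blast+
  qed
  ultimately have ev: "eventually (\<lambda>y. N y = 0) (at 0)"
    by eventually_elim (simp add: h)
  have "N x = 0"
  proof (rule ccontr)
    assume "N x \<noteq> 0"
    then have "eventually (\<lambda>y. N y \<noteq> 0) (at 0)" using entire_eventually_nonzero[OF N_hol] by blast
    with ev have "eventually (\<lambda>y. False) (at (0::complex))" by eventually_elim simp
    then show False by simp
  qed
  then show ?thesis unfolding N_def a_def b_def by simp
qed

text \<open>The comparison function \<open>h\<close> has at most a double pole at \<open>0\<close> and zeros at \<open>1/2\<close> and \<open>\<tau>/2\<close>, so that
  in \<open>h x * h (x + 1/2)\<close> the poles cancel against zeros while the zero at \<open>\<tau>/2\<close> survives.\<close>

lemma simple_critical_agree:
  assumes tau: "Im \<tau> \<noteq> 0" and crit: "simple_critical \<tau> p q" "simple_critical \<tau> a b"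
    and half: "p (1 / 2) * b (1 / 2) = q (1 / 2) * a (1 / 2)" "p (\<tau> / 2) * b (\<tau> / 2) = q (\<tau> / 2) * a (\<tau> / 2)"
  shows "p x * b x = q x * a x"
proof -
  have hol: "p holomorphic_on UNIV" "q holomorphic_on UNIV" "a holomorphic_on UNIV" "b holomorphic_on UNIV"
    and lift: "equivariant_lift \<tau> p q" "equivariant_lift \<tau> a b"
    and W0: "\<And>x. wronskian p q x = 0 \<longleftrightarrow> x \<in> lattice \<tau>" "\<And>x. wronskian a b x = 0 \<longleftrightarrow> x \<in> lattice \<tau>"
    using crit unfolding simple_critical_def equivariant_lift_def by auto
  define N where "N x = p x * b x - q x * a x" for x
  have N_hol: "N holomorphic_on UNIV" unfolding N_def by (intro holomorphic_intros hol)
  have N_half: "N (1 / 2) = 0" "N (\<tau> / 2) = 0" unfolding N_def using half by simp_all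
  define h where "h = comparison p q a b"
  have h: "h x = (N x)\<^sup>2 / (wronskian p q x * wronskian a b x)" for x
    unfolding h_def comparison_def N_def ..
  have W_hol: "wronskian p q holomorphic_on UNIV" "wronskian a b holomorphic_on UNIV"
    using hol wronskian_holomorphic by blast+
  note per = comparison_periodic[OF lift, folded h_def]
  define M where "M x = h x * h (x + 1 / 2)" for x
  have M: "M x = (N x)\<^sup>2 / (wronskian p q x * wronskian a b x) *
      ((N (x + 1 / 2))\<^sup>2 / (wronskian p q (x + 1 / 2) * wronskian a b (x + 1 / 2)))" for x
    unfolding M_def h ..
  \<comment> \<open>The period 1/2 of \<open>M\<close> carries the points congruent to 1/2 back to
    the lattice, where poles are excluded.\<close>
  have half_per: "M (x + 1 / 2) = M x" for x
    unfolding M_def using per(1)[of x] by (simp add: add.assoc)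
  have M_per: "M (x + 1) = M x" "M (x + \<tau>) = M x" for x
    using per(1)[of x] per(1)[of "x + 1 / 2"] per(2)[of x] per(2)[of "x + 1 / 2"]
    unfolding M_def by (simp_all add: ac_simps)
  have M_mero: "M meromorphic_on UNIV"
    unfolding M
    by (intro meromorphic_on_mult meromorphic_on_divide meromorphic_on_power entire_meromorphic
        holomorphic_shift N_hol W_hol)
  obtain w1 where w1: "w1 holomorphic_on UNIV" "\<And>x. wronskian p q x = x * w1 x" "w1 0 \<noteq> 0"
    using simple_critical_wronskian_factor[OF crit(1)] by blast
  obtain w2 where w2: "w2 holomorphic_on UNIV" "\<And>x. wronskian a b x = x * w2 x" "w2 0 \<noteq> 0"
    using simple_critical_wronskian_factor[OF crit(2)] by blast
  obtain N1 where N1: "N1 holomorphic_on UNIV" "\<And>x. N (x + 1 / 2) = x * N1 x"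
    using entire_factor_zero[OF holomorphic_shift[OF N_hol, of "1 / 2"]] N_half(1) by auto
  have nz_half: "wronskian p q (1 / 2) \<noteq> 0" "wronskian a b (1 / 2) \<noteq> 0"
    using W0 half_not_in_lattice[OF tau] by auto
  have nopole0: "\<not> is_pole M 0"
  proof -
    \<comment> \<open>The square of \<open>N (x + 1 / 2)\<close> supplies the factor x^2 that
      cancels the simple zeros of the two Wronskians at 0.\<close>
    define k where "k x = (N x)\<^sup>2 * (N1 x)\<^sup>2 / (w1 x * w2 x * wronskian p q (x + 1 / 2) * wronskian a b (x + 1 / 2))" for x
    have "isCont k 0"
      unfolding k_def using w1(3) w2(3) nz_half
      by (intro continuous_intros entire_isCont[OF N1(1)] entire_isCont[OF w1(1)] entire_isCont[OF w2(1)]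
          entire_isCont[OF N_hol] entire_isCont[OF holomorphic_shift[OF W_hol(1)]]
          entire_isCont[OF holomorphic_shift[OF W_hol(2)]]) auto
    then have "(k \<longlongrightarrow> k 0) (at 0)" by (simp add: isCont_def)
    moreover have "eventually (\<lambda>x. k x = M x) (at 0)"
    proof -
      have "eventually (\<lambda>x::complex. x \<noteq> 0) (at 0)" by (simp add: eventually_at_filter)
      then show ?thesis
      proof eventually_elim
        case (elim x)
        then show ?case unfolding k_def M N1 w1(2)[of x] w2(2)[of x] by (simp add: power2_eq_square ac_simps)
      qed
    qed
    ultimately have "(M \<longlongrightarrow> k 0) (at 0)" using Lim_transform_eventually by fast
    then show ?thesis
      using not_tendsto_and_filterlim_at_infinity[OF at_neq_bot] unfolding is_pole_def by blast
  qed
  have nopole_lattice: "\<not> is_pole M x" if "x \<in> lattice \<tau>" for x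
    using lattice_periodic[of "is_pole M", OF _ _ that, of 0] is_pole_periodic[of M] M_per nopole0 by simp
  have M_analytic: "M analytic_on {x}" if "x \<notin> lattice \<tau>" "x + 1 / 2 \<notin> lattice \<tau>" for x
  proof -
    have "wronskian p q x * wronskian a b x \<noteq> 0" "wronskian p q (x + 1 / 2) * wronskian a b (x + 1 / 2) \<noteq> 0"
      using that W0 by auto
    then show ?thesis
      unfolding M
      by (intro analytic_on_divide analytic_on_mult analytic_on_power entire_analytic[OF N_hol]
          entire_analytic[OF W_hol(1)] entire_analytic[OF W_hol(2)] entire_analytic[OF holomorphic_shift[OF N_hol]]
          entire_analytic[OF holomorphic_shift[OF W_hol(1)]] entire_analytic[OF holomorphic_shift[OF W_hol(2)]]) auto
  qed
  have nopole: "\<not> is_pole M x" for x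
  proof (cases "x \<in> lattice \<tau> \<or> x + 1 / 2 \<in> lattice \<tau>")
    case True
    then show ?thesis using nopole_lattice is_pole_periodic[of M "1 / 2" x] half_per by blast
  next
    case False
    then show ?thesis using M_analytic analytic_at_imp_no_pole by blast
  qed
  have "M (\<tau> / 2) = 0" unfolding M N_half by simp
  moreover have "M analytic_on {\<tau> / 2}" using M_analytic half_not_in_lattice[OF tau] by blast
  ultimately have lim0: "(M \<longlongrightarrow> 0) (at (\<tau> / 2))"
    using analytic_at_imp_isCont isContD by metis
  have M0: "eventually (\<lambda>y. M y = 0) (at 0)"
    by (rule elliptic_without_poles_zero[OF tau M_mero M_per nopole lim0])
  have W_ev: "eventually (\<lambda>y. wronskian p q y \<noteq> 0) (at z)" "eventually (\<lambda>y. wronskian a b y \<noteq> 0) (at z)" for z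
    using entire_eventually_nonzero W_hol nz_half by blast+
  have shift_ev: "eventually (\<lambda>y. f (y + 1 / 2) \<noteq> 0) (at 0)" if "f holomorphic_on UNIV" "f z \<noteq> 0" for f z
    by (rule entire_eventually_nonzero[OF holomorphic_shift[OF that(1)], of "z - 1 / 2"]) (use that in auto)
  have "N x = 0"
  proof (rule ccontr)
    assume nz: "N x \<noteq> 0"
    have "eventually (\<lambda>y. False) (at (0::complex))"
      using M0 W_ev(1)[of 0] W_ev(2)[of 0] shift_ev[OF W_hol(1) nz_half(1)] shift_ev[OF W_hol(2) nz_half(2)]
        entire_eventually_nonzero[OF N_hol nz, of 0] shift_ev[OF N_hol nz]
      by eventually_elim (simp add: M)
    then show False by simp
  qed
  then show ?thesis unfolding N_def by simp
qed

text \<open>With evenness, equivariance at -1/2 and -\<tau>/2 gives f(1/2) = -f(1/2) and f(\<tau>/2)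
  = 1/f(\<tau>/2). So the first value is 0 or infinity, the second 1 or -1.\<close>

lemma simple_critical_half:
  assumes tau: "Im \<tau> \<noteq> 0" and crit: "simple_critical \<tau> p q"
  shows "p (1 / 2) = 0 \<and> q (1 / 2) \<noteq> 0 \<or> p (1 / 2) \<noteq> 0 \<and> q (1 / 2) = 0"
    "p (\<tau> / 2) = q (\<tau> / 2) \<or> p (\<tau> / 2) = - q (\<tau> / 2)"
proof -
  have nz: "(p x, q x) \<noteq> (0, 0)"
    and eq: "p (x + 1) * q x = - p x * q (x + 1)" "p (x + \<tau>) * p x = q x * q (x + \<tau>)" for x
    using crit unfolding simple_critical_def equivariant_lift_def by auto
  note even = simple_critical_even[OF tau crit]
  show "p (1 / 2) = 0 \<and> q (1 / 2) \<noteq> 0 \<or> p (1 / 2) \<noteq> 0 \<and> q (1 / 2) = 0"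
    using eq(1)[of "- (1 / 2)"] even[of "1 / 2"] nz[of "1 / 2"] nz[of "- (1 / 2)"] by auto
  have "p (\<tau> / 2) * p (- (\<tau> / 2)) = q (- (\<tau> / 2)) * q (\<tau> / 2)" using eq(2)[of "- (\<tau> / 2)"] by simp
  then have "(p (\<tau> / 2))\<^sup>2 = (q (\<tau> / 2))\<^sup>2"
    using even[of "\<tau> / 2"] nz[of "- (\<tau> / 2)"]
    by (cases "q (- (\<tau> / 2)) = 0") (auto simp: power2_eq_square, algebra+)
  then show "p (\<tau> / 2) = q (\<tau> / 2) \<or> p (\<tau> / 2) = - q (\<tau> / 2)"
    by (simp add: power2_eq_iff)
qed

lemma simple_critical_uminus:
  assumes "simple_critical \<tau> p q" shows "simple_critical \<tau> (\<lambda>x. - p x) q"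
proof -
  have hol: "p holomorphic_on UNIV" "q holomorphic_on UNIV"
    using assms unfolding simple_critical_def equivariant_lift_def by auto
  have W: "wronskian (\<lambda>x. - p x) q = (\<lambda>x. - wronskian p q x)"
    using wronskian_uminus1[OF hol(1)] by auto
  have "deriv (\<lambda>x. - wronskian p q x) 0 = - deriv (wronskian p q) 0"
    by (intro DERIV_imp_deriv derivative_intros entire_deriv wronskian_holomorphic hol)
  then show ?thesis using assms unfolding simple_critical_def equivariant_lift_def W
    by (auto intro: holomorphic_intros)
qed

lemma simple_critical_swap:
  assumes "simple_critical \<tau> p q" shows "simple_critical \<tau> q p"
proof -
  have hol: "p holomorphic_on UNIV" "q holomorphic_on UNIV"
    using assms unfolding simple_critical_def equivariant_lift_def by auto
  have W: "wronskian q p = (\<lambda>x. - wronskian p q x)"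
    using wronskian_swap by blast
  have "deriv (\<lambda>x. - wronskian p q x) 0 = - deriv (wronskian p q) 0"
    by (intro DERIV_imp_deriv derivative_intros entire_deriv wronskian_holomorphic hol)
  then show ?thesis using assms unfolding simple_critical_def equivariant_lift_def W
    by (auto simp: mult.commute)
qed

context theta_pair
begin

lemma simple_critical_theta: "simple_critical \<tau> u v"
  unfolding simple_critical_def equivariant_lift_def
  using u_hol v_hol no_common_zero W_eq_0_iff deriv_W_0
  by (simp add: u_1 v_1 u_shift v_shift mult.commute)

lemma f0_1: "f0 (x + 1) = proj (- u x) (v x)" and f0_tau: "f0 (x + \<tau>) = proj (v x) (u x)"
  unfolding f0_def u_1 v_1 u_shift v_shift by (auto simp: proj_def)

text \<open>The translates of \<open>f0\<close> by 0, 1, \<tau> and 1 + \<tau> are f0, -f0, 1/f0 and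
  -1/f0. They realize all four combinations of values at 1/2 and \<tau>/2, so one of them agrees
  with the given map at both half periods.\<close>

lemma simple_critical_eq_f0:
  assumes crit: "simple_critical \<tau> p q"
  obtains l where "l \<in> lattice \<tau>" "\<And>x. proj (p x) (q x) = f0 (x + l)"
proof -
  have tau': "Im \<tau> \<noteq> 0" using tau by simp
  have nz: "(p x, q x) \<noteq> (0, 0)" for x
    using crit unfolding simple_critical_def equivariant_lift_def by auto
  have agree: "proj (p x) (q x) = proj (a x) (b x)"
    if "simple_critical \<tau> a b" "p (1 / 2) * b (1 / 2) = q (1 / 2) * a (1 / 2)"
      "p (\<tau> / 2) * b (\<tau> / 2) = q (\<tau> / 2) * a (\<tau> / 2)" for a b x
  proof -
    have "(a x, b x) \<noteq> (0, 0)" using that(1) unfolding simple_critical_def equivariant_lift_def by auto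
    then show ?thesis
      using simple_critical_agree[OF tau' crit that, of x] by (simp add: proj_eq_iff[OF nz] mult.commute)
  qed
  note sc = simple_critical_theta simple_critical_uminus[OF simple_critical_theta]
    simple_critical_swap[OF simple_critical_theta]
    simple_critical_swap[OF simple_critical_uminus[OF simple_critical_theta]]
  note hp = simple_critical_half[OF tau' crit] and hu = simple_critical_half[OF tau' simple_critical_theta]
  have lat: "1 + \<tau> \<in> lattice \<tau>" by (intro lattice_add) auto
  have f01: "f0 (x + (1 + \<tau>)) = proj (v x) (- u x)" for x
    using f0_tau[of "x + 1"] unfolding u_1 v_1 by (simp add: add.assoc)
  show ?thesis
  proof (cases "p (1 / 2) * v (1 / 2) = q (1 / 2) * u (1 / 2)")
    case True
    show ?thesis
    proof (cases "p (\<tau> / 2) * v (\<tau> / 2) = q (\<tau> / 2) * u (\<tau> / 2)")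
      case t: True
      show ?thesis by (rule that[of 0]) (use agree[OF sc(1) True t] in \<open>auto simp: f0_def\<close>)
    next
      case t: False
      show ?thesis
        by (rule that[of 1]) (use agree[OF sc(2)] True t hp hu in \<open>auto simp: f0_1\<close>)
    qed
  next
    case False
    show ?thesis
    proof (cases "p (\<tau> / 2) * u (\<tau> / 2) = q (\<tau> / 2) * v (\<tau> / 2)")
      case t: True
      show ?thesis by (rule that[of \<tau>]) (use agree[OF sc(3)] False t hp hu in \<open>auto simp: f0_tau\<close>)
    next
      case t: False
      show ?thesis
        by (rule that[OF lat]) (use agree[OF sc(4)] False t hp hu in \<open>auto simp: f01\<close>)
    qed
  qed
qed

end

section \<open>Sections of a flat ruled surface\<close>

lemma mobius_proj:
  assumes "(p, q) \<noteq> (0, 0)"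
  shows "mobius a b c d (proj p q) = proj (a * p + b * q) (c * p + d * q)"
proof (cases "q = 0")
  case True
  then show ?thesis using assms by (simp add: proj_def mobius_def)
next
  case False
  have "a * (p / q) + b = (a * p + b * q) / q" "c * (p / q) + d = (c * p + d * q) / q"
    using False by (simp_all add: field_simps)
  then show ?thesis using False by (simp add: proj_def mobius_def)
qed

lemma matrix_nonzero:
  fixes a b c d p q :: complex
  assumes "a * d - b * c \<noteq> 0" "(p, q) \<noteq> (0, 0)"
  shows "(a * p + b * q, c * p + d * q) \<noteq> (0, 0)"
proof
  assume "(a * p + b * q, c * p + d * q) = (0, 0)"
  then have *: "a * p + b * q = 0" "c * p + d * q = 0" by auto
  have "(a * d - b * c) * p = d * (a * p + b * q) - b * (c * p + d * q)"
    "(a * d - b * c) * q = a * (c * p + d * q) - c * (a * p + b * q)"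
    by (simp_all add: algebra_simps)
  then show False using * assms by simp
qed

lemma sphere_lift:
  obtains p q where "(p, q) \<noteq> (0 :: complex, 0 :: complex)" "z = proj p q"
  by (cases z) (auto simp: proj_def intro: that[of 1 0] that[of _ 1])

lemma proj_eq_None_iff [simp]: "proj p q = None \<longleftrightarrow> q = 0"
  by (simp add: proj_def)

text \<open>The map is a meromorphic function on the plane, and the Weierstrass factorization
  theorem writes it as a quotient of entire functions without common zeros.\<close>

lemma holomorphic_to_sphere_UNIV_lift:
  assumes hol: "holomorphic_to_sphere f UNIV" and fin: "f x0 \<noteq> None"
  obtains p q where "p holomorphic_on UNIV" "q holomorphic_on UNIV"
    "\<And>x. (p x, q x) \<noteq> (0, 0)" "\<And>x. f x = proj (p x) (q x)"
proof -
  have loc: "\<exists>N u v. open N \<and> x \<in> N \<and> u analytic_on {x} \<and> v analytic_on {x} \<and> isCont v x \<and>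
      (\<forall>y\<in>N. (u y, v y) \<noteq> (0, 0) \<and> f y = proj (u y) (v y))" for x
  proof -
    obtain N u v where N: "open N" "x \<in> N" "u holomorphic_on N" "v holomorphic_on N"
        "\<forall>y\<in>N. (u y, v y) \<noteq> (0, 0) \<and> f y = proj (u y) (v y)"
      using hol[unfolded holomorphic_to_sphere_def, rule_format, OF UNIV_I, of x] by auto
    then have "u analytic_on {x}" "v analytic_on {x}" using analytic_at by blast+
    then show ?thesis using N analytic_at_imp_isCont by (intro exI[of _ N] exI[of _ u] exI[of _ v]) simp
  qed
  \<comment> \<open>The set where \<open>f\<close> is infinite on a whole neighbourhood is open and
    closed. It misses \<open>x0\<close>, so it is empty and the poles are isolated.\<close>
  define B where "B = {x. eventually (\<lambda>y. f y = None) (nhds x)}"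
  have ev_fin: "eventually (\<lambda>y. f y \<noteq> None) (at x)" if "x \<notin> B" for x
  proof -
    obtain N u v where N: "open N" "x \<in> N" "v analytic_on {x}" "\<forall>y\<in>N. f y = proj (u y) (v y)"
      using loc[of x] by blast
    have Nev: "eventually (\<lambda>y. y \<in> N) (nhds x)" using N by (simp add: eventually_nhds_in_open)
    have "\<not> eventually (\<lambda>y. v y = 0) (at x)"
    proof
      assume ev: "eventually (\<lambda>y. v y = 0) (at x)"
      then have "(v \<longlongrightarrow> 0) (at x)" by (rule tendsto_eventually)
      moreover have "(v \<longlongrightarrow> v x) (at x)" using analytic_at_imp_isCont[OF N(3)] by (simp add: isCont_def)
      ultimately have "v x = 0" using LIM_unique by blast
      with ev have "eventually (\<lambda>y. v y = 0) (nhds x)" by (simp add: eventually_nhds_conv_at)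
      then have "eventually (\<lambda>y. f y = None) (nhds x)"
        using Nev by eventually_elim (use N in auto)
      then show False using that unfolding B_def by simp
    qed
    then have "eventually (\<lambda>y. v y \<noteq> 0) (at x)"
      using N(3) not_essential_frequently_0_imp_eventually_0[of v x] isolated_singularity_at_analytic not_essential_analytic
      unfolding frequently_def by blast
    moreover have "eventually (\<lambda>y. y \<in> N) (at x)" using Nev eventually_nhds_conv_at by blast
    ultimately show ?thesis by eventually_elim (use N in auto)
  qed
  have "open B"
  proof (subst open_subopen, intro ballI)
    fix x assume "x \<in> B"
    then obtain T where "open T" "x \<in> T" "\<forall>y\<in>T. f y = None" unfolding B_def eventually_nhds by auto
    then show "\<exists>T. open T \<and> x \<in> T \<and> T \<subseteq> B" unfolding B_def eventually_nhds by blast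
  qed
  moreover have "open (- B)"
  proof (rule openI)
    fix x assume "x \<in> - B"
    then have "eventually (\<lambda>y. f y \<noteq> None) (at x)" using ev_fin by blast
    then obtain d where d: "d > 0" "\<And>y. y \<noteq> x \<Longrightarrow> dist y x < d \<Longrightarrow> f y \<noteq> None"
      unfolding eventually_at by auto
    have "ball x d \<subseteq> - B"
    proof
      fix y assume y: "y \<in> ball x d"
      show "y \<in> - B"
      proof (cases "y = x")
        case False
        then have "f y \<noteq> None" using d y by (auto simp: dist_commute)
        then show ?thesis unfolding B_def using eventually_nhds_x_imp_x by fastforce
      qed (use \<open>x \<in> - B\<close> in simp)
    qed
    then show "\<exists>e>0. ball x e \<subseteq> - B" using d(1) by blast
  qed
  moreover have "x0 \<notin> B" unfolding B_def using fin eventually_nhds_x_imp_x by fastforce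
  ultimately have "B = {}"
    using clopen[of B] by (auto simp: closed_def)
  then have ev: "eventually (\<lambda>y. f y \<noteq> None) (at x)" for x using ev_fin by blast
  \<comment> \<open>The default value 0 at infinity matches the convention of
    \<open>nicely_meromorphic_on\<close> for poles.\<close>
  define g where "g x = (case f x of Some w \<Rightarrow> w | None \<Rightarrow> 0)" for x
  have loc_g: "g meromorphic_on {x} \<and> (if f x = None then is_pole g x \<and> g x = 0 else (g \<longlongrightarrow> g x) (at x))" for x
  proof -
    obtain N u v where N: "open N" "x \<in> N" "u analytic_on {x}" "v analytic_on {x}"
      "\<forall>y\<in>N. (u y, v y) \<noteq> (0, 0) \<and> f y = proj (u y) (v y)"
      using loc[of x] by blast
    have Nev: "eventually (\<lambda>y. y \<in> N) (at x)" using N by (simp add: eventually_at_in_open')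
    have g: "g y = u y / v y" if "y \<in> N" for y
      using N(5) that unfolding g_def proj_def by auto
    have geq: "eventually (\<lambda>y. g y = u y / v y) (at x)"
      using Nev by eventually_elim (rule g)
    have vnz: "eventually (\<lambda>y. v y \<noteq> 0) (at x)"
      using Nev ev[of x] by eventually_elim (use N in auto)
    have uv: "isCont u x" "isCont v x" using N analytic_at_imp_isCont by blast+
    have m: "(\<lambda>y. u y / v y) meromorphic_on {x}"
      using N(3,4) by (intro meromorphic_on_divide analytic_on_imp_meromorphic_on)
    have 1: "g meromorphic_on {x}"
      using meromorphic_on_cong[where f = g and g = "\<lambda>y. u y / v y" and A = "{x}", OF _ refl] m geq by auto
    have 2: "is_pole g x \<and> g x = 0" if "f x = None"
    proof
      show "g x = 0" using that by (simp add: g_def)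
      have "v x = 0" "u x \<noteq> 0" using N that by auto
      then have "is_pole (\<lambda>y. u y / v y) x"
        using uv vnz by (intro is_pole_divide) (auto simp: filterlim_at isCont_def)
      then show "is_pole g x" using is_pole_cong[OF geq refl] by simp
    qed
    have 3: "(g \<longlongrightarrow> g x) (at x)" if "f x \<noteq> None"
    proof -
      have "v x \<noteq> 0" using N that by auto
      then have "((\<lambda>y. u y / v y) \<longlongrightarrow> g x) (at x)"
        using uv g[OF N(2)] by (auto intro!: tendsto_divide simp: isCont_def)
      then show ?thesis using tendsto_cong[OF geq] by simp
    qed
    show ?thesis using 1 2 3 by simp
  qed
  have pole_iff: "is_pole g x \<longleftrightarrow> f x = None" for x
  proof (cases "f x = None")
    case False
    then have "(g \<longlongrightarrow> g x) (at x)" using loc_g[of x] by simp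
    then have "\<not> is_pole g x"
      using not_tendsto_and_filterlim_at_infinity[OF at_neq_bot] unfolding is_pole_def by blast
    then show ?thesis using False by simp
  qed (use loc_g[of x] in simp)
  have "g nicely_meromorphic_on UNIV"
    unfolding nicely_meromorphic_on_def using loc_g meromorphic_on_meromorphic_at[of g UNIV]
    by (auto split: if_splits) metis+
  then obtain h f1 f2 where w: "h holomorphic_on UNIV" "f1 holomorphic_on UNIV" "f2 holomorphic_on UNIV"
    "\<forall>z. f1 z = 0 \<longleftrightarrow> \<not>is_pole g z \<and> g z = 0" "\<forall>z. f2 z = 0 \<longleftrightarrow> is_pole g z"
    "\<forall>z. h z \<noteq> 0" "\<forall>z. g z = h z * f1 z / f2 z"
    by (rule weierstrass_factorization_meromorphic_UNIV) blast
  show ?thesis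
  proof (rule that[of "\<lambda>x. h x * f1 x" f2])
    show "(\<lambda>x. h x * f1 x) holomorphic_on UNIV" "f2 holomorphic_on UNIV"
      using w by (auto intro: holomorphic_intros)
    show "(h x * f1 x, f2 x) \<noteq> (0, 0)" for x using w by auto
    show "f x = proj (h x * f1 x) (f2 x)" for x
    proof (cases "f x")
      case None
      then show ?thesis using w(5) pole_iff by (metis proj_eq_None_iff)
    next
      case (Some y)
      then have "g x = y" "f2 x \<noteq> 0" using w(5) pole_iff by (auto simp: g_def)
      then show ?thesis using w(7) Some by (simp add: proj_def)
    qed
  qed
qed


section \<open>Flat trivializations and lifts of sections\<close>

lemma coset_inj_ball:
  assumes "Im \<tau> \<noteq> 0"
  obtains r where "r > 0" "\<And>x. inj_on (coset \<tau>) (ball x r)"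
proof -
  obtain r where r: "r > 0" "\<And>l. l \<in> lattice \<tau> \<Longrightarrow> l \<noteq> 0 \<Longrightarrow> r \<le> dist l 0"
    by (rule lattice_bounded_away[OF assms, of 0]) blast
  have "inj_on (coset \<tau>) (ball x (r / 2))" for x
  proof (rule inj_onI)
    fix y z assume yz: "y \<in> ball x (r / 2)" "z \<in> ball x (r / 2)" "coset \<tau> y = coset \<tau> z"
    then have "dist y z < r" using dist_triangle_half_r by (auto simp: dist_commute)
    then have "norm (z - y) < r" by (simp add: dist_norm norm_minus_commute)
    then show "y = z" using r(2)[of "z - y"] yz(3) unfolding coset_eq_iff by (force simp: dist_norm)
  qed
  then show ?thesis using that[of "r / 2"] r(1) by simp
qed

text \<open>The trivialization \<open>F\<close> is the one in which the Riccati foliation is horizontal.\<close>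

locale flat_ruled_surface =
  fixes \<tau> :: complex and S :: "'a set" and \<pi> :: "'a \<Rightarrow> complex set" and A :: "'a triv set"
    and F :: "complex \<Rightarrow> sphere \<Rightarrow> 'a"
  assumes tau: "Im \<tau> > 0" and ruled: "ruled_surface \<tau> S \<pi> A"
    and flat_triv: "open U \<Longrightarrow> inj_on (coset \<tau>) U \<Longrightarrow> (U, F) \<in> A"
    and F_1: "F (x + 1) z = F x (mobius (-1) 0 0 1 z)"
    and F_tau: "F (x + \<tau>) z = F x (mobius 0 1 1 0 z)"
begin

lemma tau_nz: "Im \<tau> \<noteq> 0" using tau by simp

lemma triv:
  assumes "(V, t) \<in> A"
  shows "open V" "inj_on (coset \<tau>) V"
    "x \<in> V \<Longrightarrow> inv (t x) (t x z) = z"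
    "x \<in> V \<Longrightarrow> P \<in> S \<Longrightarrow> \<pi> P = coset \<tau> x \<Longrightarrow> t x (inv (t x) P) = P"
    "x \<in> V \<Longrightarrow> t x z \<in> S" "x \<in> V \<Longrightarrow> \<pi> (t x z) = coset \<tau> x"
proof -
  have "local_triv \<tau> S \<pi> (V, t)" using ruled assms unfolding ruled_surface_def by blast
  then have *: "open V" "inj_on (coset \<tau>) V" "\<And>x. x \<in> V \<Longrightarrow> bij_betw (t x) UNIV {q \<in> S. \<pi> q = coset \<tau> x}"
    unfolding local_triv_def by auto
  show "open V" "inj_on (coset \<tau>) V" using * by auto
  assume x: "x \<in> V"
  note b = *(3)[OF x]
  show "inv (t x) (t x z) = z" using b by (simp add: bij_betw_def inv_f_f)
  show "t x z \<in> S" "\<pi> (t x z) = coset \<tau> x" using b unfolding bij_betw_def by blast+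
  show "t x (inv (t x) P) = P" if "P \<in> S" "\<pi> P = coset \<tau> x"
    using b that unfolding bij_betw_def by (metis (mono_tags, lifting) f_inv_into_f mem_Collect_eq)
qed

lemma flat_ball: obtains r where "r > 0" "(ball x r, F) \<in> A" "\<And>r'. r' \<le> r \<Longrightarrow> (ball x r', F) \<in> A"
proof -
  obtain r where "r > 0" "inj_on (coset \<tau>) (ball x r)" using coset_inj_ball[OF tau_nz] by metis
  then show ?thesis using that flat_triv inj_on_subset subset_ball by (metis open_ball order_refl)
qed

lemma F_simps [simp]: "inv (F x) (F x z) = z" "F x z \<in> S" "\<pi> (F x z) = coset \<tau> x"
proof -
  obtain r where "r > 0" "(ball x r, F) \<in> A" using flat_ball by blast
  then show "inv (F x) (F x z) = z" "F x z \<in> S" "\<pi> (F x z) = coset \<tau> x"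
    using triv centre_in_ball by metis+
qed

lemma F_inv: "P \<in> S \<Longrightarrow> \<pi> P = coset \<tau> x \<Longrightarrow> F x (inv (F x) P) = P"
proof -
  assume P: "P \<in> S" "\<pi> P = coset \<tau> x"
  obtain r where "r > 0" "(ball x r, F) \<in> A" using flat_ball by blast
  then show "F x (inv (F x) P) = P"
    using triv(4)[OF _ _ P] centre_in_ball by metis
qed

lemma F_inj [simp]: "F x z = F x z' \<longleftrightarrow> z = z'"
  using F_simps(1) by metis

lemma transition:
  assumes "(V, t) \<in> A" "(V', t') \<in> A" "x \<in> V" "x' \<in> V'" "coset \<tau> x = coset \<tau> x'"
  obtains N a b c d where "open N" "x \<in> N" "N \<subseteq> V" "a holomorphic_on N" "b holomorphic_on N"
    "c holomorphic_on N" "d holomorphic_on N" "\<And>y. y \<in> N \<Longrightarrow> a y * d y - b y * c y \<noteq> 0"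
    "\<And>y. y \<in> N \<Longrightarrow> y + (x' - x) \<in> V'"
    "\<And>y z. y \<in> N \<Longrightarrow> t y z = t' (y + (x' - x)) (mobius (a y) (b y) (c y) (d y) z)"
proof -
  have "compatible_triv \<tau> (V, t) (V', t')" using ruled assms unfolding ruled_surface_def by blast
  then have "\<exists>N a b c d. open N \<and> x \<in> N \<and> N \<subseteq> V \<and>
             a holomorphic_on N \<and> b holomorphic_on N \<and> c holomorphic_on N \<and> d holomorphic_on N \<and>
             (\<forall>y\<in>N. a y * d y - b y * c y \<noteq> 0 \<and> y + (x' - x) \<in> V' \<and>
                (\<forall>z. t y z = t' (y + (x' - x)) (mobius (a y) (b y) (c y) (d y) z)))"
    using assms unfolding compatible_triv_def by simp
  then show ?thesis using that by blast
qed

lemma section_coord: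
  assumes "holomorphic_section \<tau> S \<pi> A s"
  shows "F x (fibre_coord \<tau> s F x) = s (coset \<tau> x)"
    "(V, t) \<in> A \<Longrightarrow> x \<in> V \<Longrightarrow> t x (fibre_coord \<tau> s t x) = s (coset \<tau> x)"
proof -
  have s: "s (coset \<tau> x) \<in> S" "\<pi> (s (coset \<tau> x)) = coset \<tau> x"
    using assms unfolding holomorphic_section_def by simp_all
  show "F x (fibre_coord \<tau> s F x) = s (coset \<tau> x)" unfolding fibre_coord_def using F_inv[OF s] .
  show "t x (fibre_coord \<tau> s t x) = s (coset \<tau> x)" if "(V, t) \<in> A" "x \<in> V"
    unfolding fibre_coord_def using triv(4)[OF that(1,2) s] .
qed

lemma coset_shift: "coset \<tau> (x + l) = coset \<tau> x \<longleftrightarrow> l \<in> lattice \<tau>"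
  using lattice_minus_iff[of l \<tau>] by (simp add: coset_eq_iff)

lemma section_lift:
  assumes s: "holomorphic_section \<tau> S \<pi> A s"
  obtains p q where "equivariant_lift \<tau> p q" "\<And>x. fibre_coord \<tau> s F x = proj (p x) (q x)"
proof -
  define f where "f = fibre_coord \<tau> s F"
  note coord = section_coord(1)[OF s, folded f_def]
  have f1: "mobius (-1) 0 0 1 (f (x + 1)) = f x" for x
  proof -
    have "F x (mobius (-1) 0 0 1 (f (x + 1))) = F x (f x)"
      using coord[of "x + 1"] coord[of x] coset_shift[of x 1] unfolding F_1 by simp
    then show ?thesis by simp
  qed
  have f2: "mobius 0 1 1 0 (f (x + \<tau>)) = f x" for x
  proof -
    have "F x (mobius 0 1 1 0 (f (x + \<tau>))) = F x (f x)"
      using coord[of "x + \<tau>"] coord[of x] coset_shift[of x \<tau>] unfolding F_tau by simp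
    then show ?thesis by simp
  qed
  have "holomorphic_to_sphere f UNIV"
    unfolding holomorphic_to_sphere_def
  proof
    fix x :: complex
    obtain r where r: "r > 0" "(ball x r, F) \<in> A" using flat_ball by blast
    then have "holomorphic_to_sphere f (ball x r)" using s unfolding holomorphic_section_def f_def by blast
    then have "\<exists>N u v. open N \<and> x \<in> N \<and> N \<subseteq> ball x r \<and> u holomorphic_on N \<and> v holomorphic_on N \<and>
        (\<forall>y\<in>N. (u y, v y) \<noteq> (0, 0) \<and> f y = proj (u y) (v y))"
      unfolding holomorphic_to_sphere_def using r(1) by auto
    then show "\<exists>N u v. open N \<and> x \<in> N \<and> N \<subseteq> UNIV \<and> u holomorphic_on N \<and> v holomorphic_on N \<and>
        (\<forall>y\<in>N. (u y, v y) \<noteq> (0, 0) \<and> f y = proj (u y) (v y))"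
      by blast
  qed
  \<comment> \<open>A section that is infinite everywhere contradicts the inversion under
    \<tau>.\<close>
  moreover have "\<exists>x. f x \<noteq> None"
  proof (rule ccontr)
    assume "\<nexists>x. f x \<noteq> None"
    then show False using f2[of 0] by (simp add: mobius_def proj_def)
  qed
  ultimately obtain p q where pq: "p holomorphic_on UNIV" "q holomorphic_on UNIV"
    "\<And>x. (p x, q x) \<noteq> (0, 0)" "\<And>x. f x = proj (p x) (q x)"
    using holomorphic_to_sphere_UNIV_lift by metis
  have "equivariant_lift \<tau> p q"
    unfolding equivariant_lift_def
  proof (intro conjI allI pq)
    fix x
    have nz: "(- p x, q x) \<noteq> (0, 0)" "(q x, p x) \<noteq> (0, 0)" for x using pq(3)[of x] by auto
    have "proj (- p (x + 1)) (q (x + 1)) = proj (p x) (q x)"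
      using f1[of x] unfolding pq(4) mobius_proj[OF pq(3)] by simp
    then show "p (x + 1) * q x = - p x * q (x + 1)"
      unfolding proj_eq_iff[OF nz(1) pq(3)] by algebra
    have "proj (q (x + \<tau>)) (p (x + \<tau>)) = proj (p x) (q x)"
      using f2[of x] unfolding pq(4) mobius_proj[OF pq(3)] by simp
    then show "p (x + \<tau>) * p x = q x * q (x + \<tau>)"
      unfolding proj_eq_iff[OF nz(2) pq(3)] by algebra
  qed
  then show ?thesis using that pq(4) unfolding f_def by blast
qed

text \<open>Equivariance makes \<open>F x (proj (p x) (q x))\<close> invariant under the lattice, so
  it descends to the curve.\<close>

lemma lift_section:
  assumes lift: "equivariant_lift \<tau> p q"
  obtains s where "holomorphic_section \<tau> S \<pi> A s" "\<And>x. fibre_coord \<tau> s F x = proj (p x) (q x)"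
proof -
  have hol: "p holomorphic_on UNIV" "q holomorphic_on UNIV" and nz: "\<And>x. (p x, q x) \<noteq> (0, 0)"
    using lift unfolding equivariant_lift_def by auto
  define G where "G x = F x (proj (p x) (q x))" for x
  have "G (x + 1) = G x" for x
  proof -
    obtain l where l: "l \<noteq> 0" "p (x + 1) = - l * p x" "q (x + 1) = l * q x"
      using equivariant_lift_1[OF lift] by metis
    have "mobius (-1) 0 0 1 (proj (p (x + 1)) (q (x + 1))) = proj (p x) (q x)"
      unfolding mobius_proj[OF nz] using l by (simp add: proj_def)
    then show ?thesis unfolding G_def F_1 by simp
  qed
  moreover have "G (x + \<tau>) = G x" for x
  proof -
    obtain l where l: "l \<noteq> 0" "p (x + \<tau>) = l * q x" "q (x + \<tau>) = l * p x"
      using equivariant_lift_tau[OF lift] by metis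
    have "mobius 0 1 1 0 (proj (p (x + \<tau>)) (q (x + \<tau>))) = proj (p x) (q x)"
      unfolding mobius_proj[OF nz] using l by (simp add: proj_def)
    then show ?thesis unfolding G_def F_tau by simp
  qed
  ultimately have G_lattice: "G (x + l) = G x" if "l \<in> lattice \<tau>" for x l
    using lattice_periodic[of G] that by blast
  define s where "s c = G (SOME x. c = coset \<tau> x)" for c
  have s: "s (coset \<tau> x) = G x" for x
  proof -
    define y where "y = (SOME y. coset \<tau> x = coset \<tau> y)"
    have "coset \<tau> x = coset \<tau> y" unfolding y_def by (rule someI[of _ x]) simp
    then have "G (x + (y - x)) = G x" by (intro G_lattice) (simp add: coset_eq_iff)
    then show ?thesis unfolding s_def y_def by simp
  qed
  have fc: "fibre_coord \<tau> s F x = proj (p x) (q x)" for x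
    unfolding fibre_coord_def s G_def by simp
  have "holomorphic_section \<tau> S \<pi> A s"
    unfolding holomorphic_section_def
  proof (intro conjI ballI)
    fix c assume "c \<in> curve \<tau>"
    then obtain x where "c = coset \<tau> x" by (auto simp: curve_iff)
    then show "s c \<in> S" "\<pi> (s c) = c" by (simp_all add: s G_def)
  next
    fix T assume "T \<in> A"
    moreover obtain V t where T: "T = (V, t)" by (cases T)
    ultimately have Vt: "(V, t) \<in> A" by simp
    have "holomorphic_to_sphere (fibre_coord \<tau> s t) V"
      unfolding holomorphic_to_sphere_def
    proof
      fix x assume x: "x \<in> V"
      obtain r where r: "r > 0" "(ball x r, F) \<in> A" using flat_ball by blast
      obtain N a b c d where N: "open N" "x \<in> N" "N \<subseteq> ball x r" "a holomorphic_on N" "b holomorphic_on N"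
        "c holomorphic_on N" "d holomorphic_on N" "\<And>y. y \<in> N \<Longrightarrow> a y * d y - b y * c y \<noteq> 0"
        "\<And>y. y \<in> N \<Longrightarrow> y + (x - x) \<in> V"
        "\<And>y z. y \<in> N \<Longrightarrow> F y z = t (y + (x - x)) (mobius (a y) (b y) (c y) (d y) z)"
        by (rule transition[OF r(2) Vt _ x refl]) (use r(1) in auto)
      show "\<exists>N u v. open N \<and> x \<in> N \<and> N \<subseteq> V \<and> u holomorphic_on N \<and> v holomorphic_on N \<and>
          (\<forall>y\<in>N. (u y, v y) \<noteq> (0, 0) \<and> fibre_coord \<tau> s t y = proj (u y) (v y))"
      proof (intro exI conjI ballI)
        show "N \<subseteq> V" using N(9) by auto
        show "(\<lambda>y. a y * p y + b y * q y) holomorphic_on N" "(\<lambda>y. c y * p y + d y * q y) holomorphic_on N"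
          using N(4-7) hol[THEN holomorphic_on_subset[OF _ subset_UNIV]] by (auto intro!: holomorphic_intros)
        fix y assume y: "y \<in> N"
        show "(a y * p y + b y * q y, c y * p y + d y * q y) \<noteq> (0, 0)"
          using matrix_nonzero[OF N(8)[OF y] nz] .
        have "y \<in> V" using N(9)[OF y] by simp
        then show "fibre_coord \<tau> s t y = proj (a y * p y + b y * q y) (c y * p y + d y * q y)"
          unfolding fibre_coord_def s G_def using N(10)[OF y] triv(3)[OF Vt] by (simp add: mobius_proj[OF nz])
      qed (use N in auto)
    qed
    then show "case T of (V, t) \<Rightarrow> holomorphic_to_sphere (fibre_coord \<tau> s t) V" by (simp add: T)
  qed
  then show ?thesis using that fc by blast
qed

end

section \<open>Self-intersection of sections\<close>

lemma coset_translate: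
  assumes "coset \<tau> x = coset \<tau> x'" shows "coset \<tau> (y + (x' - x)) = coset \<tau> y"
proof -
  have "x' - x \<in> lattice \<tau>" using assms by (simp add: coset_eq_iff)
  then have "- (x' - x) \<in> lattice \<tau>" by (rule lattice_minus)
  then show ?thesis by (simp add: coset_eq_iff)
qed

lemma zorder_translate: "zorder (\<lambda>y. h (y + d)) x = zorder h (x + d)"
  using zorder_shift[of h "x + d"] zorder_shift[of "\<lambda>y. h (y + d)" x] by (simp add: ac_simps)

lemma meromorphic_translate:
  assumes "h meromorphic_on {x + d}" shows "(\<lambda>y. h (y + d)) meromorphic_on {x}"
  using assms unfolding meromorphic_on_def by (simp add: ac_simps)

text \<open>A constant map would be a common fixed point of z -> -z and z -> 1/z, and there is
  none.\<close>

lemma nonconstant_wronskian: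
  assumes lift: "equivariant_lift \<tau> p q"
  obtains z0 where "wronskian p q z0 \<noteq> 0"
proof -
  have hol: "p holomorphic_on UNIV" "q holomorphic_on UNIV" and nz: "\<And>x. (p x, q x) \<noteq> (0, 0)"
    and eq: "\<And>x. p (x + 1) * q x = - p x * q (x + 1)" "\<And>x. p (x + \<tau>) * p x = q x * q (x + \<tau>)"
    using lift unfolding equivariant_lift_def by auto
  have "\<exists>z0. wronskian p q z0 \<noteq> 0"
  proof (rule ccontr)
    assume W: "\<nexists>z0. wronskian p q z0 \<noteq> 0"
    show False
    proof (cases "\<exists>x0. q x0 \<noteq> 0")
      case False
      then show False using eq(2)[of 0] nz[of 0] nz[of \<tau>] by auto
    next
      case True
      then obtain x0 where x0: "q x0 \<noteq> 0" by blast
      obtain c where c: "\<And>x. p x = c * q x"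
        using wronskian_zero_imp_proportional[OF hol x0] W by metis
      have q: "q x \<noteq> 0" for x using nz[of x] c[of x] by auto
      have "c * (q 1 * q 0) = - c * (q 0 * q 1)" using eq(1)[of 0] c by simp
      then have "c = 0" using q by (simp add: mult.commute)
      then show False using eq(2)[of 0] c q by simp
    qed
  qed
  then show ?thesis using that by blast
qed

section \<open>The normal bundle of a section and its transition functions\<close>

locale flat_section = flat_ruled_surface \<tau> S \<pi> A F for \<tau> S \<pi> A F +
  fixes s :: "complex set \<Rightarrow> 'a" and p q :: "complex \<Rightarrow> complex"
  assumes sec: "holomorphic_section \<tau> S \<pi> A s" and lift: "equivariant_lift \<tau> p q"
    and coord: "fibre_coord \<tau> s F x = proj (p x) (q x)"
begin

abbreviation "FT \<equiv> finite_trivs \<tau> A s"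
abbreviation "td \<equiv> transition_deriv \<tau> s"
abbreviation "W \<equiv> wronskian p q"

definition w :: "(complex \<Rightarrow> sphere \<Rightarrow> 'a) \<Rightarrow> complex \<Rightarrow> complex" where
  "w t x = the (fibre_coord \<tau> s t x)"

definition trans_fun ::
  "(complex \<Rightarrow> sphere \<Rightarrow> 'a) \<Rightarrow> complex \<Rightarrow> (complex \<Rightarrow> sphere \<Rightarrow> 'a) \<Rightarrow> complex \<Rightarrow> complex \<Rightarrow> complex" where
  "trans_fun t x t' x' z = the (inv (t' x') (t x (Some z)))"

lemma p_hol: "p holomorphic_on UNIV" and q_hol: "q holomorphic_on UNIV"
  and nz: "(p x, q x) \<noteq> (0, 0)"
  using lift unfolding equivariant_lift_def by auto

lemma W_hol: "W holomorphic_on UNIV"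
  using wronskian_holomorphic p_hol q_hol by blast

lemma W_ev: "eventually (\<lambda>y. W y \<noteq> 0) (at x)"
  using nonconstant_wronskian[OF lift] entire_eventually_nonzero[OF W_hol] by metis

lemma FT_D:
  assumes "(V, t) \<in> FT"
  shows "(V, t) \<in> A" "x \<in> V \<Longrightarrow> fibre_coord \<tau> s t x = Some (w t x)"
  using assms unfolding finite_trivs_def w_def by auto

lemma FT_holomorphic:
  assumes "(V, t) \<in> FT" "x \<in> V"
  obtains N where "open N" "x \<in> N" "N \<subseteq> V" "w t holomorphic_on N"
proof -
  have "holomorphic_to_sphere (fibre_coord \<tau> s t) V"
    using sec FT_D(1)[OF assms(1)] unfolding holomorphic_section_def by blast
  then obtain N u v where N: "open N" "x \<in> N" "N \<subseteq> V" "u holomorphic_on N" "v holomorphic_on N"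
    "\<forall>y\<in>N. (u y, v y) \<noteq> (0, 0) \<and> fibre_coord \<tau> s t y = proj (u y) (v y)"
    using assms(2) unfolding holomorphic_to_sphere_def by meson
  have *: "v y \<noteq> 0 \<and> w t y = u y / v y" if "y \<in> N" for y
    using FT_D(2)[OF assms(1), of y] N that unfolding proj_def by (auto split: if_splits)
  have "(\<lambda>y. u y / v y) holomorphic_on N" using N * by (intro holomorphic_on_divide) auto
  then have "w t holomorphic_on N" by (rule holomorphic_transform) (simp add: *)
  then show ?thesis using that N by blast
qed

text \<open>The transition is a fibrewise Moebius map, with derivative (ad - bc)/(cw + d)^2 at the
  value w of the section. The denominator is nonzero because the section is finite in both
  trivializations, so the derivative is holomorphic and without zeros along the section.\<close>

lemma transition_derivative:
  assumes T: "(V, t) \<in> FT" "(V', t') \<in> FT" "x \<in> V" "x' \<in> V'" "coset \<tau> x = coset \<tau> x'"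
  obtains N J where "open N" "x \<in> N" "N \<subseteq> V" "J holomorphic_on N"
    "\<And>y. y \<in> N \<Longrightarrow> y + (x' - x) \<in> V'" "\<And>y. y \<in> N \<Longrightarrow> J y \<noteq> 0"
    "\<And>y. y \<in> N \<Longrightarrow> (trans_fun t y t' (y + (x' - x)) has_field_derivative J y) (at (w t y))"
    "\<And>y. y \<in> N \<Longrightarrow> trans_fun t y t' (y + (x' - x)) (w t y) = w t' (y + (x' - x))"
    "\<And>y. y \<in> N \<Longrightarrow> eventually (\<lambda>z. inv (t' (y + (x' - x))) (t y (Some z)) \<noteq> None) (nhds (w t y))"
    "\<And>y. y \<in> N \<Longrightarrow> td t y t' (y + (x' - x)) = J y"
proof -
  let ?d = "x' - x"
  note A = FT_D(1)[OF T(1)] FT_D(1)[OF T(2)]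
  obtain N0 a b c d where N0: "open N0" "x \<in> N0" "N0 \<subseteq> V" "a holomorphic_on N0" "b holomorphic_on N0"
    "c holomorphic_on N0" "d holomorphic_on N0" "\<And>y. y \<in> N0 \<Longrightarrow> a y * d y - b y * c y \<noteq> 0"
    "\<And>y. y \<in> N0 \<Longrightarrow> y + ?d \<in> V'"
    "\<And>y z. y \<in> N0 \<Longrightarrow> t y z = t' (y + ?d) (mobius (a y) (b y) (c y) (d y) z)"
    by (rule transition[OF A T(3-5)]) blast
  obtain N1 where N1: "open N1" "x \<in> N1" "N1 \<subseteq> V" "w t holomorphic_on N1"
    by (rule FT_holomorphic[OF T(1,3)])
  define N where "N = N0 \<inter> N1"
  have hol: "a holomorphic_on N" "b holomorphic_on N" "c holomorphic_on N" "d holomorphic_on N" "w t holomorphic_on N"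
    using N0 N1 unfolding N_def by (auto elim: holomorphic_on_subset)
  have tr: "inv (t' (y + ?d)) (t y (Some z)) = proj (a y * z + b y) (c y * z + d y)" if "y \<in> N" for y z
  proof -
    have "y + ?d \<in> V'" using that N0(9) unfolding N_def by blast
    then show ?thesis using triv(3)[OF A(2)] N0(10)[of y "Some z"] that
      unfolding N_def by (simp add: mobius_def)
  qed
  note coset_d = coset_translate[OF T(5)]
  have sect: "inv (t' (y + ?d)) (t y (Some (w t y))) = Some (w t' (y + ?d))" if "y \<in> N" for y
  proof -
    have y: "y \<in> V" "y + ?d \<in> V'" using that N0(3,9) unfolding N_def by auto
    have "t y (Some (w t y)) = s (coset \<tau> y)"
      using section_coord(2)[OF sec A(1) y(1)] FT_D(2)[OF T(1) y(1)] by simp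
    then have "inv (t' (y + ?d)) (t y (Some (w t y))) = fibre_coord \<tau> s t' (y + ?d)"
      unfolding fibre_coord_def coset_d by simp
    then show ?thesis using FT_D(2)[OF T(2) y(2)] by simp
  qed
  have den: "c y * w t y + d y \<noteq> 0" if "y \<in> N" for y
    using sect[OF that] unfolding tr[OF that] by (metis option.distinct(1) proj_eq_None_iff)
  define J where "J y = (a y * d y - b y * c y) / (c y * w t y + d y)\<^sup>2" for y
  have den_ev: "eventually (\<lambda>z. c y * z + d y \<noteq> 0) (nhds (w t y))" if "y \<in> N" for y
    by (rule tendsto_imp_eventually_ne[OF _ den[OF that]]) (intro tendsto_intros filterlim_ident)
  have deriv: "(trans_fun t y t' (y + ?d) has_field_derivative J y) (at (w t y))" if "y \<in> N" for y
  proof -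
    have "((\<lambda>z. (a y * z + b y) / (c y * z + d y)) has_field_derivative J y) (at (w t y))"
      unfolding J_def using den[OF that]
      by (auto intro!: derivative_eq_intros simp: field_simps power2_eq_square)
    moreover have "eventually (\<lambda>z. (a y * z + b y) / (c y * z + d y) = trans_fun t y t' (y + ?d) z) (nhds (w t y))"
      using den_ev[OF that] by eventually_elim (simp add: trans_fun_def tr[OF that] proj_def)
    ultimately show ?thesis by (subst (asm) DERIV_cong_ev[OF refl _ refl]) auto
  qed
  show ?thesis
  proof (rule that[of N J])
    show "open N" "x \<in> N" "N \<subseteq> V" using N0 N1 unfolding N_def by auto
    show "J holomorphic_on N" unfolding J_def using den by (intro holomorphic_intros hol) auto
    fix y assume y: "y \<in> N"
    show "y + ?d \<in> V'" using y N0(9) unfolding N_def by blast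
    show "J y \<noteq> 0" using N0(8) den y unfolding J_def N_def by auto
    show "(trans_fun t y t' (y + ?d) has_field_derivative J y) (at (w t y))" by (rule deriv[OF y])
    show "trans_fun t y t' (y + ?d) (w t y) = w t' (y + ?d)" unfolding trans_fun_def sect[OF y] by simp
    show "eventually (\<lambda>z. inv (t' (y + ?d)) (t y (Some z)) \<noteq> None) (nhds (w t y))"
      using den_ev[OF y] by eventually_elim (simp add: tr[OF y])
    show "td t y t' (y + ?d) = J y"
      unfolding transition_deriv_def using DERIV_imp_deriv[OF deriv[OF y]] unfolding trans_fun_def[abs_def] w_def .
  qed
qed

lemma td_point:
  assumes T: "(V, t) \<in> FT" "(V', t') \<in> FT" "x \<in> V" "x' \<in> V'" "coset \<tau> x = coset \<tau> x'"
  shows "(trans_fun t x t' x' has_field_derivative td t x t' x') (at (w t x))"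
    "trans_fun t x t' x' (w t x) = w t' x'"
    "eventually (\<lambda>z. inv (t' x') (t x (Some z)) \<noteq> None) (nhds (w t x))"
    "td t x t' x' \<noteq> 0"
proof -
  obtain N J where N: "open N" "x \<in> N" "N \<subseteq> V" "J holomorphic_on N"
    "\<And>y. y \<in> N \<Longrightarrow> y + (x' - x) \<in> V'" "\<And>y. y \<in> N \<Longrightarrow> J y \<noteq> 0"
    "\<And>y. y \<in> N \<Longrightarrow> (trans_fun t y t' (y + (x' - x)) has_field_derivative J y) (at (w t y))"
    "\<And>y. y \<in> N \<Longrightarrow> trans_fun t y t' (y + (x' - x)) (w t y) = w t' (y + (x' - x))"
    "\<And>y. y \<in> N \<Longrightarrow> eventually (\<lambda>z. inv (t' (y + (x' - x))) (t y (Some z)) \<noteq> None) (nhds (w t y))"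
    "\<And>y. y \<in> N \<Longrightarrow> td t y t' (y + (x' - x)) = J y"
    by (rule transition_derivative[OF T]) blast
  have xx: "x + (x' - x) = x'" by simp
  note * = N(6-10)[OF N(2), unfolded xx]
  show "(trans_fun t x t' x' has_field_derivative td t x t' x') (at (w t x))"
    "trans_fun t x t' x' (w t x) = w t' x'"
    "eventually (\<lambda>z. inv (t' x') (t x (Some z)) \<noteq> None) (nhds (w t x))"
    "td t x t' x' \<noteq> 0"
    using * by simp_all
qed

text \<open>The chain rule. Near the section the intermediate coordinate stays finite, which allows
  the two functions built with \<open>the\<close> to be composed.\<close>

lemma td_cocycle:
  assumes T: "(V, t) \<in> FT" "(V', t') \<in> FT" "(V'', t'') \<in> FT" "x \<in> V" "x' \<in> V'" "x'' \<in> V''"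
    "coset \<tau> x = coset \<tau> x'" "coset \<tau> x = coset \<tau> x''"
  shows "td t x t'' x'' = td t' x' t'' x'' * td t x t' x'"
proof -
  have c: "coset \<tau> x' = coset \<tau> x''" using T(7,8) by simp
  note 1 = td_point[OF T(1,2,4,5,7)] and 2 = td_point[OF T(2,3,5,6) c] and 3 = td_point[OF T(1,3,4,6,8)]
  have "((\<lambda>z. trans_fun t' x' t'' x'' (trans_fun t x t' x' z)) has_field_derivative
      td t' x' t'' x'' * td t x t' x') (at (w t x))"
    by (rule DERIV_chain2) (use 1 2 in simp_all)
  moreover have "eventually (\<lambda>z. trans_fun t' x' t'' x'' (trans_fun t x t' x' z) = trans_fun t x t'' x'' z) (nhds (w t x))"
    using 1(3)
  proof eventually_elim
    case (elim z)
    then have "Some (trans_fun t x t' x' z) = inv (t' x') (t x (Some z))" unfolding trans_fun_def by simp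
    then have "t' x' (Some (trans_fun t x t' x' z)) = t x (Some z)"
      using triv(4)[OF FT_D(1)[OF T(2)] T(5), of "t x (Some z)"] triv(5,6)[OF FT_D(1)[OF T(1)] T(4), of "Some z"] T(7)
      by simp
    then show ?case unfolding trans_fun_def[of t' x'] trans_fun_def[of t x t'' x''] by simp
  qed
  ultimately have "(trans_fun t x t'' x'' has_field_derivative td t' x' t'' x'' * td t x t' x') (at (w t x))"
    by (subst (asm) DERIV_cong_ev[OF refl _ refl]) auto
  then show ?thesis using 3(1) DERIV_unique by blast
qed

section \<open>The horizontal derivative of the section as a normal field\<close>

definition g where "g x = p x / q x"

lemma w_flat: "q x \<noteq> 0 \<Longrightarrow> w F x = g x"
  unfolding w_def coord g_def proj_def by simp

lemma flat_finite:
  assumes "q x \<noteq> 0"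
  obtains r where "r > 0" "(ball x r, F) \<in> FT" "\<And>y. y \<in> ball x r \<Longrightarrow> q y \<noteq> 0"
proof -
  obtain r1 where r1: "r1 > 0" "\<And>r'. r' \<le> r1 \<Longrightarrow> (ball x r', F) \<in> A" using flat_ball by metis
  have "eventually (\<lambda>y. q y \<noteq> 0) (nhds x)"
    using entire_isCont[OF q_hol] assms by (intro tendsto_imp_eventually_ne[of q "q x"])
      (auto simp: isCont_def tendsto_at_iff_tendsto_nhds)
  then obtain r2 where r2: "r2 > 0" "\<And>y. y \<in> ball x r2 \<Longrightarrow> q y \<noteq> 0"
    unfolding eventually_nhds_metric by (auto simp: dist_commute)
  have q: "q y \<noteq> 0" if "y \<in> ball x (min r1 r2)" for y using r2 that by simp
  have "(ball x (min r1 r2), F) \<in> FT"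
    unfolding finite_trivs_def using r1(2)[of "min r1 r2"] q by (auto simp: coord simp del: not_None_eq)
  then show ?thesis using that[of "min r1 r2"] r1(1) r2(1) q by simp
qed

text \<open>This is flatness: \<open>m\<close> does not depend on the base point. Both generators
  act by involutions, so 2\<Lambda> acts trivially and four classes of translations remain.\<close>

lemma F_lattice:
  assumes "l \<in> lattice \<tau>"
  obtains m where "\<And>x z. F (x + l) z = F x (m z)"
proof -
  define m1 where "m1 = mobius (-1) 0 0 1" define m2 where "m2 = mobius 0 1 1 0"
  note F1 = F_1[folded m1_def] and Ft = F_tau[folded m2_def]
  have inv: "m1 (m1 z) = z" "m2 (m2 z) = z" for z
  proof -
    obtain a b where ab: "(a, b) \<noteq> (0 :: complex, 0 :: complex)" "z = proj a b" by (rule sphere_lift)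
    have ab': "(- a, b) \<noteq> (0, 0)" "(b, a) \<noteq> (0, 0)" using ab(1) by auto
    show "m1 (m1 z) = z" "m2 (m2 z) = z"
      unfolding m1_def m2_def ab(2) mobius_proj[OF ab(1)] using mobius_proj[OF ab'(1), of "-1" 0 0 1] mobius_proj[OF ab'(2), of 0 1 1 0]
      by simp_all
  qed
  have F2: "F (x + 2) z = F x z" for x z
  proof -
    have x: "x + 2 = (x + 1) + 1" by simp
    show ?thesis unfolding x F1 inv ..
  qed
  have F2t: "F (x + 2 * \<tau>) z = F x z" for x z
  proof -
    have x: "x + 2 * \<tau> = (x + \<tau>) + \<tau>" by simp
    show ?thesis unfolding x Ft inv ..
  qed
  have per: "F (x + 2 * l) = F x" if "l \<in> lattice \<tau>" for l x
  proof -
    have "(\<lambda>x. F (2 * x)) (x / 2 + l) = (\<lambda>x. F (2 * x)) (x / 2)"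
      by (rule lattice_periodic[OF _ _ that]) (auto simp: distrib_left F2 F2t)
    then show ?thesis by (simp add: distrib_left)
  qed
  obtain m n where l: "l = of_int m + of_int n * \<tau>" using assms unfolding lattice_def by blast
  define h where "h = of_int (m div 2) + of_int (n div 2) * \<tau>"
  have h: "h \<in> lattice \<tau>" unfolding h_def by (rule latticeI)
  have *: "of_int m = 2 * of_int (m div 2) + (of_int (m mod 2) :: complex)" for m
    by (metis mult_div_mod_eq of_int_add of_int_mult of_int_numeral)
  have l': "l = 2 * h + (of_int (m mod 2) + of_int (n mod 2) * \<tau>)"
    unfolding l h_def by (subst *[of m], subst *[of n]) (simp add: algebra_simps)
  have "m mod 2 = 0 \<or> m mod 2 = 1" "n mod 2 = 0 \<or> n mod 2 = 1" by presburger+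
  then consider "l = 2 * h" | "l = 2 * h + 1" | "l = 2 * h + \<tau>" | "l = 2 * h + (1 + \<tau>)" using l' by auto
  then show ?thesis
  proof cases
    case 1
    then show ?thesis using that[of "\<lambda>z. z"] per[OF h] by simp
  next
    case 2
    have x: "x + l = (x + 1) + 2 * h" for x using 2 by simp
    have "F (x + l) z = F x (m1 z)" for x z unfolding x per[OF h] F1 ..
    then show ?thesis by (rule that)
  next
    case 3
    have x: "x + l = (x + \<tau>) + 2 * h" for x using 3 by simp
    have "F (x + l) z = F x (m2 z)" for x z unfolding x per[OF h] Ft ..
    then show ?thesis by (rule that)
  next
    case 4
    have x: "x + l = ((x + 1) + \<tau>) + 2 * h" for x using 4 by simp
    have "F (x + l) z = F x (m1 (m2 z))" for x z unfolding x per[OF h] Ft F1 ..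
    then show ?thesis by (rule that)
  qed
qed

lemma g_deriv:
  assumes "q x \<noteq> 0" shows "(g has_field_derivative W x / (q x)\<^sup>2) (at x)"
  unfolding g_def[abs_def] wronskian_def power2_eq_square using assms
  by (intro DERIV_divide entire_deriv p_hol q_hol)

lemma deriv_g: "q x \<noteq> 0 \<Longrightarrow> deriv g x = W x / (q x)\<^sup>2"
  using g_deriv DERIV_imp_deriv by blast

text \<open>Differentiate \<open>g (y + l) = m (g y)\<close>, read in finite coordinates. As
  \<open>m\<close> is the same over all base points, no derivative of \<open>m\<close> along the
  base appears, and the derivative of \<open>g\<close> transforms like a normal vector.\<close>

lemma flat_derivative_transition:
  assumes q: "q x \<noteq> 0" "q x' \<noteq> 0" and c: "coset \<tau> x = coset \<tau> x'"
  shows "deriv g x' = td F x F x' * deriv g x"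
proof -
  define l where "l = x' - x"
  have l: "l \<in> lattice \<tau>" using c by (simp add: coset_eq_iff l_def)
  obtain m where m: "\<And>x z. F (x + - l) z = F x (m z)" using F_lattice lattice_minus[OF l] by metis
  obtain r where r: "r > 0" "(ball x r, F) \<in> FT" "\<And>y. y \<in> ball x r \<Longrightarrow> q y \<noteq> 0" using flat_finite[OF q(1)] by metis
  obtain r' where r': "r' > 0" "(ball x' r', F) \<in> FT" "\<And>y. y \<in> ball x' r' \<Longrightarrow> q y \<noteq> 0" using flat_finite[OF q(2)] by metis
  have in_ball: "x \<in> ball x r" "x' \<in> ball x' r'" using r r' by auto
  note td = td_point[OF r(2) r'(2) in_ball c]
  have eq: "g (y + l) = trans_fun F x F x' (g y)" if "y \<in> ball x (min r r')" for y
  proof -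
    have qq: "q y \<noteq> 0" "q (y + l) \<noteq> 0"
      using r(3)[of y] r'(3)[of "y + l"] that by (auto simp: l_def dist_norm algebra_simps)
    have "F (y + l) (Some (g (y + l))) = s (coset \<tau> (y + l))"
      using section_coord(1)[OF sec, of "y + l"] qq unfolding coord proj_def g_def by simp
    also have "coset \<tau> (y + l) = coset \<tau> y" using l by (simp add: coset_shift)
    also have "s (coset \<tau> y) = F y (Some (g y))"
      using section_coord(1)[OF sec, of y] qq unfolding coord proj_def g_def by simp
    also have "\<dots> = F (y + l) (m (Some (g y)))" using m[of "y + l"] by simp
    finally have "Some (g (y + l)) = m (Some (g y))" by simp
    moreover have "inv (F x') (F x (Some (g y))) = m (Some (g y))" using m[of x'] by (simp add: l_def)
    ultimately show ?thesis unfolding trans_fun_def by (metis option.sel)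
  qed
  have "((\<lambda>y. trans_fun F x F x' (g y)) has_field_derivative td F x F x' * (W x / (q x)\<^sup>2)) (at x)"
    by (rule DERIV_chain2) (use td(1) g_deriv[OF q(1)] w_flat[OF q(1)] in simp_all)
  moreover have "eventually (\<lambda>y. trans_fun F x F x' (g y) = g (y + l)) (nhds x)"
    using eventually_nhds_in_open[of "ball x (min r r')" x] r(1) r'(1)
    by (auto elim!: eventually_mono simp: eq)
  ultimately have "((\<lambda>y. g (y + l)) has_field_derivative td F x F x' * (W x / (q x)\<^sup>2)) (at x)"
    by (subst (asm) DERIV_cong_ev[OF refl _ refl]) auto
  then have "(g has_field_derivative td F x F x' * (W x / (q x)\<^sup>2)) (at (x + l))"
    by (simp add: DERIV_shift)
  then show ?thesis using DERIV_imp_deriv deriv_g[OF q(1)] unfolding l_def by fastforce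
qed

text \<open>The derivative of the section relative to the horizontal directions of \<open>F\<close>. Replacing \<open>y\<close> by
  \<open>y + \<tau>\<close> moves the section away from infinity.\<close>

definition finite_rep :: "complex \<Rightarrow> complex" where
  "finite_rep y = (if q y = 0 then y + \<tau> else y)"

lemma finite_rep: "q (finite_rep y) \<noteq> 0" "coset \<tau> (finite_rep y) = coset \<tau> y"
proof -
  obtain l where "l \<noteq> 0" "q (y + \<tau>) = l * p y" using equivariant_lift_tau[OF lift] by metis
  then show "q (finite_rep y) \<noteq> 0" using nz[of y] unfolding finite_rep_def by auto
  show "coset \<tau> (finite_rep y) = coset \<tau> y" unfolding finite_rep_def by (simp add: coset_shift)
qed

definition flat_field :: "'a triv \<Rightarrow> complex \<Rightarrow> complex" where
  "flat_field T y = td F (finite_rep y) (snd T) y * deriv g (finite_rep y)"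

text \<open>Independence of the representative in the flat trivialization: the cocycle rule combined
  with the transformation law for the derivative of \<open>g\<close>.\<close>

lemma flat_field_eq:
  assumes T: "(V, t) \<in> FT" "y \<in> V" "q y' \<noteq> 0" "coset \<tau> y' = coset \<tau> y"
  shows "flat_field (V, t) y = td F y' t y * deriv g y'"
proof -
  obtain r where r: "r > 0" "(ball y' r, F) \<in> FT" using flat_finite[OF T(3)] by metis
  obtain r' where r': "r' > 0" "(ball (finite_rep y) r', F) \<in> FT" using flat_finite[OF finite_rep(1)] by metis
  have b: "y' \<in> ball y' r" "finite_rep y \<in> ball (finite_rep y) r'" using r r' by auto
  have c: "coset \<tau> y' = coset \<tau> (finite_rep y)" using T(4) finite_rep(2) by simp
  have "td F y' t y = td F (finite_rep y) t y * td F y' F (finite_rep y)"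
    by (rule td_cocycle[OF r(2) r'(2) T(1) b T(2) c T(4)])
  then show ?thesis unfolding flat_field_def
    using flat_derivative_transition[OF T(3) finite_rep(1) c] by simp
qed

text \<open>The derivative of \<open>g\<close> is W/q^2, so the field is a translate of the
  Wronskian times the nonvanishing factor J/q^2. Its orders are therefore those of
  \<open>W\<close>.\<close>

lemma flat_field_local:
  assumes T: "(V, t) \<in> FT" "x \<in> V" "q x' \<noteq> 0" "coset \<tau> x' = coset \<tau> x"
  obtains H where "H analytic_on {x'}" "H x' \<noteq> 0"
    "eventually (\<lambda>y. flat_field (V, t) y = H (y + (x' - x)) * W (y + (x' - x))) (nhds x)"
proof -
  obtain r where r: "r > 0" "(ball x' r, F) \<in> FT" "\<And>y. y \<in> ball x' r \<Longrightarrow> q y \<noteq> 0"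
    using flat_finite[OF T(3)] by metis
  have b: "x' \<in> ball x' r" using r by simp
  obtain N J where N: "open N" "x' \<in> N" "N \<subseteq> ball x' r" "J holomorphic_on N"
    "\<And>y. y \<in> N \<Longrightarrow> y + (x - x') \<in> V" "\<And>y. y \<in> N \<Longrightarrow> J y \<noteq> 0"
    "\<And>y. y \<in> N \<Longrightarrow> td F y t (y + (x - x')) = J y"
    by (rule transition_derivative[OF r(2) T(1) b T(2) T(4)]) blast
  define H where "H y = J y / (q y)\<^sup>2" for y
  have J: "J analytic_on {x'}" using N analytic_at by blast
  have "H analytic_on {x'}"
    unfolding H_def using T(3) by (intro analytic_intros J entire_analytic[OF q_hol]) auto
  moreover have "H x' \<noteq> 0" using N(2,6) T(3) unfolding H_def by simp
  moreover have "eventually (\<lambda>y. flat_field (V, t) y = H (y + (x' - x)) * W (y + (x' - x))) (nhds x)"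
  proof -
    have "open ((\<lambda>y. y + (x' - x)) -` N)" using N(1) by (intro open_vimage) (auto intro!: continuous_intros)
    then have "eventually (\<lambda>y. y \<in> (\<lambda>y. y + (x' - x)) -` N) (nhds x)"
      using N(2) by (intro eventually_nhds_in_open) auto
    then show ?thesis
    proof eventually_elim
      case (elim y)
      let ?y = "y + (x' - x)"
      have y: "?y \<in> N" using elim by simp
      have yV: "y \<in> V" using N(5)[OF y] by simp
      have qy: "q ?y \<noteq> 0" using r(3) N(3) y by blast
      have "coset \<tau> ?y = coset \<tau> y" by (rule coset_translate[OF T(4)[symmetric]])
      then have "flat_field (V, t) y = td F ?y t y * deriv g ?y"
        by (rule flat_field_eq[OF T(1) yV qy])
      also have "td F ?y t y = J ?y" using N(7)[OF y] by simp
      finally show ?case unfolding H_def deriv_g[OF qy] by simp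
    qed
  qed
  ultimately show ?thesis using that by blast
qed

lemma flat_field_order:
  assumes T: "(V, t) \<in> FT" "x \<in> V"
  shows "flat_field (V, t) analytic_on {x}" "eventually (\<lambda>y. flat_field (V, t) y \<noteq> 0) (at x)"
    "q x' \<noteq> 0 \<Longrightarrow> coset \<tau> x' = coset \<tau> x \<Longrightarrow> zorder (flat_field (V, t)) x = zorder W x'"
proof -
  have *: "flat_field (V, t) analytic_on {x} \<and> eventually (\<lambda>y. flat_field (V, t) y \<noteq> 0) (at x) \<and>
      zorder (flat_field (V, t)) x = zorder W x'"
    if x': "q x' \<noteq> 0" "coset \<tau> x' = coset \<tau> x" for x'
  proof -
    obtain H where H: "H analytic_on {x'}" "H x' \<noteq> 0"
      "eventually (\<lambda>y. flat_field (V, t) y = H (y + (x' - x)) * W (y + (x' - x))) (nhds x)"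
      by (rule flat_field_local[OF T x'])
    let ?k = "\<lambda>y. H y * W y"
    let ?d = "x' - x"
    have k: "?k analytic_on {x'}" using H(1) entire_analytic[OF W_hol] by (intro analytic_intros)
    have kd: "(\<lambda>y. ?k (y + ?d)) analytic_on {x}"
      using analytic_on_compose[of "\<lambda>y. y + ?d" "{x}" ?k] k by (simp add: o_def analytic_intros)
    have Hev: "eventually (\<lambda>y. H y \<noteq> 0) (at x')"
      using H analytic_at_neq_imp_eventually_neq by blast
    then have kev: "eventually (\<lambda>y. ?k y \<noteq> 0) (at x')"
      using W_ev[of x'] by eventually_elim simp
    have evat: "eventually (\<lambda>y. flat_field (V, t) y = ?k (y + ?d)) (at x)"
      using H(3) eventually_nhds_conv_at by blast
    have "filterlim (\<lambda>y. y + ?d) (at x') (at x)"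
      by (auto simp: filterlim_at eventually_at_filter intro!: tendsto_eq_intros)
    then have kev': "eventually (\<lambda>y. ?k (y + ?d) \<noteq> 0) (at x)"
      using kev by (rule eventually_compose_filterlim[rotated])
    have "zorder (flat_field (V, t)) x = zorder (\<lambda>y. ?k (y + ?d)) x"
      by (rule zorder_cong[OF evat refl])
    also have "\<dots> = zorder ?k x'" using zorder_translate[of ?k ?d x] by simp
    also have "\<dots> = zorder H x' + zorder W x'"
      by (rule zorder_times_analytic[OF H(1) entire_analytic[OF W_hol] kev])
    also have "zorder H x' = 0" by (rule zorder_eq_0I[OF H(1,2)])
    finally have "zorder (flat_field (V, t)) x = zorder W x'" by simp
    moreover have "flat_field (V, t) analytic_on {x}"
      using kd analytic_at_cong[OF H(3) refl] by blast
    moreover have "eventually (\<lambda>y. flat_field (V, t) y \<noteq> 0) (at x)"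
      using evat kev' by eventually_elim simp
    ultimately show ?thesis by blast
  qed
  show "flat_field (V, t) analytic_on {x}" "eventually (\<lambda>y. flat_field (V, t) y \<noteq> 0) (at x)"
    using *[OF finite_rep[of x]] by blast+
  show "q x' \<noteq> 0 \<Longrightarrow> coset \<tau> x' = coset \<tau> x \<Longrightarrow> zorder (flat_field (V, t)) x = zorder W x'"
    using * by blast
qed

lemma flat_field_normal: "meromorphic_normal_field \<tau> A s flat_field"
  unfolding meromorphic_normal_field_def
proof (intro conjI ballI)
  fix T assume "T \<in> FT"
  moreover obtain V t where T: "T = (V, t)" by (cases T)
  ultimately have Vt: "(V, t) \<in> FT" by simp
  have "flat_field (V, t) meromorphic_on V"
    using flat_field_order(1)[OF Vt] meromorphic_on_meromorphic_at[of "flat_field (V, t)" V] analytic_on_imp_meromorphic_on by blast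
  then show "case T of (V, t) \<Rightarrow> flat_field (V, t) meromorphic_on V \<and> (\<forall>x\<in>V. eventually (\<lambda>y. flat_field (V, t) y \<noteq> 0) (at x))"
    unfolding T using flat_field_order(2)[OF Vt] by simp
next
  fix T assume "T \<in> FT"
  moreover obtain V t where T: "T = (V, t)" by (cases T)
  ultimately have Vt: "(V, t) \<in> FT" by simp
  show "case T of (V, t) \<Rightarrow> \<forall>(V', t')\<in>FT. \<forall>x\<in>V. \<forall>x'\<in>V'. coset \<tau> x = coset \<tau> x' \<longrightarrow>
      eventually (\<lambda>y. flat_field (V', t') (y + (x' - x)) = td t y t' (y + (x' - x)) * flat_field (V, t) y) (at x)"
    unfolding T prod.case
  proof (intro ballI, clarify)
    fix V' t' x x'
    assume T': "(V', t') \<in> FT" "x \<in> V" "x' \<in> V'" "coset \<tau> x = coset \<tau> x'"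
    let ?d = "x' - x"
    have "open (V \<inter> (\<lambda>y. y + ?d) -` V')"
      using triv(1)[OF FT_D(1)[OF Vt]] triv(1)[OF FT_D(1)[OF T'(1)]]
      by (intro open_Int open_vimage) (auto intro!: continuous_intros)
    then have "eventually (\<lambda>y. y \<in> V \<inter> (\<lambda>y. y + ?d) -` V') (at x)"
      using T' by (intro eventually_at_in_open') auto
    then show "eventually (\<lambda>y. flat_field (V', t') (y + ?d) = td t y t' (y + ?d) * flat_field (V, t) y) (at x)"
    proof eventually_elim
      case (elim y)
      then have y: "y \<in> V" "y + ?d \<in> V'" by auto
      have d: "coset \<tau> y = coset \<tau> (y + ?d)" using coset_translate[OF T'(4)] by simp
      let ?z = "finite_rep y"
      have z: "coset \<tau> ?z = coset \<tau> (y + ?d)" using finite_rep(2) d by simp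
      obtain r where r: "r > 0" "(ball ?z r, F) \<in> FT" using flat_finite[OF finite_rep(1)] by metis
      have b: "?z \<in> ball ?z r" using r by simp
      have "flat_field (V', t') (y + ?d) = td F ?z t' (y + ?d) * deriv g ?z"
        by (rule flat_field_eq[OF T'(1) y(2) finite_rep(1) z])
      also have "td F ?z t' (y + ?d) = td t y t' (y + ?d) * td F ?z t y"
        by (rule td_cocycle[OF r(2) Vt T'(1) b y finite_rep(2) z])
      also have "td t y t' (y + ?d) * td F ?z t y * deriv g ?z = td t y t' (y + ?d) * flat_field (V, t) y"
        using flat_field_eq[OF Vt y(1) finite_rep] by simp
      finally show ?case .
    qed
  qed
qed

end

lemma equivariant_lift_translate:
  assumes "equivariant_lift \<tau> p q"
  shows "equivariant_lift \<tau> (\<lambda>x. p (x + a)) (\<lambda>x. q (x + a))"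
proof -
  have x: "x + 1 + a = (x + a) + 1" "x + \<tau> + a = (x + a) + \<tau>" for x by simp_all
  show ?thesis
    using assms holomorphic_shift[of p a] holomorphic_shift[of q a]
    unfolding equivariant_lift_def x by auto
qed

text \<open>Agreement is required at the point itself as well, because being nicely meromorphic also
  fixes the value there.\<close>

lemma nicely_meromorphic_cong_nhds:
  assumes "f nicely_meromorphic_on {x}" "eventually (\<lambda>y. g y = f y) (nhds x)"
  shows "g nicely_meromorphic_on {x}"
proof -
  have ev: "eventually (\<lambda>y. g y = f y) (at x)" and x: "g x = f x"
    using assms(2) by (auto simp: eventually_nhds_conv_at)
  have f: "f meromorphic_on {x}" "is_pole f x \<and> f x = 0 \<or> (f \<longlongrightarrow> f x) (at x)"
    using assms(1) unfolding nicely_meromorphic_on_def by auto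
  have "g meromorphic_on {x}"
    by (rule iffD2[OF meromorphic_on_cong f(1)]) (use ev in auto)
  then show ?thesis
    using f(2) unfolding nicely_meromorphic_on_def is_pole_cong[OF ev refl, symmetric]
      tendsto_cong[OF ev, symmetric] x[symmetric] by simp
qed

lemma eventually_at_translate:
  fixes x d :: "'a::real_normed_vector"
  assumes "eventually P (at (x + d))"
  shows "eventually (\<lambda>y. P (y + d)) (at x)"
proof -
  have "filterlim (\<lambda>y. y + d) (at (x + d)) (at x)"
    by (auto simp: filterlim_at eventually_at_filter intro!: tendsto_eq_intros)
  then show ?thesis using assms by (rule eventually_compose_filterlim[rotated])
qed

section \<open>Degrees of normal fields\<close>

context flat_section
begin

lemma finite_cover:
  obtains V t x' where "(V, t) \<in> FT" "x' \<in> V" "coset \<tau> x' = coset \<tau> x"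
  using flat_finite[OF finite_rep(1)[of x]] finite_rep(2)[of x] centre_in_ball by metis

lemma normal_field_D:
  assumes "meromorphic_normal_field \<tau> A s v" "(V, t) \<in> FT" "x \<in> V"
  shows "v (V, t) meromorphic_on {x}" "eventually (\<lambda>y. v (V, t) y \<noteq> 0) (at x)"
    "(V', t') \<in> FT \<Longrightarrow> x' \<in> V' \<Longrightarrow> coset \<tau> x = coset \<tau> x' \<Longrightarrow>
      eventually (\<lambda>y. v (V', t') (y + (x' - x)) = td t y t' (y + (x' - x)) * v (V, t) y) (at x)"
proof -
  have 1: "\<forall>(V, t) \<in> FT. v (V, t) meromorphic_on V \<and> (\<forall>x\<in>V. eventually (\<lambda>y. v (V, t) y \<noteq> 0) (at x))"
    and 2: "\<forall>(V, t) \<in> FT. \<forall>(V', t') \<in> FT. \<forall>x\<in>V. \<forall>x'\<in>V'. coset \<tau> x = coset \<tau> x' \<longrightarrow>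
      eventually (\<lambda>y. v (V', t') (y + (x' - x)) = td t y t' (y + (x' - x)) * v (V, t) y) (at x)"
    using assms(1) unfolding meromorphic_normal_field_def by blast+
  have "v (V, t) meromorphic_on V" using 1 assms(2) by auto
  then show "v (V, t) meromorphic_on {x}" using assms(3) by (auto elim: meromorphic_on_subset)
  show "eventually (\<lambda>y. v (V, t) y \<noteq> 0) (at x)" using 1 assms(2,3) by auto
  show "eventually (\<lambda>y. v (V', t') (y + (x' - x)) = td t y t' (y + (x' - x)) * v (V, t) y) (at x)"
    if "(V', t') \<in> FT" "x' \<in> V'" "coset \<tau> x = coset \<tau> x'"
    using bspec[OF 2 assms(2)] that assms(3) by auto
qed

lemma td_eventually:
  assumes "(V, t) \<in> FT" "(V', t') \<in> FT" "x \<in> V" "x' \<in> V'" "coset \<tau> x = coset \<tau> x'"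
  obtains J where "J analytic_on {x}" "J x \<noteq> 0"
    "eventually (\<lambda>y. td t y t' (y + (x' - x)) = J y \<and> J y \<noteq> 0) (at x)"
proof -
  obtain N J where N: "open N" "x \<in> N" "N \<subseteq> V" "J holomorphic_on N" "\<And>y. y \<in> N \<Longrightarrow> J y \<noteq> 0"
    "\<And>y. y \<in> N \<Longrightarrow> td t y t' (y + (x' - x)) = J y"
    by (rule transition_derivative[OF assms]) blast
  have "eventually (\<lambda>y. y \<in> N) (at x)" using N by (intro eventually_at_in_open') auto
  then have "eventually (\<lambda>y. td t y t' (y + (x' - x)) = J y \<and> J y \<noteq> 0) (at x)"
    by eventually_elim (use N in auto)
  then show ?thesis using that N analytic_at by blast
qed

text \<open>Transition derivatives are holomorphic and nonzero, so they leave the order unchanged.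
  This gives a meaning to the definite description in \<open>normal_field_order\<close>.\<close>

lemma normal_field_zorder:
  assumes v: "meromorphic_normal_field \<tau> A s v"
    and T: "(V, t) \<in> FT" "(V', t') \<in> FT" "x \<in> V" "x' \<in> V'" "coset \<tau> x = coset \<tau> x'"
  shows "zorder (v (V', t')) x' = zorder (v (V, t)) x"
proof -
  obtain J where J: "J analytic_on {x}" "J x \<noteq> 0"
    "eventually (\<lambda>y. td t y t' (y + (x' - x)) = J y \<and> J y \<noteq> 0) (at x)"
    by (rule td_eventually[OF T])
  note nf = normal_field_D[OF v T(1,3)]
  have ev: "eventually (\<lambda>y. v (V', t') (y + (x' - x)) = J y * v (V, t) y) (at x)"
    using nf(3)[OF T(2,4,5)] J(3) by eventually_elim simp
  have J0: "eventually (\<lambda>y. J y \<noteq> 0) (at x)" using J(3) by eventually_elim simp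
  have "zorder (v (V', t')) x' = zorder (\<lambda>y. v (V', t') (y + (x' - x))) x"
    unfolding zorder_translate by simp
  also have "\<dots> = zorder (\<lambda>y. J y * v (V, t) y) x" by (rule zorder_cong[OF ev refl])
  also have "\<dots> = zorder J x + zorder (v (V, t)) x"
    using J(1) J0 nf(1,2) by (intro zorder_mult) (auto intro: analytic_on_imp_meromorphic_on eventually_frequently)
  also have "zorder J x = 0" by (rule zorder_eq_0I[OF J(1,2)])
  finally show ?thesis by simp
qed

lemma normal_field_order_eq:
  assumes v: "meromorphic_normal_field \<tau> A s v" and T: "(V, t) \<in> FT" "x \<in> V" "coset \<tau> x = c"
  shows "normal_field_order \<tau> A s v c = zorder (v (V, t)) x"
  unfolding normal_field_order_def
proof (rule the_equality)
  show "\<exists>(V', t')\<in>FT. \<exists>x'\<in>V'. coset \<tau> x' = c \<and> zorder (v (V', t')) x' = zorder (v (V, t)) x"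
    using T by blast
  show "n = zorder (v (V, t)) x"
    if "\<exists>(V, t)\<in>FT. \<exists>x\<in>V. coset \<tau> x = c \<and> zorder (v (V, t)) x = n" for n
    using that normal_field_zorder[OF v T(1) _ T(2)] T(3) by auto
qed

definition flat_order :: "complex set \<Rightarrow> int" where
  "flat_order = normal_field_order \<tau> A s flat_field"

lemma flat_order_eq:
  assumes "q x \<noteq> 0" shows "flat_order (coset \<tau> x) = zorder W x"
proof -
  obtain V t x' where T: "(V, t) \<in> FT" "x' \<in> V" "coset \<tau> x' = coset \<tau> x" by (rule finite_cover)
  have "flat_order (coset \<tau> x) = zorder (flat_field (V, t)) x'"
    unfolding flat_order_def by (rule normal_field_order_eq[OF flat_field_normal T])
  also have "\<dots> = zorder W x" by (rule flat_field_order(3)[OF T(1,2) assms T(3)[symmetric]])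
  finally show ?thesis .
qed

lemma flat_order_nonneg: "c \<in> curve \<tau> \<Longrightarrow> flat_order c \<ge> 0"
  using flat_order_eq[OF finite_rep(1)] finite_rep(2)
    zorder_ge_0[OF entire_analytic[OF W_hol] eventually_frequently[OF _ W_ev]]
  by (auto simp: curve_iff)

text \<open>\<open>flat_order_eq\<close> covers the points with \<open>q x \<noteq> 0\<close>. From
  the others \<open>finite_rep\<close> moves by \<tau>, which multiplies the Wronskian by a nonzero
  factor.\<close>

lemma W_zero_iff: "W x = 0 \<longleftrightarrow> flat_order (coset \<tau> x) \<noteq> 0"
proof -
  obtain l where "l \<noteq> 0" "W (x + \<tau>) = - l\<^sup>2 * W x" using equivariant_lift_tau[OF lift] by metis
  then have "W x = 0 \<longleftrightarrow> W (finite_rep x) = 0" unfolding finite_rep_def by simp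
  also have "\<dots> \<longleftrightarrow> zorder W (finite_rep x) \<noteq> 0"
    using zorder_eq_0_iff[OF entire_analytic[OF W_hol] eventually_frequently[OF _ W_ev], of "finite_rep x"] by simp
  also have "zorder W (finite_rep x) = flat_order (coset \<tau> x)"
    using flat_order_eq[OF finite_rep(1)[of x]] finite_rep(2)[of x] by simp
  finally show ?thesis .
qed

lemma finite_flat_order: "finite {c \<in> curve \<tau>. flat_order c \<noteq> 0}"
proof -
  define B where "B = {x. coord1 \<tau> x \<in> {0..1} \<and> coord2 \<tau> x \<in> {0..1}}"
  have "{x. W x = 0} sparse_in UNIV"
    using W_ev eventually_cosparse_open_eq[OF open_UNIV, of "\<lambda>x. W x \<noteq> 0"] unfolding eventually_cosparse by simp
  then have "{x. W x = 0} sparse_in B" using sparse_in_subset by blast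
  then have "finite (B \<inter> {x. W x = 0})"
    using sparse_in_compact_finite compact_coord_box[OF tau_nz] unfolding B_def by blast
  moreover have "{c \<in> curve \<tau>. flat_order c \<noteq> 0} \<subseteq> coset \<tau> ` (B \<inter> {x. W x = 0})"
  proof safe
    fix c assume "c \<in> curve \<tau>" "flat_order c \<noteq> 0"
    then obtain x where x: "c = coset \<tau> x" by (auto simp: curve_iff)
    obtain l where l: "l \<in> lattice \<tau>" "0 \<le> coord1 \<tau> (x + l)" "coord1 \<tau> (x + l) < 1"
      "0 \<le> coord2 \<tau> (x + l)" "coord2 \<tau> (x + l) < 1"
      by (rule lattice_reduce[OF tau_nz])
    have c: "coset \<tau> (x + l) = c" using l(1) x by (simp add: coset_shift)
    then have "W (x + l) = 0" using W_zero_iff \<open>flat_order c \<noteq> 0\<close> by simp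
    then show "c \<in> coset \<tau> ` (B \<inter> {x. W x = 0})"
      using c l unfolding B_def by (intro image_eqI[of _ _ "x + l"]) auto
  qed
  ultimately show ?thesis using finite_surj by blast
qed

text \<open>Any two meromorphic normal fields differ by an elliptic function, whose divisor has degree zero.\<close>

lemma normal_field_degree_unique:
  assumes v: "meromorphic_normal_field \<tau> A s v"
  shows "normal_field_degree \<tau> A s v = normal_field_degree \<tau> A s flat_field"
proof -
  define R where "R T y = v T y / flat_field T y" for T y
  note ff = flat_field_normal
  have R_mero: "R (V, t) meromorphic_on {x}" and R_nz: "eventually (\<lambda>y. R (V, t) y \<noteq> 0) (at x)"
    and R_zorder: "zorder (R (V, t)) x = zorder (v (V, t)) x - zorder (flat_field (V, t)) x"
    if T: "(V, t) \<in> FT" "x \<in> V" for V t x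
  proof -
    note 1 = normal_field_D(1,2)[OF v T] and 2 = normal_field_D(1,2)[OF ff T]
    show "R (V, t) meromorphic_on {x}" unfolding R_def[abs_def] using 1 2 by (intro meromorphic_on_divide)
    show "eventually (\<lambda>y. R (V, t) y \<noteq> 0) (at x)" using 1(2) 2(2) by eventually_elim (simp add: R_def)
    show "zorder (R (V, t)) x = zorder (v (V, t)) x - zorder (flat_field (V, t)) x"
      unfolding R_def[abs_def] using 1 2 by (intro zorder_divide eventually_frequently at_neq_bot)
  qed
  have R_indep: "remove_sings (R (V', t')) x' = remove_sings (R (V, t)) x"
    if T: "(V, t) \<in> FT" "(V', t') \<in> FT" "x \<in> V" "x' \<in> V'" "coset \<tau> x = coset \<tau> x'" for V t V' t' x x'
  proof -
    obtain J where J: "eventually (\<lambda>y. td t y t' (y + (x' - x)) = J y \<and> J y \<noteq> 0) (at x)"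
      using td_eventually[OF T] by blast
    have "eventually (\<lambda>y. R (V', t') (y + (x' - x)) = R (V, t) y) (at x)"
      using J normal_field_D(3)[OF v T(1,3,2,4,5)] normal_field_D(3)[OF ff T(1,3,2,4,5)]
      by eventually_elim (simp add: R_def)
    then have "remove_sings (\<lambda>y. R (V', t') (y + (x' - x))) x = remove_sings (R (V, t)) x"
      by (rule remove_sings_cong) simp
    then show ?thesis using remove_sings_shift[of "R (V', t')" x "x' - x"] by simp
  qed
  define P where "P c z \<longleftrightarrow> fst z \<in> FT \<and> snd z \<in> fst (fst z) \<and> coset \<tau> (snd z) = c" for c and z :: "'a triv \<times> complex"
  \<comment> \<open>The quotient of the two fields does not depend on the trivialization, hence
    lives on the curve. Its singularities are removed because the defining identities hold on
    punctured neighbourhoods only, while gluing takes definite values.\<close>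
  define K where "K x = (let z = SOME z. P (coset \<tau> x) z in remove_sings (R (fst z)) (snd z))" for x
  have K_eq: "K x = remove_sings (R (V, t)) x'" if T: "(V, t) \<in> FT" "x' \<in> V" "coset \<tau> x' = coset \<tau> x" for x V t x'
  proof -
    define z where "z = (SOME z. P (coset \<tau> x) z)"
    have "P (coset \<tau> x) z" unfolding z_def by (rule someI[of _ "((V, t), x')"]) (use T in \<open>simp add: P_def\<close>)
    then have "remove_sings (R (V, t)) x' = remove_sings (R (fst z)) (snd z)"
      using R_indep[of "fst (fst z)" "snd (fst z)" V t "snd z" x'] T by (simp add: P_def)
    then show ?thesis unfolding K_def z_def[symmetric] by simp
  qed
  have K_per: "K (x + 1) = K x" "K (x + \<tau>) = K x" for x
    unfolding K_def using coset_shift[of x 1] coset_shift[of x \<tau>] by simp_all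
  have K_loc: "K nicely_meromorphic_on {x} \<and> eventually (\<lambda>y. K y \<noteq> 0) (at x) \<and>
      zorder K x = normal_field_order \<tau> A s v (coset \<tau> x) - flat_order (coset \<tau> x)" for x
  proof -
    obtain V t x' where T: "(V, t) \<in> FT" "x' \<in> V" "coset \<tau> x' = coset \<tau> x" by (rule finite_cover)
    let ?d = "x' - x"
    define R' where "R' y = R (V, t) (y + ?d)" for y
    have x': "x + ?d = x'" by simp
    have m: "R' meromorphic_on {x}"
      unfolding R'_def[abs_def] by (rule meromorphic_translate) (use R_mero[OF T(1,2)] in simp)
    have "open ((\<lambda>y. y + ?d) -` V)"
      using triv(1)[OF FT_D(1)[OF T(1)]] by (intro open_vimage) (auto intro!: continuous_intros)
    then have "eventually (\<lambda>y. y \<in> (\<lambda>y. y + ?d) -` V) (nhds x)"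
      using T(2) by (intro eventually_nhds_in_open) auto
    then have K: "eventually (\<lambda>y. K y = remove_sings R' y) (nhds x)"
    proof eventually_elim
      case (elim y)
      have "K y = remove_sings (R (V, t)) (y + ?d)"
        by (rule K_eq[OF T(1)]) (use elim coset_translate[OF T(3)[symmetric]] in auto)
      then show ?case unfolding R'_def[abs_def] remove_sings_shift .
    qed
    have 1: "K nicely_meromorphic_on {x}"
      by (rule nicely_meromorphic_cong_nhds[OF remove_sings_nicely_meromorphic[OF m] K])
    have "isolated_singularity_at R' x" using m meromorphic_at_iff by blast
    then have "eventually (\<lambda>y. remove_sings R' y = R' y) (at x)" by (rule eventually_remove_sings_eq_at)
    moreover have "eventually (\<lambda>y. K y = remove_sings R' y) (at x)" using K eventually_nhds_conv_at by blast
    ultimately have KR: "eventually (\<lambda>y. K y = R' y) (at x)" by eventually_elim simp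
    have "eventually (\<lambda>y. R' y \<noteq> 0) (at x)"
      unfolding R'_def by (rule eventually_at_translate) (use R_nz[OF T(1,2)] in simp)
    with KR have 2: "eventually (\<lambda>y. K y \<noteq> 0) (at x)" by eventually_elim simp
    have "zorder K x = zorder R' x" by (rule zorder_cong[OF KR refl])
    also have "\<dots> = zorder (R (V, t)) x'" unfolding R'_def[abs_def] zorder_translate by simp
    also have "\<dots> = zorder (v (V, t)) x' - zorder (flat_field (V, t)) x'" by (rule R_zorder[OF T(1,2)])
    also have "\<dots> = normal_field_order \<tau> A s v (coset \<tau> x) - flat_order (coset \<tau> x)"
      unfolding flat_order_def using normal_field_order_eq[OF v T] normal_field_order_eq[OF ff T] by simp
    finally show ?thesis using 1 2 by blast
  qed
  define n where "n c = normal_field_order \<tau> A s v c - flat_order c" for c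
  have K_nice: "K nicely_meromorphic_on UNIV"
    using K_loc meromorphic_on_meromorphic_at[of K UNIV] unfolding nicely_meromorphic_on_def by blast
  have "\<exists>x. K x \<noteq> 0" using K_loc[of 0] eventually_happens[of _ "at (0::complex)"] by auto
  \<comment> \<open>An elliptic function is quasi-periodic with \<open>b = 0\<close>, so its degree
    is 0.\<close>
  note deg = quasi_periodic_degree[OF tau K_nice this, of 0 0 0 n]
  have fin: "finite {c \<in> curve \<tau>. n c \<noteq> 0}"
    by (rule deg(1)) (use K_per K_loc in \<open>auto simp: n_def\<close>)
  have "\<exists>w::int. w \<noteq> 0 \<and> 2 * pi * \<i> * of_int (w * (\<Sum>c | c \<in> curve \<tau> \<and> n c \<noteq> 0. n c)) = - 0"
    by (rule deg(2)) (use K_per K_loc in \<open>auto simp: n_def\<close>)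
  then obtain w' :: int where "w' \<noteq> 0" "(of_int (w' * (\<Sum>c | c \<in> curve \<tau> \<and> n c \<noteq> 0. n c)) :: complex) = 0"
    by (auto simp del: of_int_mult of_int_sum)
  then have n0: "(\<Sum>c | c \<in> curve \<tau> \<and> n c \<noteq> 0. n c) = 0" unfolding of_int_eq_0_iff by simp
  \<comment> \<open>Outside this union of supports the orders of both fields and of their quotient
    vanish, so all three sums can be taken over \<open>B\<close>.\<close>
  define B where "B = {c \<in> curve \<tau>. n c \<noteq> 0} \<union> {c \<in> curve \<tau>. flat_order c \<noteq> 0}"
  have B: "finite B" "B \<subseteq> curve \<tau>" unfolding B_def using fin finite_flat_order by auto
  have "normal_field_degree \<tau> A s v = (\<Sum>c\<in>B. normal_field_order \<tau> A s v c)"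
    unfolding normal_field_degree_def using B by (intro sum.mono_neutral_left) (auto simp: B_def n_def)
  also have "\<dots> = (\<Sum>c\<in>B. flat_order c) + (\<Sum>c\<in>B. n c)"
    unfolding sum.distrib[symmetric] by (simp add: n_def)
  also have "(\<Sum>c\<in>B. n c) = (\<Sum>c | c \<in> curve \<tau> \<and> n c \<noteq> 0. n c)"
    using B by (intro sum.mono_neutral_right) (auto simp: B_def)
  also have "(\<Sum>c\<in>B. flat_order c) = normal_field_degree \<tau> A s flat_field"
    unfolding normal_field_degree_def flat_order_def[symmetric] using B
    by (intro sum.mono_neutral_right) (auto simp: B_def)
  finally show ?thesis using n0 by simp
qed

lemma self_intersection_eq:
  "self_intersection \<tau> A s = (\<Sum>c | c \<in> curve \<tau> \<and> flat_order c \<noteq> 0. flat_order c)"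
proof -
  have "self_intersection \<tau> A s = normal_field_degree \<tau> A s flat_field"
    unfolding self_intersection_def
  proof (rule the_equality)
    show "\<exists>v. meromorphic_normal_field \<tau> A s v \<and> normal_field_degree \<tau> A s v = normal_field_degree \<tau> A s flat_field"
      using flat_field_normal by blast
    show "d = normal_field_degree \<tau> A s flat_field"
      if "\<exists>v. meromorphic_normal_field \<tau> A s v \<and> normal_field_degree \<tau> A s v = d" for d
      using that normal_field_degree_unique by blast
  qed
  then show ?thesis unfolding normal_field_degree_def flat_order_def .
qed

text \<open>The orders are nonnegative integers with sum 1, so a single coset carries the order 1.
  Translation by a representative \<open>a\<close> moves this critical point to 0.\<close>

lemma self_intersection_1_critical:
  assumes "self_intersection \<tau> A s = 1"
  obtains a where "simple_critical \<tau> (\<lambda>x. p (x + a)) (\<lambda>x. q (x + a))"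
proof -
  let ?B = "{c \<in> curve \<tau>. flat_order c \<noteq> 0}"
  have sum: "(\<Sum>c\<in>?B. flat_order c) = 1" using assms self_intersection_eq by simp
  then obtain c where c: "c \<in> ?B" by (cases "?B = {}") auto
  have "flat_order c + (\<Sum>c\<in>?B - {c}. flat_order c) = 1"
    using sum.remove[OF finite_flat_order c, of flat_order] sum by simp
  moreover have "flat_order c \<ge> 1" using c flat_order_nonneg[of c] by auto
  moreover have "(\<Sum>c\<in>?B - {c}. flat_order c) \<ge> of_nat (card (?B - {c})) * 1"
    using flat_order_nonneg by (intro sum_bounded_below) force
  ultimately have *: "flat_order c = 1" "card (?B - {c}) = 0" by auto
  then have B: "?B = {c}" using finite_flat_order c by auto
  obtain a0 where "c = coset \<tau> a0" using c by (auto simp: curve_iff)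
  \<comment> \<open>With \<open>q a \<noteq> 0\<close> the order at this coset can be read off from
    the Wronskian at \<open>a\<close>.\<close>
  then obtain a where a: "c = coset \<tau> a" "q a \<noteq> 0" using finite_rep[of a0] by metis
  have zeros: "W x = 0 \<longleftrightarrow> x - a \<in> lattice \<tau>" for x
  proof -
    have "W x = 0 \<longleftrightarrow> coset \<tau> x \<in> ?B" using W_zero_iff by simp
    also have "\<dots> \<longleftrightarrow> coset \<tau> a = coset \<tau> x" unfolding B a(1) by auto
    finally show ?thesis by (simp add: coset_eq_iff)
  qed
  have "deriv W a \<noteq> 0"
  proof
    assume "deriv W a = 0"
    moreover have "W a = 0" using zeros by simp
    moreover obtain z0 where "W z0 \<noteq> 0" using nonconstant_wronskian[OF lift] by metis
    ultimately have "zorder W a \<ge> 2" using zorder_ge_2[OF W_hol] by blast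
    then show False using flat_order_eq[OF a(2)] a(1) *(1) by simp
  qed
  moreover have "deriv (\<lambda>x. W (x + a)) 0 = deriv W a"
    using entire_deriv[OF W_hol, of "0 + a"] by (intro DERIV_imp_deriv) (simp add: DERIV_shift[symmetric])
  moreover have W': "wronskian (\<lambda>x. p (x + a)) (\<lambda>x. q (x + a)) = (\<lambda>x. W (x + a))"
    by (rule ext) (rule wronskian_shift[OF p_hol q_hol])
  ultimately have "simple_critical \<tau> (\<lambda>x. p (x + a)) (\<lambda>x. q (x + a))"
    using equivariant_lift_translate[OF lift] zeros by (simp add: simple_critical_def W')
  then show ?thesis using that by blast
qed

end

section \<open>Classification of the minimal sections\<close>

locale flat_theta = flat_ruled_surface \<tau> S \<pi> A F + theta_pair \<tau> u v for \<tau> S \<pi> A F u v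
begin

lemma equivariant_translate:
  "equivariant_lift \<tau> (\<lambda>x. u (x - a)) (\<lambda>x. v (x - a))"
proof -
  have "equivariant_lift \<tau> u v" using simple_critical_theta unfolding simple_critical_def by blast
  from equivariant_lift_translate[OF this, of "- a"] show ?thesis by simp
qed

text \<open>Once the critical point is moved to 0, the lift of a minimal section is
  \<open>f0\<close> up to a lattice translation, and both translations merge into the parameter
  \<open>a\<close>. Conversely, the Wronskian of a translate of \<open>(u, v)\<close> has one simple
  zero modulo the lattice.\<close>

lemma minimal_sections_eq:
  "minimal_sections \<tau> S \<pi> A = {{F x (f0 (x - a)) | x. True} | a. True}"
proof (intro equalityI subsetI)
  have image: "s ` curve \<tau> = {F x (fibre_coord \<tau> s F x) | x. True}"
    if "holomorphic_section \<tau> S \<pi> A s" for s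
    using section_coord(1)[OF that] unfolding curve_def by auto
  {
    fix L assume "L \<in> minimal_sections \<tau> S \<pi> A"
    then obtain s where s: "L = s ` curve \<tau>" "holomorphic_section \<tau> S \<pi> A s" "self_intersection \<tau> A s = 1"
      unfolding minimal_sections_def by blast
    obtain p q where pq: "equivariant_lift \<tau> p q" "\<And>x. fibre_coord \<tau> s F x = proj (p x) (q x)"
      using section_lift[OF s(2)] by metis
    interpret s: flat_section \<tau> S \<pi> A F s p q
      by unfold_locales (use s pq in auto)
    obtain a where a: "simple_critical \<tau> (\<lambda>x. p (x + a)) (\<lambda>x. q (x + a))"
      using s.self_intersection_1_critical[OF s(3)] by metis
    obtain l where l: "\<And>x. proj (p (x + a)) (q (x + a)) = f0 (x + l)"
      using simple_critical_eq_f0[OF a] by metis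
    have "fibre_coord \<tau> s F x = f0 (x - (a - l))" for x
      using l[of "x - a"] unfolding pq(2) by (simp add: algebra_simps)
    then show "L \<in> {{F x (f0 (x - a)) | x. True} | a. True}"
      unfolding s(1) image[OF s(2)] by auto
  next
    fix L assume "L \<in> {{F x (f0 (x - a)) | x. True} | a. True}"
    then obtain a where L: "L = {F x (f0 (x - a)) | x. True}" by blast
    define p q where "p x = u (x - a)" and "q x = v (x - a)" for x
    have lift: "equivariant_lift \<tau> p q" unfolding p_def q_def by (rule equivariant_translate)
    obtain s where s: "holomorphic_section \<tau> S \<pi> A s" "\<And>x. fibre_coord \<tau> s F x = proj (p x) (q x)"
      using lift_section[OF lift] by metis
    interpret s: flat_section \<tau> S \<pi> A F s p q
      by unfold_locales (use s lift in auto)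
    have W: "wronskian p q = (\<lambda>x. W (x + - a))"
      using wronskian_shift[OF u_hol v_hol, of "- a"] unfolding p_def q_def by auto
    have order: "s.flat_order c = (if c = coset \<tau> a then 1 else 0)" if "c \<in> curve \<tau>" for c
    proof -
      obtain x where x: "q x \<noteq> 0" "c = coset \<tau> x" using \<open>c \<in> curve \<tau>\<close> s.finite_rep by (metis curve_iff)
      have "s.flat_order c = zorder W (x + - a)" using s.flat_order_eq[OF x(1)] unfolding x(2) W zorder_translate .
      also have "\<dots> = (if x - a \<in> lattice \<tau> then 1 else 0)" unfolding W_zorder by simp
      also have "x - a \<in> lattice \<tau> \<longleftrightarrow> c = coset \<tau> a" unfolding x(2) using coset_eq_iff[of \<tau> a x] by auto
      finally show ?thesis .
    qed
    have "{c \<in> curve \<tau>. s.flat_order c \<noteq> 0} = {coset \<tau> a}" using order by (auto split: if_splits)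
    then have "self_intersection \<tau> A s = 1" using s.self_intersection_eq order[of "coset \<tau> a"] by simp
    moreover have "L = s ` curve \<tau>" unfolding image[OF s(1)] L s(2) f0_def p_def q_def ..
    ultimately show "L \<in> minimal_sections \<tau> S \<pi> A" unfolding minimal_sections_def using s(1) by blast
  }
qed

end

section \<open>Coordinates outside the discriminant\<close>

text \<open>Complex linearity of the derivative is encoded by the two partial derivatives
  \<open>a\<close> and \<open>b\<close>, from which those of sums, products and compositions are
  computed.\<close>

definition holomorphic2_at :: "(complex \<times> complex \<Rightarrow> complex) \<Rightarrow> complex \<times> complex \<Rightarrow> bool" where
  "holomorphic2_at f q \<longleftrightarrow> (\<exists>a b. (f has_derivative (\<lambda>h. a * fst h + b * snd h)) (at q))"

lemma holomorphic2_at_fst: "holomorphic2_at fst q"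
  unfolding holomorphic2_at_def
  by (rule exI[of _ 1], rule exI[of _ 0]) (auto intro!: derivative_eq_intros)

lemma holomorphic2_at_snd: "holomorphic2_at snd q"
  unfolding holomorphic2_at_def
  by (rule exI[of _ 0], rule exI[of _ 1]) (auto intro!: derivative_eq_intros)

lemma holomorphic2_at_const: "holomorphic2_at (\<lambda>_. c) q"
  unfolding holomorphic2_at_def
  by (rule exI[of _ 0], rule exI[of _ 0]) (auto intro!: derivative_eq_intros)

lemma holomorphic2_at_add:
  assumes "holomorphic2_at f q" "holomorphic2_at g q"
  shows "holomorphic2_at (\<lambda>p. f p + g p) q"
proof -
  obtain a b where f: "(f has_derivative (\<lambda>h. a * fst h + b * snd h)) (at q)"
    using assms(1) unfolding holomorphic2_at_def by blast
  obtain c d where g: "(g has_derivative (\<lambda>h. c * fst h + d * snd h)) (at q)"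
    using assms(2) unfolding holomorphic2_at_def by blast
  have "((\<lambda>p. f p + g p) has_derivative (\<lambda>h. (a + c) * fst h + (b + d) * snd h)) (at q)"
    by (rule has_derivative_eq_rhs[OF has_derivative_add[OF f g]]) (simp add: fun_eq_iff algebra_simps)
  then show ?thesis unfolding holomorphic2_at_def by blast
qed

lemma holomorphic2_at_mult:
  assumes "holomorphic2_at f q" "holomorphic2_at g q"
  shows "holomorphic2_at (\<lambda>p. f p * g p) q"
proof -
  obtain a b where f: "(f has_derivative (\<lambda>h. a * fst h + b * snd h)) (at q)"
    using assms(1) unfolding holomorphic2_at_def by blast
  obtain c d where g: "(g has_derivative (\<lambda>h. c * fst h + d * snd h)) (at q)"
    using assms(2) unfolding holomorphic2_at_def by blast
  have "((\<lambda>p. f p * g p) has_derivative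
      (\<lambda>h. (f q * c + a * g q) * fst h + (f q * d + b * g q) * snd h)) (at q)"
    by (rule has_derivative_eq_rhs[OF has_derivative_mult[OF f g]]) (simp add: fun_eq_iff algebra_simps)
  then show ?thesis unfolding holomorphic2_at_def by blast
qed

lemma holomorphic2_at_compose:
  assumes "holomorphic2_at f q" "(k has_field_derivative k') (at (f q))"
  shows "holomorphic2_at (\<lambda>p. k (f p)) q"
proof -
  obtain a b where f: "(f has_derivative (\<lambda>h. a * fst h + b * snd h)) (at q)"
    using assms(1) unfolding holomorphic2_at_def by blast
  have k: "(k has_derivative (*) k') (at (f q))"
    using assms(2) by (simp add: has_field_derivative_def)
  have "((\<lambda>p. k (f p)) has_derivative (\<lambda>h. (k' * a) * fst h + (k' * b) * snd h)) (at q)"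
    by (rule has_derivative_eq_rhs[OF has_derivative_compose[OF f k]]) (simp add: fun_eq_iff algebra_simps)
  then show ?thesis unfolding holomorphic2_at_def by blast
qed

lemma holomorphic2_at_divide:
  assumes "holomorphic2_at f q" "holomorphic2_at g q" "g q \<noteq> 0"
  shows "holomorphic2_at (\<lambda>p. f p / g p) q"
proof -
  have "holomorphic2_at (\<lambda>p. inverse (g p)) q"
    by (rule holomorphic2_at_compose[OF assms(2) DERIV_inverse]) (rule assms(3))
  from holomorphic2_at_mult[OF assms(1) this] show ?thesis by (simp add: divide_inverse)
qed

lemma holomorphic2_onI:
  assumes "\<And>q. q \<in> D \<Longrightarrow> \<exists>N f1 f2. open N \<and> q \<in> N \<and> (\<forall>p\<in>N. g p = (f1 p, f2 p)) \<and>
      holomorphic2_at f1 q \<and> holomorphic2_at f2 q"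
  shows "holomorphic2_on g D"
  unfolding holomorphic2_on_def
proof
  fix q assume "q \<in> D"
  then obtain N f1 f2 where N: "open N" "q \<in> N" "\<And>p. p \<in> N \<Longrightarrow> g p = (f1 p, f2 p)"
    "holomorphic2_at f1 q" "holomorphic2_at f2 q" using assms[OF \<open>q \<in> D\<close>] by blast
  obtain a b where f1: "(f1 has_derivative (\<lambda>h. a * fst h + b * snd h)) (at q)"
    using N(4) unfolding holomorphic2_at_def by blast
  obtain c d where f2: "(f2 has_derivative (\<lambda>h. c * fst h + d * snd h)) (at q)"
    using N(5) unfolding holomorphic2_at_def by blast
  let ?L = "\<lambda>h. (a * fst h + b * snd h, c * fst h + d * snd h)"
  have "((\<lambda>p. (f1 p, f2 p)) has_derivative ?L) (at q)" by (rule has_derivative_Pair[OF f1 f2])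
  then have "(g has_derivative ?L) (at q)"
    by (rule has_derivative_transform_within_open[OF _ N(1,2)]) (simp add: N(3))
  then show "\<exists>L. (g has_derivative L) (at q) \<and>
      (\<forall>c u w. L (c * u, c * w) = (c * fst (L (u, w)), c * snd (L (u, w))))"
    by (intro exI[of _ ?L]) (simp add: algebra_simps)
qed

lemma holomorphic2_at_holomorphic_fst:
  assumes "a holomorphic_on N" "open N" "fst q \<in> N"
  shows "holomorphic2_at (\<lambda>p. a (fst p)) q"
  by (rule holomorphic2_at_compose[OF holomorphic2_at_fst holomorphic_derivI[OF assms]])

text \<open>\<open>small_period\<close> embeds \<open>D1\<close> into the curve and separates
  parallel lines that differ by a period in 2\<Lambda>. \<open>lattice_away\<close> keeps
  \<open>D2\<close> away from the ramification points of \<open>f0\<close>, so that y and -y' + 2l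
  cannot both lie in \<open>D2\<close>. The bound \<open>2 * r\<close> is chosen because the
  quantities 2l that occur are compared with errors of size less than \<open>4 * r\<close>.\<close>

locale flat_chart = flat_theta \<tau> S \<pi> A F u v for \<tau> S \<pi> A F u v +
  fixes x0 y0 :: complex and r :: real
  assumes r: "r > 0"
    and small_period: "l \<in> lattice \<tau> \<Longrightarrow> norm l < 2 * r \<Longrightarrow> l = 0"
    and lattice_away: "l \<in> lattice \<tau> \<Longrightarrow> 2 * r \<le> dist l y0"
    and v_nonzero: "y \<in> ball y0 r \<Longrightarrow> v y \<noteq> 0"
begin

abbreviation "D1 \<equiv> ball x0 r"
abbreviation "D2 \<equiv> ball y0 r"

definition g0 where "g0 y = u y / v y"
definition leaf_point where "leaf_point q = F (fst q) (f0 (snd q))"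
definition U where "U = leaf_point ` (D1 \<times> D2)"
definition \<phi> where "\<phi> = inv_into (D1 \<times> D2) leaf_point"

lemma f0_g0: "y \<in> D2 \<Longrightarrow> f0 y = Some (g0 y)"
  unfolding f0_def proj_def g0_def using v_nonzero by simp

lemma coset_inj_D1: "inj_on (coset \<tau>) D1"
proof (rule inj_onI)
  fix x y assume xy: "x \<in> D1" "y \<in> D1" "coset \<tau> x = coset \<tau> y"
  then have "norm (y - x) < 2 * r"
    using dist_triangle_less_add[of y x0 r x r] by (simp add: dist_norm dist_commute norm_minus_commute)
  then show "x = y" using small_period[of "y - x"] xy(3) by (simp add: coset_eq_iff)
qed

lemma flat_D1: "(D1, F) \<in> A"
  using flat_triv[OF open_ball coset_inj_D1] .

lemma no_lattice_sum:
  assumes "norm (s - 2 * y0) < 4 * r" "l \<in> lattice \<tau>" shows "s \<noteq> 2 * l"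
proof
  assume "s = 2 * l"
  then have "s - 2 * y0 = 2 * (l - y0)" by (simp only: right_diff_distrib)
  then have "2 * norm (l - y0) < 4 * r" using assms(1) by (simp only: norm_mult norm_numeral)
  then show False using lattice_away[OF assms(2)] by (simp add: dist_norm)
qed

lemma D2_not_lattice: "y \<in> D2 \<Longrightarrow> y \<notin> lattice \<tau>"
  using lattice_away[of y] r by (auto simp: dist_commute)

lemma f0_inj: "inj_on f0 D2"
proof (rule inj_onI)
  fix y y' assume y: "y \<in> D2" "y' \<in> D2" "f0 y = f0 y'"
  have n: "norm (y - y0) < r" "norm (y' - y0) < r" using y by (auto simp: dist_norm norm_minus_commute)
  obtain l where l: "l \<in> lattice \<tau>" "y = y' + 2 * l \<or> y = - y' + 2 * l"
    using y(3) unfolding f0_eq_lattice_iff by blast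
  from l(2) show "y = y'"
  proof
    assume "y = y' + 2 * l"
    then have "norm (2 * l) = norm ((y - y0) - (y' - y0))" by simp
    also have "\<dots> < 2 * r" using norm_triangle_ineq4[of "y - y0" "y' - y0"] n by simp
    finally have "l = 0" using small_period[OF l(1)] r by (simp add: norm_mult)
    then show ?thesis using \<open>y = y' + 2 * l\<close> by simp
  next
    assume "y = - y' + 2 * l"
    then have s: "y + y' = 2 * l" by simp
    have "norm (y + y' - 2 * y0) = norm ((y - y0) + (y' - y0))" by (simp add: algebra_simps)
    also have "\<dots> < 4 * r" using norm_triangle_ineq[of "y - y0" "y' - y0"] n r by simp
    finally show ?thesis using no_lattice_sum[OF _ l(1)] s by blast
  qed
qed

lemma leaf_point_inj: "inj_on leaf_point (D1 \<times> D2)"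
proof (rule inj_onI)
  fix p q assume pq: "p \<in> D1 \<times> D2" "q \<in> D1 \<times> D2" "leaf_point p = leaf_point q"
  then have "coset \<tau> (fst p) = coset \<tau> (fst q)" using F_simps(3) unfolding leaf_point_def by metis
  then have 1: "fst p = fst q" using coset_inj_D1 pq by (auto simp: inj_on_def mem_Times_iff)
  then have "f0 (snd p) = f0 (snd q)" using pq(3) unfolding leaf_point_def by simp
  then have "snd p = snd q" using f0_inj pq by (auto simp: inj_on_def mem_Times_iff)
  with 1 show "p = q" by (rule prod_eqI)
qed

lemma phi_leaf_point: "q \<in> D1 \<times> D2 \<Longrightarrow> \<phi> (leaf_point q) = q"
  unfolding \<phi>_def by (rule inv_into_f_f[OF leaf_point_inj])

lemma phi_U: "\<phi> ` U = D1 \<times> D2"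
  unfolding U_def image_image using phi_leaf_point by force

lemma phi_inj: "inj_on \<phi> U"
  unfolding \<phi>_def U_def by (rule inj_on_inv_into) simp

lemma U_subset: "U \<subseteq> S"
  unfolding U_def leaf_point_def by auto

lemma g0_holomorphic: "g0 holomorphic_on D2"
  unfolding g0_def using v_nonzero u_hol v_hol
  by (intro holomorphic_on_divide) (auto elim: holomorphic_on_subset)

lemma g0_inj: "inj_on g0 D2"
  using f0_inj f0_g0 unfolding inj_on_def by simp

lemma g0_inverse:
  obtains k where "k holomorphic_on g0 ` D2" "\<And>y. y \<in> D2 \<Longrightarrow> k (g0 y) = y" "open (g0 ` D2)"
proof -
  obtain k where "k holomorphic_on g0 ` D2" "\<And>y. y \<in> D2 \<Longrightarrow> k (g0 y) = y"
    using holomorphic_has_inverse[OF g0_holomorphic open_ball g0_inj] by metis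
  then show ?thesis using that open_mapping_thm3[OF g0_holomorphic open_ball g0_inj] by blast
qed

text \<open>In the trivialization \<open>t\<close>, the coordinates \<open>\<phi>\<close> are a translation of the base followed by
  a fibrewise Moebius map and a branch of the inverse of \<open>f0\<close>.\<close>

lemma chart_local:
  assumes T: "(V, t) \<in> A" "q \<in> finite_points (V, t) U"
  obtains N f1 f2 where "open N" "q \<in> N" "N \<subseteq> finite_points (V, t) U"
    "\<And>p. p \<in> N \<Longrightarrow> \<phi> (t (fst p) (Some (snd p))) = (f1 p, f2 p)"
    "holomorphic2_at f1 q" "holomorphic2_at f2 q"
proof -
  obtain x w where q: "q = (x, w)" by (cases q)
  have x: "x \<in> V" "t x (Some w) \<in> U" using T(2) unfolding q finite_points_def by auto
  obtain x1 y1 where xy: "x1 \<in> D1" "y1 \<in> D2" "t x (Some w) = F x1 (Some (g0 y1))"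
    using x(2) f0_g0 unfolding U_def leaf_point_def by auto
  have c: "coset \<tau> x = coset \<tau> x1" using triv(6)[OF T(1) x(1)] xy(3) F_simps(3) by metis
  let ?d = "x1 - x"
  obtain N a b c d where N: "open N" "x \<in> N" "N \<subseteq> V" "a holomorphic_on N" "b holomorphic_on N"
    "c holomorphic_on N" "d holomorphic_on N" "\<And>y. y \<in> N \<Longrightarrow> a y * d y - b y * c y \<noteq> 0"
    "\<And>y. y \<in> N \<Longrightarrow> y + ?d \<in> D1"
    "\<And>y z. y \<in> N \<Longrightarrow> t y z = F (y + ?d) (mobius (a y) (b y) (c y) (d y) z)"
    by (rule transition[OF T(1) flat_D1 x(1) xy(1) c]) blast
  obtain k where k: "k holomorphic_on g0 ` D2" "\<And>y. y \<in> D2 \<Longrightarrow> k (g0 y) = y" "open (g0 ` D2)"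
    by (rule g0_inverse) blast
  define num den where "num p = a (fst p) * snd p + b (fst p)" and "den p = c (fst p) * snd p + d (fst p)"
    for p :: "complex \<times> complex"
  have tr: "t (fst p) (Some (snd p)) = F (fst p + ?d) (proj (num p) (den p))" if "fst p \<in> N" for p
    using N(10)[OF that, of "Some (snd p)"] by (simp add: mobius_def num_def den_def)
  have "F x1 (proj (num q) (den q)) = F x1 (Some (g0 y1))"
    using tr[of q] N(2) xy(3) by (simp add: q)
  then have q1: "den q \<noteq> 0" "num q / den q = g0 y1" by (auto simp: proj_def split: if_splits)
  have cont: "continuous_on (N \<times> UNIV) num" "continuous_on (N \<times> UNIV) den"
  proof -
    have "continuous_on (N \<times> (UNIV :: complex set)) (\<lambda>p. h (fst p))" if "h holomorphic_on N" for h
      by (rule continuous_on_compose2[OF holomorphic_on_imp_continuous_on[OF that]]) (auto intro!: continuous_intros)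
    from this[OF N(4)] this[OF N(5)] this[OF N(6)] this[OF N(7)]
    show "continuous_on (N \<times> UNIV) num" "continuous_on (N \<times> UNIV) den"
      unfolding num_def den_def by (auto intro!: continuous_intros)
  qed
  define N0 where "N0 = {p \<in> N \<times> UNIV. den p \<in> - {0}}"
  have N0: "open N0"
    unfolding N0_def using continuous_open_preimage[OF cont(2), of "- {0}"] N(1)
    by (auto simp: open_Times vimage_def Int_def)
  \<comment> \<open>The branch \<open>k\<close> of the inverse is available only over the image of
    \<open>D2\<close> under \<open>g0\<close>, so the neighbourhood is cut down accordingly.\<close>
  define M where "M = {p \<in> N0. num p / den p \<in> g0 ` D2}"
  have "continuous_on N0 (\<lambda>p. num p / den p)"
    using cont unfolding N0_def by (intro continuous_on_divide) (auto elim: continuous_on_subset)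
  then have "open (N0 \<inter> (\<lambda>p. num p / den p) -` (g0 ` D2))" by (rule continuous_open_preimage[OF _ N0 k(3)])
  then have M: "open M" unfolding M_def by (simp add: vimage_def Int_def)
  define f1 f2 where "f1 p = fst p + ?d" and "f2 p = k (num p / den p)" for p :: "complex \<times> complex"
  have q_N0: "q \<in> N0" unfolding N0_def using q1 N(2) by (simp add: q)
  have q_M: "q \<in> M" unfolding M_def using q_N0 q1 xy(2) by simp
  have loc: "t (fst p) (Some (snd p)) = leaf_point (f1 p, f2 p) \<and> (f1 p, f2 p) \<in> D1 \<times> D2 \<and> fst p \<in> V" if "p \<in> M" for p
  proof -
    have p: "fst p \<in> N" "den p \<noteq> 0" "num p / den p \<in> g0 ` D2" using that unfolding M_def N0_def by auto
    then obtain y where y: "y \<in> D2" "num p / den p = g0 y" by blast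
    then have f2: "f2 p = y" unfolding f2_def using k(2) by simp
    have "t (fst p) (Some (snd p)) = leaf_point (f1 p, f2 p)"
      unfolding tr[OF p(1)] leaf_point_def f2 f1_def using p(2) y f0_g0 by (simp add: proj_def)
    then show ?thesis using N(3,9) p(1) y(1) f2 unfolding f1_def by auto
  qed
  show ?thesis
  proof (rule that[of M f1 f2, OF M q_M])
    show "M \<subseteq> finite_points (V, t) U"
      using loc unfolding finite_points_def U_def by fastforce
    show "\<phi> (t (fst p) (Some (snd p))) = (f1 p, f2 p)" if "p \<in> M" for p
      using loc[OF that] phi_leaf_point by simp
    show "holomorphic2_at f1 q" unfolding f1_def by (intro holomorphic2_at_add holomorphic2_at_fst holomorphic2_at_const)
    have x_q: "fst q \<in> N" using N(2) q by simp
    have "holomorphic2_at (\<lambda>p. num p / den p) q"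
      unfolding num_def den_def
      by (intro holomorphic2_at_divide holomorphic2_at_add holomorphic2_at_mult holomorphic2_at_snd
          holomorphic2_at_holomorphic_fst[OF _ N(1) x_q] N(4-7)) (use q1(1) in \<open>simp add: den_def\<close>)
    then show "holomorphic2_at f2 q" unfolding f2_def
      by (rule holomorphic2_at_compose) (rule holomorphic_derivI[OF k(1,3)], use q1 xy in auto)
  qed
qed

text \<open>The inverse change of coordinates applies \<open>g0\<close> to y, followed by a
  fibrewise Moebius map and a translation of the base.\<close>

lemma chart_inverse_local:
  assumes T: "(V, t) \<in> A" "x \<in> V" "t x (Some w) = leaf_point q" "q \<in> D1 \<times> D2"
  obtains N f1 f2 where "open N" "q \<in> N" "N \<subseteq> D1 \<times> D2"
    "\<And>p. p \<in> N \<Longrightarrow> (f1 p, f2 p) \<in> finite_points (V, t) U \<and> t (f1 p) (Some (f2 p)) = leaf_point p"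
    "holomorphic2_at f1 q" "holomorphic2_at f2 q"
proof -
  obtain x1 y1 where q: "q = (x1, y1)" by (cases q)
  have xy: "x1 \<in> D1" "y1 \<in> D2" "t x (Some w) = F x1 (Some (g0 y1))"
    using T(3,4) f0_g0 unfolding q leaf_point_def by auto
  have c: "coset \<tau> x1 = coset \<tau> x" using triv(6)[OF T(1,2)] xy(3) F_simps(3) by metis
  let ?d = "x - x1"
  obtain N a b c d where N: "open N" "x1 \<in> N" "N \<subseteq> D1" "a holomorphic_on N" "b holomorphic_on N"
    "c holomorphic_on N" "d holomorphic_on N" "\<And>y. y \<in> N \<Longrightarrow> a y * d y - b y * c y \<noteq> 0"
    "\<And>y. y \<in> N \<Longrightarrow> y + ?d \<in> V"
    "\<And>y z. y \<in> N \<Longrightarrow> F y z = t (y + ?d) (mobius (a y) (b y) (c y) (d y) z)"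
    by (rule transition[OF flat_D1 T(1) xy(1) T(2) c]) blast
  define num den where "num p = a (fst p) * g0 (snd p) + b (fst p)" and "den p = c (fst p) * g0 (snd p) + d (fst p)"
    for p :: "complex \<times> complex"
  have tr: "leaf_point p = t (fst p + ?d) (proj (num p) (den p))" if "fst p \<in> N" "snd p \<in> D2" for p
    using N(10)[OF that(1), of "Some (g0 (snd p))"] f0_g0[OF that(2)]
    by (simp add: leaf_point_def mobius_def num_def den_def)
  have "t x (proj (num q) (den q)) = t x (Some w)"
    using tr[of q] N(2) xy T(3) by (simp add: q)
  then have "proj (num q) (den q) = Some w" using triv(3)[OF T(1,2)] by metis
  then have q1: "den q \<noteq> 0" by (auto simp: proj_def split: if_splits)
  have cont: "continuous_on (N \<times> D2) den"
  proof -
    have 1: "continuous_on (N \<times> D2) (\<lambda>p. h (fst p))" if "h holomorphic_on N" for h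
      by (rule continuous_on_compose2[OF holomorphic_on_imp_continuous_on[OF that]]) (auto intro!: continuous_intros)
    have 2: "continuous_on (N \<times> D2) (\<lambda>p. g0 (snd p))"
      by (rule continuous_on_compose2[OF holomorphic_on_imp_continuous_on[OF g0_holomorphic]]) (auto intro!: continuous_intros)
    show ?thesis unfolding den_def using 1[OF N(6)] 1[OF N(7)] 2 by (intro continuous_intros)
  qed
  define M where "M = {p \<in> N \<times> D2. den p \<in> - {0}}"
  have M: "open M"
    unfolding M_def using continuous_open_preimage[OF cont, of "- {0}"] N(1)
    by (auto simp: open_Times vimage_def Int_def)
  have q_M: "q \<in> M" unfolding M_def using q1 N(2) xy(2) by (simp add: q)
  define f1 f2 where "f1 p = fst p + ?d" and "f2 p = num p / den p" for p :: "complex \<times> complex"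
  have MD: "M \<subseteq> D1 \<times> D2" unfolding M_def using N(3) by auto
  have loc: "t (f1 p) (Some (f2 p)) = leaf_point p \<and> f1 p \<in> V" if "p \<in> M" for p
    using tr[of p] N(9)[of "fst p"] that unfolding M_def f1_def f2_def by (auto simp: proj_def mem_Times_iff)
  show ?thesis
  proof (rule that[of M f1 f2, OF M q_M MD])
    show "(f1 p, f2 p) \<in> finite_points (V, t) U \<and> t (f1 p) (Some (f2 p)) = leaf_point p" if "p \<in> M" for p
      using loc[OF that] that MD unfolding finite_points_def U_def by auto
    show "holomorphic2_at f1 q" unfolding f1_def by (intro holomorphic2_at_add holomorphic2_at_fst holomorphic2_at_const)
    have x_q: "fst q \<in> N" using N(2) q by simp
    have "holomorphic2_at (\<lambda>p. g0 (snd p)) q"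
      by (rule holomorphic2_at_compose[OF holomorphic2_at_snd holomorphic_derivI[OF g0_holomorphic open_ball]])
        (use xy in \<open>simp add: q\<close>)
    then show "holomorphic2_at f2 q" unfolding f2_def num_def den_def
      by (intro holomorphic2_at_divide holomorphic2_at_add holomorphic2_at_mult
          holomorphic2_at_holomorphic_fst[OF _ N(1) x_q] N(4-7)) (use q1(1) in \<open>simp_all add: den_def\<close>)
  qed
qed

lemma chart_biholomorphic:
  assumes T: "(V, t) \<in> A"
  shows "open (finite_points (V, t) U)"
    "biholomorphic2_on (\<lambda>(x, w). \<phi> (t x (Some w))) (finite_points (V, t) U)"
proof -
  define D where "D = finite_points (V, t) U"
  define G where "G p = \<phi> (t (fst p) (Some (snd p)))" for p
  have G: "(\<lambda>(x, w). \<phi> (t x (Some w))) = G" by (auto simp: G_def)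
  have loc: "\<exists>N f1 f2. open N \<and> q \<in> N \<and> N \<subseteq> D \<and> (\<forall>p\<in>N. G p = (f1 p, f2 p)) \<and>
      holomorphic2_at f1 q \<and> holomorphic2_at f2 q" if q: "q \<in> D" for q
  proof -
    obtain N f1 f2 where N: "open N" "q \<in> N" "N \<subseteq> D" "\<And>p. p \<in> N \<Longrightarrow> G p = (f1 p, f2 p)"
      "holomorphic2_at f1 q" "holomorphic2_at f2 q"
      unfolding D_def G_def by (rule chart_local[OF T q[unfolded D_def]]) blast
    then show ?thesis by (intro exI[of _ N] exI[of _ f1] exI[of _ f2]) simp
  qed
  have D: "open D"
  proof (subst open_subopen, intro ballI)
    fix q assume "q \<in> D"
    then show "\<exists>N. open N \<and> q \<in> N \<and> N \<subseteq> D" using loc[of q] by blast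
  qed
  then show "open (finite_points (V, t) U)" by (simp add: D_def)
  have mem: "fst p \<in> V \<and> t (fst p) (Some (snd p)) \<in> U" if "p \<in> D" for p
    using that unfolding D_def finite_points_def by auto
  have inj: "inj_on G D"
  proof (rule inj_onI)
    fix p q assume pq: "p \<in> D" "q \<in> D" "G p = G q"
    then have eq: "t (fst p) (Some (snd p)) = t (fst q) (Some (snd q))"
      using inj_onD[OF phi_inj] mem unfolding G_def by blast
    then have "coset \<tau> (fst p) = coset \<tau> (fst q)" using triv(6)[OF T] mem pq by metis
    then have 1: "fst p = fst q" using inj_onD[OF triv(2)[OF T]] mem pq by blast
    then have "Some (snd p) = Some (snd q)" using eq triv(3)[OF T] mem[OF pq(1)] by metis
    with 1 show "p = q" by (simp add: prod_eq_iff)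
  qed
  have img: "\<exists>N f1 f2. open N \<and> q \<in> N \<and> N \<subseteq> G ` D \<and> (\<forall>p\<in>N. inv_into D G p = (f1 p, f2 p)) \<and>
      holomorphic2_at f1 q \<and> holomorphic2_at f2 q"
    if q_im: "q \<in> G ` D" for q
  proof -
    obtain p where "p \<in> D" "q = G p" using q_im by (rule imageE)
    then have p: "p \<in> D" "q = \<phi> (t (fst p) (Some (snd p)))" unfolding G_def by auto
    have pU: "t (fst p) (Some (snd p)) \<in> U" "fst p \<in> V" using mem[OF p(1)] by auto
    then have q: "q \<in> D1 \<times> D2" "t (fst p) (Some (snd p)) = leaf_point q"
      using phi_U p(2) unfolding U_def by (auto simp: phi_leaf_point)
    obtain N f1 f2 where N: "open N" "q \<in> N" "N \<subseteq> D1 \<times> D2"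
      "\<And>p. p \<in> N \<Longrightarrow> (f1 p, f2 p) \<in> D \<and> t (f1 p) (Some (f2 p)) = leaf_point p"
      "holomorphic2_at f1 q" "holomorphic2_at f2 q"
      unfolding D_def by (rule chart_inverse_local[OF T pU(2) q(2,1)]) blast
    have *: "G (f1 p, f2 p) = p" if "p \<in> N" for p
      using N(3,4) that phi_leaf_point unfolding G_def by auto
    have inv: "inv_into D G p = (f1 p, f2 p)" if "p \<in> N" for p
      by (rule inv_into_f_eq[OF inj]) (use N(4)[OF that] *[OF that] in auto)
    have "N \<subseteq> G ` D"
    proof
      fix p assume "p \<in> N"
      then show "p \<in> G ` D" using *[of p] N(4)[of p] by (intro image_eqI[of _ _ "(f1 p, f2 p)"]) auto
    qed
    then show ?thesis using N inv by (intro exI[of _ N] exI[of _ f1] exI[of _ f2]) simp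
  qed
  have "open (G ` D)"
  proof (subst open_subopen, intro ballI)
    fix q assume "q \<in> G ` D"
    then show "\<exists>N. open N \<and> q \<in> N \<and> N \<subseteq> G ` D" using img[of q] by blast
  qed
  moreover have "holomorphic2_on G D"
  proof (rule holomorphic2_onI)
    fix q assume "q \<in> D"
    then show "\<exists>N f1 f2. open N \<and> q \<in> N \<and> (\<forall>p\<in>N. G p = (f1 p, f2 p)) \<and>
        holomorphic2_at f1 q \<and> holomorphic2_at f2 q"
      using loc[of q] by blast
  qed
  moreover have "holomorphic2_on (inv_into D G) (G ` D)"
  proof (rule holomorphic2_onI)
    fix q assume "q \<in> G ` D"
    then show "\<exists>N f1 f2. open N \<and> q \<in> N \<and> (\<forall>p\<in>N. inv_into D G p = (f1 p, f2 p)) \<and>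
        holomorphic2_at f1 q \<and> holomorphic2_at f2 q"
      using img[of q] by blast
  qed
  ultimately show "biholomorphic2_on (\<lambda>(x, w). \<phi> (t x (Some w))) (finite_points (V, t) U)"
    unfolding biholomorphic2_on_def G D_def[symmetric] using D inj by blast
qed

lemma chart_coordinates: "holomorphic_coordinates S A U \<phi>"
  unfolding holomorphic_coordinates_def surface_open_def
proof (intro conjI ballI)
  show "open (finite_points T U)" if "T \<in> A" for T
    using chart_biholomorphic(1) that by (cases T) simp
  show "open (\<phi> ` U)" unfolding phi_U by (intro open_Times open_ball)
  fix T assume "T \<in> A"
  then show "case T of (V, t) \<Rightarrow> biholomorphic2_on (\<lambda>(x, w). \<phi> (t x (Some w))) (finite_points (V, t) U)"
    using chart_biholomorphic(2) by (cases T) simp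
qed (use U_subset phi_inj in auto)

end

section \<open>Leaves in the coordinates\<close>

text \<open>Lines as level sets of a linear form: this is the shape in which the traces of the
  leaves arise.\<close>

lemma parallel_lines_eq:
  assumes "d \<noteq> (0, 0)"
  shows "parallel_lines d = {{p. fst d * snd p - snd d * fst p = k} | k. True}"
proof -
  obtain a b where d: "d = (a, b)" by (cases d)
  have line: "{(x + c * a, y + c * b) | c. True} = {p. a * snd p - b * fst p = a * y - b * x}" for x y
  proof (intro equalityI subsetI)
    fix p assume "p \<in> {p. a * snd p - b * fst p = a * y - b * x}"
    then have eq: "a * (snd p - y) = b * (fst p - x)" by (simp add: algebra_simps)
    show "p \<in> {(x + c * a, y + c * b) | c. True}"
    proof (cases "a = 0")
      case True
      then have b: "b \<noteq> 0" using assms d by simp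
      then have "p = (x + (snd p - y) / b * a, y + (snd p - y) / b * b)" using eq True by (simp add: prod_eq_iff)
      then show ?thesis by blast
    next
      case False
      then have "snd p - y = (fst p - x) / a * b" using eq by (simp add: field_simps)
      then have "snd p = y + (fst p - x) / a * b" by (simp only: diff_eq_eq add.commute)
      then have "p = (x + (fst p - x) / a * a, y + (fst p - x) / a * b)" using False by (simp add: prod_eq_iff)
      then show ?thesis by blast
    qed
  qed (auto simp: algebra_simps)
  have ex: "\<exists>x y. k = a * y - b * x" for k
  proof (cases "a = 0")
    case True
    then have "k = a * 0 - b * (- (k / b))" using assms d by simp
    then show ?thesis by blast
  next
    case False
    then have "k = a * (k / a) - b * 0" by simp
    then show ?thesis by blast
  qed
  show ?thesis unfolding parallel_lines_def d fst_conv snd_conv line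
  proof (intro equalityI subsetI)
    fix X assume "X \<in> {{p. a * snd p - b * fst p = k} | k. True}"
    then obtain k where X: "X = {p. a * snd p - b * fst p = k}" by blast
    obtain x y where "k = a * y - b * x" using ex by blast
    then show "X \<in> {{p. a * snd p - b * fst p = a * w - b * u} | u w. True}" using X by blast
  qed blast
qed

lemma components_convex:
  fixes X :: "'a::real_normed_vector set"
  assumes "convex X" "X \<noteq> {}" shows "components X = {X}"
  using assms components_eq_sing_iff convex_connected by blast

text \<open>The second projection of a component is a connected subset of a countable set, hence a
  point. This serves for the Riccati leaves, which may cross a chart several times.\<close>

lemma component_Times_countable:
  fixes B :: "'a::real_normed_vector set" and Y :: "'b::real_normed_vector set"
  assumes B: "connected B" and Y: "countable Y" and K: "K \<in> components (B \<times> Y)" and p: "p \<in> K"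
  shows "K = B \<times> {snd p}"
proof
  have sub: "K \<subseteq> B \<times> Y" and conn: "connected K" using in_components_subset[OF K] in_components_connected[OF K] by auto
  have "connected (snd ` K)" by (intro connected_continuous_image continuous_intros conn)
  moreover have "snd ` K \<subseteq> Y" using sub by auto
  then have "countable (snd ` K)" using Y by (rule countable_subset)
  ultimately have "snd q = snd p" if "q \<in> K" for q
    using connected_uncountable[of "snd ` K" "snd q" "snd p"] that p by blast
  then show "K \<subseteq> B \<times> {snd p}" using sub by auto
  have "connected (B \<times> {snd p})" by (intro connected_Times B connected_sing)
  moreover have "p \<in> B \<times> {snd p}" "snd p \<in> Y" using sub p by (auto simp: mem_Times_iff)
  then have "B \<times> {snd p} \<subseteq> B \<times> Y" "K \<inter> (B \<times> {snd p}) \<noteq> {}" using p by auto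
  ultimately show "B \<times> {snd p} \<subseteq> K" using components_maximal[OF K] by blast
qed

lemma countable_lattice: "countable (lattice \<tau>)"
proof -
  have "lattice \<tau> = (\<lambda>(m, n). of_int m + of_int n * \<tau>) ` UNIV" unfolding lattice_def by auto
  then show ?thesis by simp
qed

section \<open>Leaves and discriminant in terms of the pairs (x, y)\<close>

context flat_theta
begin

definition leaf :: "complex \<Rightarrow> 'a set" where "leaf a = {F x (f0 (x - a)) | x. True}"

lemma minimal_sections_leaf: "minimal_sections \<tau> S \<pi> A = {leaf a | a. True}"
  unfolding minimal_sections_eq leaf_def ..

text \<open>The equivariance of \<open>f0\<close> matches the monodromy of \<open>F\<close>, so
  translating x and y together by a period changes nothing.\<close>

lemma F_f0_lattice:
  assumes "l \<in> lattice \<tau>" shows "F (x + l) (f0 (y + l)) = F x (f0 y)"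
proof -
  have u: "(u z, v z) \<noteq> (0, 0)" "(- u z, v z) \<noteq> (0, 0)" "(v z, u z) \<noteq> (0, 0)" for z
    using no_common_zero[of z] by auto
  have "F (x + (t + 1)) (f0 (y + (t + 1))) = F (x + t) (f0 (y + t))" for t
    unfolding add.assoc[symmetric] F_1 f0_1 mobius_proj[OF u(2)] by (simp add: f0_def)
  moreover have "F (x + (t + \<tau>)) (f0 (y + (t + \<tau>))) = F (x + t) (f0 (y + t))" for t
    unfolding add.assoc[symmetric] F_tau f0_tau mobius_proj[OF u(3)] by (simp add: f0_def)
  ultimately show ?thesis
    using lattice_periodic[of "\<lambda>t. F (x + t) (f0 (y + t))" \<tau> l 0, OF _ _ assms] by simp
qed

lemma F_eq_lattice: "F x z = F x' z' \<Longrightarrow> \<exists>l\<in>lattice \<tau>. x' = x + l"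
proof -
  assume "F x z = F x' z'"
  then have "coset \<tau> x = coset \<tau> x'" using F_simps(3) by metis
  then have "x' - x \<in> lattice \<tau>" by (simp add: coset_eq_iff)
  then show ?thesis by (intro bexI[of _ "x' - x"]) auto
qed

lemma leaf_iff: "F x z \<in> leaf a \<longleftrightarrow> z = f0 (x - a)"
proof
  assume "F x z \<in> leaf a"
  then obtain x' where x': "F x z = F x' (f0 (x' - a))" unfolding leaf_def by blast
  then obtain l where l: "l \<in> lattice \<tau>" "x' = x + l" using F_eq_lattice by blast
  have eq: "x + l - a = (x - a) + l" by simp
  have "F x z = F x (f0 (x - a))" using x' unfolding l(2) eq F_f0_lattice[OF l(1)] .
  then show "z = f0 (x - a)" by simp
qed (auto simp: leaf_def)

text \<open>The leaves through the point have the parameters \<open>x - y\<close> and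
  \<open>x + y\<close>, up to 2\<Lambda>. They are the same leaf exactly when 2y lies in
  2\<Lambda>.\<close>

lemma discriminant_iff: "F x (f0 y) \<in> discriminant \<tau> S \<pi> A \<longleftrightarrow> y \<in> lattice \<tau>"
proof
  assume "F x (f0 y) \<in> discriminant \<tau> S \<pi> A"
  then have "\<exists>!L. L \<in> {leaf a | a. True} \<and> F x (f0 y) \<in> L"
    unfolding discriminant_def minimal_sections_leaf by simp
  moreover have "leaf (x - y) \<in> {leaf a | a. True} \<and> F x (f0 y) \<in> leaf (x - y)"
    "leaf (x + y) \<in> {leaf a | a. True} \<and> F x (f0 y) \<in> leaf (x + y)"
    by (auto simp: leaf_iff)
  ultimately have "leaf (x - y) = leaf (x + y)" by blast
  then have "f0 (t - (x - y)) = f0 (t - (x + y))" for t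
    using leaf_iff[of t "f0 (t - (x - y))" "x - y"] leaf_iff[of t "f0 (t - (x - y))" "x + y"] by simp
  \<comment> \<open>Equality of the two sections over x + c allows 2y = 2l or 2c = 2l. The choice c
    = 1/2 rules out the second case, since 1/2 is not a lattice point.\<close>
  from this[of "x + 1 / 2"] obtain l where l: "l \<in> lattice \<tau>"
      "y + 1 / 2 = (1 / 2 - y) + 2 * l \<or> y + 1 / 2 = - (1 / 2 - y) + 2 * l"
    unfolding f0_eq_lattice_iff by (auto simp: algebra_simps)
  moreover have "y + 1 / 2 \<noteq> - (1 / 2 - y) + 2 * l"
  proof
    assume "y + 1 / 2 = - (1 / 2 - y) + 2 * l"
    then have "2 * l = 1" by (simp add: algebra_simps)
    then have "l = 1 / 2" by (simp add: eq_divide_eq mult.commute)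
    from l(1)[unfolded this] show False using half_not_in_lattice(1)[OF tau_nz] by (rule notE[rotated])
  qed
  ultimately have "2 * y = 2 * l" by (auto simp: algebra_simps)
  then show "y \<in> lattice \<tau>" using l(1) by simp
next
  assume y: "y \<in> lattice \<tau>"
  have unique: "leaf a = leaf (x - y)" if mem: "F x (f0 y) \<in> leaf a" for a
  proof -
    obtain l where l: "l \<in> lattice \<tau>" "y = (x - a) + 2 * l \<or> y = - (x - a) + 2 * l"
      using mem unfolding leaf_iff f0_eq_lattice_iff by blast
    have "\<exists>k\<in>lattice \<tau>. a = (x - y) + 2 * k"
      using l(2)
    proof
      assume "y = (x - a) + 2 * l"
      then have "a = (x - y) + 2 * l" by simp
      then show ?thesis using l(1) by blast
    next
      assume "y = - (x - a) + 2 * l"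
      then have "a = (x - y) + 2 * (y - l)" by (simp add: algebra_simps)
      then show ?thesis using lattice_diff[OF y l(1)] by blast
    qed
    then obtain k where k: "k \<in> lattice \<tau>" "a = (x - y) + 2 * k" by blast
    have "f0 (t - a) = f0 (t - (x - y))" for t
      using f0_2lattice[OF lattice_minus[OF k(1)], of "t - (x - y)"] unfolding k(2) by (simp add: algebra_simps)
    then show ?thesis unfolding leaf_def by simp
  qed
  have "F x (f0 y) \<in> leaf (x - y)" by (simp add: leaf_iff)
  then show "F x (f0 y) \<in> discriminant \<tau> S \<pi> A"
    unfolding discriminant_def minimal_sections_leaf using unique by auto
qed

lemma chart_exists:
  assumes "q \<in> S - discriminant \<tau> S \<pi> A"
  obtains x0 y0 r where "flat_chart \<tau> S \<pi> A F u v y0 r" "q = F x0 (f0 y0)"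
proof -
  have "\<pi> q \<in> curve \<tau>" using assms ruled unfolding ruled_surface_def by blast
  then obtain x where x: "\<pi> q = coset \<tau> x" by (auto simp: curve_iff)
  obtain y where "f0 y = inv (F x) q" using f0_surj by metis
  then have q: "q = F x (f0 y)" using F_inv[OF _ x] assms by simp
  obtain x0 y0 where xy: "q = F x0 (f0 y0)" "v y0 \<noteq> 0"
  proof (cases "v y = 0")
    \<comment> \<open>At a pole of \<open>f0\<close> both coordinates are moved by \<tau>. This
      exchanges \<open>u\<close> and \<open>v\<close> up to a nonzero factor, so the new value is
      finite.\<close>
    case True
    then have "v (y + \<tau>) \<noteq> 0" using no_common_zero[of y] v_shift[of y] by simp
    then show ?thesis using that[of "x + \<tau>" "y + \<tau>"] q F_f0_lattice[of \<tau> x y] by simp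
  qed (use that q in blast)
  have y0: "y0 \<notin> lattice \<tau>" using assms xy discriminant_iff by blast
  obtain r1 where r1: "r1 > 0" "\<And>l. l \<in> lattice \<tau> \<Longrightarrow> l \<noteq> 0 \<Longrightarrow> r1 \<le> dist l 0"
    by (rule lattice_bounded_away[OF tau_nz, of 0]) blast
  obtain r2 where r2: "r2 > 0" "\<And>l. l \<in> lattice \<tau> \<Longrightarrow> l \<noteq> y0 \<Longrightarrow> r2 \<le> dist l y0"
    by (rule lattice_bounded_away[OF tau_nz, of y0]) blast
  have "eventually (\<lambda>y. v y \<noteq> 0) (nhds y0)"
    using entire_isCont[OF v_hol] xy(2) by (intro tendsto_imp_eventually_ne[of v "v y0"])
      (auto simp: isCont_def tendsto_at_iff_tendsto_nhds)
  then obtain r3 where r3: "r3 > 0" "\<And>y. y \<in> ball y0 r3 \<Longrightarrow> v y \<noteq> 0"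
    unfolding eventually_nhds_metric by (auto simp: dist_commute)
  define r where "r = min (min (r1 / 2) (r2 / 2)) r3"
  have r: "r > 0" "2 * r \<le> r1" "2 * r \<le> r2" "r \<le> r3" using r1(1) r2(1) r3(1) unfolding r_def by auto
  have "flat_chart \<tau> S \<pi> A F u v y0 r"
  proof unfold_locales
    show "l = 0" if "l \<in> lattice \<tau>" "norm l < 2 * r" for l
      using r1(2)[OF that(1)] that(2) r(2) by (cases "l = 0") auto
    show "2 * r \<le> dist l y0" if "l \<in> lattice \<tau>" for l
      using r2(2)[OF that] y0 that r(3) by (metis order_trans)
    show "v y \<noteq> 0" if "y \<in> ball y0 r" for y using r3(2) that r(4) by auto
  qed (rule r(1))
  then show ?thesis using that xy(1) by blast
qed

end

text \<open>In order: the two families of minimal sections, the Riccati leaves (y constant) and the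
  fibres (x constant).\<close>

definition web_direction :: "nat \<Rightarrow> complex \<times> complex" where
  "web_direction i = (if i = 0 then (1, 1) else if i = 1 then (1, - 1) else if i = 2 then (1, 0) else (0, 1))"

section \<open>Plaques of the four families in a chart\<close>

context flat_chart
begin

abbreviation "D \<equiv> D1 \<times> D2"

definition plaque :: "complex \<times> complex \<Rightarrow> complex \<Rightarrow> (complex \<times> complex) set" where
  "plaque d k = {p \<in> D. fst d * snd p - snd d * fst p = k}"

definition trace :: "'a set \<Rightarrow> (complex \<times> complex) set" where
  "trace L = {p \<in> D. leaf_point p \<in> L}"

lemma trace_eq: "\<phi> ` (L \<inter> U) = trace L"
proof -
  have "L \<inter> U = leaf_point ` trace L" unfolding U_def trace_def by blast
  then have "\<phi> ` (L \<inter> U) = (\<lambda>p. \<phi> (leaf_point p)) ` trace L" by (simp only: image_image)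
  also have "\<dots> = (\<lambda>p. p) ` trace L" by (rule image_cong[OF refl phi_leaf_point]) (simp add: trace_def)
  finally show ?thesis by simp
qed

lemma plaque_convex: "convex (plaque d k)"
proof (rule convexI)
  fix p q :: "complex \<times> complex" and s t :: real
  assume pq: "p \<in> plaque d k" "q \<in> plaque d k" and st: "0 \<le> s" "0 \<le> t" "s + t = 1"
  have "convex D" by (intro convex_Times convex_ball)
  then have "s *\<^sub>R p + t *\<^sub>R q \<in> D" using pq st unfolding plaque_def by (intro convexD) auto
  moreover have "fst d * snd (s *\<^sub>R p + t *\<^sub>R q) - snd d * fst (s *\<^sub>R p + t *\<^sub>R q) =
      of_real s * (fst d * snd p - snd d * fst p) + of_real t * (fst d * snd q - snd d * fst q)"
    by (simp add: scaleR_conv_of_real algebra_simps)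
  moreover have "of_real s * k + of_real t * k = k"
    using st(3) by (metis distrib_right mult_1 of_real_1 of_real_add)
  ultimately show "s *\<^sub>R p + t *\<^sub>R q \<in> plaque d k" using pq unfolding plaque_def by auto
qed

lemma plaque_components: "p \<in> plaque d k \<Longrightarrow> components (plaque d k) = {plaque d k}"
  by (rule components_convex[OF plaque_convex]) auto

lemma D_bounds:
  assumes "p \<in> D" "p' \<in> D"
  shows "norm (fst p' - fst p) < 2 * r" "norm (snd p' - snd p) < 2 * r"
    "norm (snd p' + snd p - 2 * y0) < 2 * r"
proof -
  have *: "norm (fst p - x0) < r" "norm (fst p' - x0) < r" "norm (snd p - y0) < r" "norm (snd p' - y0) < r"
    using assms by (auto simp: mem_Times_iff dist_norm norm_minus_commute)
  show "norm (fst p' - fst p) < 2 * r"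
    using norm_triangle_ineq4[of "fst p' - x0" "fst p - x0"] * by simp
  show "norm (snd p' - snd p) < 2 * r"
    using norm_triangle_ineq4[of "snd p' - y0" "snd p - y0"] * by simp
  have "snd p' + snd p - 2 * y0 = (snd p' - y0) + (snd p - y0)" by simp
  then show "norm (snd p' + snd p - 2 * y0) < 2 * r"
    using norm_triangle_ineq[of "snd p' - y0" "snd p - y0"] * by simp
qed

lemma lattice_translates_equal:
  assumes "norm s < 2 * r" "norm t < 2 * r" "s - t = 2 * (l' - l)" "l \<in> lattice \<tau>" "l' \<in> lattice \<tau>"
  shows "s = t"
proof -
  have "2 * norm (l' - l) = norm (s - t)" unfolding assms(3) norm_mult by simp
  also have "\<dots> < 4 * r" using norm_triangle_ineq4[of s t] assms(1,2) by simp
  finally have "l' - l = 0" by (intro small_period lattice_diff assms) simp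
  then show ?thesis using assms(3) by simp
qed

lemma mem_trace_leaf: "p \<in> trace (leaf a) \<longleftrightarrow> p \<in> D \<and> f0 (snd p) = f0 (fst p - a)"
  unfolding trace_def leaf_point_def leaf_iff by simp

text \<open>A minimal section meets the chart in one line only. A point on a line of the other
  family would give a period l too close to \<open>y0\<close>, against \<open>lattice_away\<close>;
  a parallel line shifted by 2\<Lambda> is excluded by \<open>small_period\<close>. The lemma after
  this one is the mirror image.\<close>

lemma trace_leaf_1:
  assumes p: "p \<in> D" and l: "l \<in> lattice \<tau>" "snd p = (fst p - a) + 2 * l"
  shows "trace (leaf a) = plaque (1, 1) (snd p - fst p)"
proof (intro equalityI subsetI)
  fix p' assume p': "p' \<in> trace (leaf a)"
  then have D: "p' \<in> D" unfolding mem_trace_leaf by blast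
  obtain l' where l': "l' \<in> lattice \<tau>" "snd p' = (fst p' - a) + 2 * l' \<or> snd p' = - (fst p' - a) + 2 * l'"
    using p' unfolding mem_trace_leaf f0_eq_lattice_iff by blast
  note bd = D_bounds[OF p D]
  from l'(2) have "snd p' - snd p = fst p' - fst p"
  proof
    assume e: "snd p' = (fst p' - a) + 2 * l'"
    have "(snd p' - snd p) - (fst p' - fst p) = 2 * (l' - l)" unfolding e l(2) by (simp add: algebra_simps)
    then show ?thesis by (rule lattice_translates_equal[OF bd(2,1) _ l(1) l'(1)])
  next
    assume e: "snd p' = - (fst p' - a) + 2 * l'"
    have *: "snd p' + snd p + (fst p' - fst p) = 2 * (l' + l)" unfolding e l(2) by (simp add: algebra_simps)
    have "norm (snd p' + snd p + (fst p' - fst p) - 2 * y0) < 4 * r"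
      using norm_triangle_ineq[of "snd p' + snd p - 2 * y0" "fst p' - fst p"] bd by (simp add: algebra_simps)
    then show ?thesis using no_lattice_sum[OF _ lattice_add[OF l'(1) l(1)]] * by blast
  qed
  then show "p' \<in> plaque (1, 1) (snd p - fst p)" using D unfolding plaque_def by (simp add: algebra_simps)
next
  fix p' assume "p' \<in> plaque (1, 1) (snd p - fst p)"
  then have D: "p' \<in> D" and "snd p' - fst p' = snd p - fst p" unfolding plaque_def by auto
  then have "snd p' = fst p' + (snd p - fst p)" by (simp only: diff_eq_eq add.commute)
  then have "snd p' = (fst p' - a) + 2 * l" unfolding l(2) by simp
  then show "p' \<in> trace (leaf a)" using D l(1) unfolding mem_trace_leaf f0_eq_lattice_iff by blast
qed

lemma trace_leaf_2:
  assumes p: "p \<in> D" and l: "l \<in> lattice \<tau>" "snd p = - (fst p - a) + 2 * l"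
  shows "trace (leaf a) = plaque (1, - 1) (snd p + fst p)"
proof (intro equalityI subsetI)
  fix p' assume p': "p' \<in> trace (leaf a)"
  then have D: "p' \<in> D" unfolding mem_trace_leaf by blast
  obtain l' where l': "l' \<in> lattice \<tau>" "snd p' = (fst p' - a) + 2 * l' \<or> snd p' = - (fst p' - a) + 2 * l'"
    using p' unfolding mem_trace_leaf f0_eq_lattice_iff by blast
  note bd = D_bounds[OF p D]
  have bd1: "norm (fst p - fst p') < 2 * r" using bd(1) by (simp add: norm_minus_commute)
  from l'(2) have "snd p' - snd p = fst p - fst p'"
  proof
    assume e: "snd p' = (fst p' - a) + 2 * l'"
    have *: "snd p' + snd p - (fst p' - fst p) = 2 * (l' + l)" unfolding e l(2) by (simp add: algebra_simps)
    have "norm (snd p' + snd p - (fst p' - fst p) - 2 * y0) < 4 * r"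
      using norm_triangle_ineq4[of "snd p' + snd p - 2 * y0" "fst p' - fst p"] bd by (simp add: algebra_simps)
    then show ?thesis using no_lattice_sum[OF _ lattice_add[OF l'(1) l(1)]] * by blast
  next
    assume e: "snd p' = - (fst p' - a) + 2 * l'"
    have "(snd p' - snd p) - (fst p - fst p') = 2 * (l' - l)" unfolding e l(2) by (simp add: algebra_simps)
    then show ?thesis by (rule lattice_translates_equal[OF bd(2) bd1 _ l(1) l'(1)])
  qed
  then show "p' \<in> plaque (1, - 1) (snd p + fst p)" using D unfolding plaque_def by (simp add: algebra_simps)
next
  fix p' assume "p' \<in> plaque (1, - 1) (snd p + fst p)"
  then have D: "p' \<in> D" and "snd p' + fst p' = snd p + fst p" unfolding plaque_def by auto
  then have "snd p' = snd p + fst p - fst p'" by (simp only: eq_diff_eq)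
  then have "snd p' = - (fst p' - a) + 2 * l" unfolding l(2) by simp
  then show "p' \<in> trace (leaf a)" using D l(1) unfolding mem_trace_leaf f0_eq_lattice_iff by blast
qed

lemma trace_fibre:
  assumes "p \<in> D"
  shows "trace {q \<in> S. \<pi> q = coset \<tau> (fst p)} = plaque (0, 1) (- fst p)"
  unfolding trace_def plaque_def leaf_point_def
  using inj_onD[OF coset_inj_D1, of _ "fst p"] assms by (auto simp: mem_Times_iff)

text \<open>The heights at which a Riccati leaf crosses the chart are among the points
  \<plusminus>(y1 - l) + 2k with periods l and k, of which there are countably many.\<close>

lemma trace_horizontal:
  "\<exists>Y. countable Y \<and> trace {F x z | x. True} = D1 \<times> Y"
proof -
  obtain y1 where y1: "f0 y1 = z" by (rule f0_surj)
  have mem: "F x (f0 y) \<in> {F x z | x. True} \<longleftrightarrow> (\<exists>l\<in>lattice \<tau>. f0 y = f0 (y1 - l))" for x y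
  proof
    assume "F x (f0 y) \<in> {F x z | x. True}"
    then obtain x' where x': "F x (f0 y) = F x' z" by blast
    then obtain l where l: "l \<in> lattice \<tau>" "x' = x + l" using F_eq_lattice by blast
    then have "F x (f0 y) = F x (f0 (y1 - l))"
      using x' F_f0_lattice[OF l(1), of x "y1 - l"] y1 by simp
    then show "\<exists>l\<in>lattice \<tau>. f0 y = f0 (y1 - l)" using l(1) by auto
  next
    assume "\<exists>l\<in>lattice \<tau>. f0 y = f0 (y1 - l)"
    then obtain l where l: "l \<in> lattice \<tau>" "f0 y = f0 (y1 - l)" by blast
    then have "F x (f0 y) = F (x + l) z" using F_f0_lattice[OF l(1), of x "y1 - l"] y1 by simp
    then show "F x (f0 y) \<in> {F x z | x. True}" by blast
  qed
  define Y where "Y = {y \<in> D2. \<exists>l\<in>lattice \<tau>. f0 y = f0 (y1 - l)}"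
  have "Y \<subseteq> (\<Union>l\<in>lattice \<tau>. \<Union>k\<in>lattice \<tau>. {(y1 - l) + 2 * k, - (y1 - l) + 2 * k})"
    unfolding Y_def f0_eq_lattice_iff by blast
  moreover have "countable (\<Union>l\<in>lattice \<tau>. \<Union>k\<in>lattice \<tau>. {(y1 - l) + 2 * k, - (y1 - l) + 2 * k})"
    by (intro countable_UN countable_lattice) auto
  ultimately have "countable Y" by (rule countable_subset)
  moreover have "trace {F x z | x. True} = D1 \<times> Y"
    unfolding trace_def leaf_point_def mem Y_def by auto
  ultimately show ?thesis by blast
qed

lemma horizontal_component:
  assumes "K \<in> components (trace {F x z | x. True})" "p \<in> K"
  shows "K = plaque (1, 0) (snd p)" "p \<in> D"
proof -
  obtain Y where Y: "countable Y" "trace {F x z | x. True} = D1 \<times> Y" using trace_horizontal by blast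
  have K: "K = D1 \<times> {snd p}"
    by (rule component_Times_countable[OF convex_connected[OF convex_ball] Y(1) _ assms(2)])
      (use assms(1) Y(2) in simp)
  show p: "p \<in> D" using in_components_subset[OF assms(1)] assms(2) unfolding trace_def by blast
  show "K = plaque (1, 0) (snd p)" unfolding K plaque_def using p by auto
qed

lemma web_leaf_component:
  assumes L: "L \<in> minimal_sections \<tau> S \<pi> A \<union> {{F x z | x. True} | z. True} \<union> fibres \<tau> S \<pi>"
    and K: "K \<in> components (trace L)" and p: "p \<in> K"
  shows "\<exists>i<4. \<exists>k. K = plaque (web_direction i) k \<and> p \<in> plaque (web_direction i) k"
proof -
  have pD: "p \<in> D" "p \<in> trace L" using in_components_subset[OF K] p unfolding trace_def by auto
  have single: "K = plaque d k" if "trace L = plaque d k" for d k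
    using K plaque_components[of p d k] pD(2) unfolding that by simp
  consider a where "L = leaf a" | z where "L = {F x z | x. True}" | c where "L = {q \<in> S. \<pi> q = coset \<tau> c}"
    using L unfolding minimal_sections_leaf fibres_def curve_def by blast
  then show ?thesis
  proof cases
    case 1
    then obtain l where l: "l \<in> lattice \<tau>" "snd p = (fst p - a) + 2 * l \<or> snd p = - (fst p - a) + 2 * l"
      using pD(2) unfolding 1 mem_trace_leaf f0_eq_lattice_iff by blast
    from l(2) show ?thesis
    proof
      assume "snd p = (fst p - a) + 2 * l"
      then have "K = plaque (1, 1) (snd p - fst p)" using single trace_leaf_1[OF pD(1) l(1)] 1 by blast
      then show ?thesis using p by (intro exI[of _ 0]) (auto simp: web_direction_def)
    next
      assume "snd p = - (fst p - a) + 2 * l"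
      then have "K = plaque (1, - 1) (snd p + fst p)" using single trace_leaf_2[OF pD(1) l(1)] 1 by blast
      then show ?thesis using p by (intro exI[of _ 1]) (auto simp: web_direction_def)
    qed
  next
    case 2
    then have "K = plaque (1, 0) (snd p)" using horizontal_component(1) K p by blast
    then show ?thesis using p by (intro exI[of _ 2]) (auto simp: web_direction_def)
  next
    case 3
    have "\<pi> (leaf_point p) = coset \<tau> c" using pD(2) unfolding trace_def 3 by blast
    then have "coset \<tau> c = coset \<tau> (fst p)" unfolding leaf_point_def by simp
    then have "K = plaque (0, 1) (- fst p)" using single trace_fibre[OF pD(1)] 3 by metis
    then show ?thesis using p by (intro exI[of _ 3]) (auto simp: web_direction_def)
  qed
qed

text \<open>Each plaque is cut out by an actual leaf through \<open>p\<close>; for the minimal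
  sections its parameter is \<open>fst p - snd p\<close> or \<open>fst p + snd p\<close>.\<close>

lemma plaque_web_leaf:
  assumes "i < 4" "p \<in> plaque (web_direction i) k"
  shows "\<exists>L\<in>minimal_sections \<tau> S \<pi> A \<union> {{F x z | x. True} | z. True} \<union> fibres \<tau> S \<pi>.
    plaque (web_direction i) k \<in> components (trace L)"
proof -
  have pD: "p \<in> D" and k: "k = fst (web_direction i) * snd p - snd (web_direction i) * fst p"
    using assms(2) unfolding plaque_def by auto
  have comp: "plaque d k \<in> components (trace L)" if "trace L = plaque d k" "p \<in> plaque d k" for d L
    unfolding that(1) plaque_components[OF that(2)] by simp
  consider "i = 0" | "i = 1" | "i = 2" | "i = 3" using assms(1) by linarith
  then show ?thesis
  proof cases
    case 1
    then have d: "web_direction i = (1, 1)" "k = snd p - fst p" unfolding k by (simp_all add: web_direction_def)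
    have "trace (leaf (fst p - snd p)) = plaque (1, 1) k"
      using trace_leaf_1[OF pD, of 0 "fst p - snd p"] d(2) by simp
    then show ?thesis using comp[of "leaf (fst p - snd p)"] assms(2) unfolding d(1) minimal_sections_leaf by blast
  next
    case 2
    then have d: "web_direction i = (1, - 1)" "k = snd p + fst p" unfolding k by (simp_all add: web_direction_def)
    have "trace (leaf (fst p + snd p)) = plaque (1, - 1) k"
      using trace_leaf_2[OF pD, of 0 "fst p + snd p"] d(2) by simp
    then show ?thesis using comp[of "leaf (fst p + snd p)"] assms(2) unfolding d(1) minimal_sections_leaf by blast
  next
    case 3
    then have d: "web_direction i = (1, 0)" "k = snd p" unfolding k by (simp_all add: web_direction_def)
    let ?L = "{F x (f0 (snd p)) | x. True}"
    \<comment> \<open>This trace can consist of several plaques, so the component through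
      \<open>p\<close> is taken.\<close>
    have "p \<in> trace ?L" using pD unfolding trace_def leaf_point_def by blast
    then obtain K where K: "K \<in> components (trace ?L)" "p \<in> K" using Union_components by blast
    have "K = plaque (1, 0) k" using horizontal_component(1)[OF K] d(2) by simp
    then show ?thesis using K(1) unfolding d(1) by blast
  next
    case 4
    then have d: "web_direction i = (0, 1)" "k = - fst p" unfolding k by (simp_all add: web_direction_def)
    let ?L = "{q \<in> S. \<pi> q = coset \<tau> (fst p)}"
    have "trace ?L = plaque (0, 1) k" using trace_fibre[OF pD] d(2) by simp
    moreover have "?L \<in> fibres \<tau> S \<pi>" unfolding fibres_def by auto
    ultimately show ?thesis using comp[of ?L] assms(2) unfolding d(1) by blast
  qed
qed

text \<open>The comparison is between components: a Riccati leaf can cut the chart in several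
  plaques, whereas a line cuts it in a single one.\<close>

lemma local_leaves_eq:
  "local_leaves {\<phi> ` (L \<inter> U) | L. L \<in> minimal_sections \<tau> S \<pi> A \<union> {{F x z | x. True} | z. True} \<union> fibres \<tau> S \<pi>} =
   local_leaves {l \<inter> \<phi> ` U | l i. i < 4 \<and> l \<in> parallel_lines (web_direction i)}"
proof -
  have nz: "web_direction i \<noteq> (0, 0)" for i by (simp add: web_direction_def)
  have pl: "{p. fst d * snd p - snd d * fst p = k} \<inter> D = plaque d k" for d k
    unfolding plaque_def by auto
  have lines: "{l \<inter> \<phi> ` U | l i. i < 4 \<and> l \<in> parallel_lines (web_direction i)} = {plaque (web_direction i) k | i k. i < 4}"
    unfolding phi_U parallel_lines_eq[OF nz]
  proof (intro equalityI subsetI)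
    fix X assume "X \<in> {l \<inter> D | l i. i < 4 \<and>
        l \<in> {{p. fst (web_direction i) * snd p - snd (web_direction i) * fst p = k} | k. True}}"
    then obtain i k where "i < 4"
        "X = {p. fst (web_direction i) * snd p - snd (web_direction i) * fst p = k} \<inter> D" by blast
    then show "X \<in> {plaque (web_direction i) k | i k. i < 4}" unfolding pl by blast
  next
    fix X assume "X \<in> {plaque (web_direction i) k | i k. i < 4}"
    then obtain i k where "i < 4" "X = plaque (web_direction i) k" by blast
    then show "X \<in> {l \<inter> D | l i. i < 4 \<and>
        l \<in> {{p. fst (web_direction i) * snd p - snd (web_direction i) * fst p = k} | k. True}}"
      unfolding pl[symmetric] by blast
  qed
  have R: "local_leaves {l \<inter> \<phi> ` U | l i. i < 4 \<and> l \<in> parallel_lines (web_direction i)}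
      = (\<Union>i\<in>{..<4}. \<Union>k. components (plaque (web_direction i) k))"
    unfolding local_leaves_def lines by auto
  show ?thesis
    unfolding R trace_eq
  proof (intro equalityI subsetI)
    fix K assume "K \<in> local_leaves {trace L | L. L \<in> minimal_sections \<tau> S \<pi> A \<union> {{F x z | x. True} | z. True} \<union> fibres \<tau> S \<pi>}"
    then obtain L where L: "L \<in> minimal_sections \<tau> S \<pi> A \<union> {{F x z | x. True} | z. True} \<union> fibres \<tau> S \<pi>"
      "K \<in> components (trace L)" unfolding local_leaves_def by blast
    obtain p where p: "p \<in> K" using in_components_nonempty[OF L(2)] by blast
    obtain i k where ik: "i < 4" "K = plaque (web_direction i) k" "p \<in> plaque (web_direction i) k"
      using web_leaf_component[OF L p] by blast
    then have "K \<in> components (plaque (web_direction i) k)" using plaque_components[OF ik(3)] by simp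
    then show "K \<in> (\<Union>i\<in>{..<4}. \<Union>k. components (plaque (web_direction i) k))" using ik(1) by blast
  next
    fix K assume "K \<in> (\<Union>i\<in>{..<4}. \<Union>k. components (plaque (web_direction i) k))"
    then obtain i k where ik: "i < 4" "K \<in> components (plaque (web_direction i) k)" by blast
    obtain p where "p \<in> K" using in_components_nonempty[OF ik(2)] by blast
    then have p: "p \<in> plaque (web_direction i) k" using in_components_subset[OF ik(2)] by blast
    then have "K = plaque (web_direction i) k" using plaque_components[OF p] ik(2) by simp
    then show "K \<in> local_leaves {trace L | L. L \<in> minimal_sections \<tau> S \<pi> A \<union> {{F x z | x. True} | z. True} \<union> fibres \<tau> S \<pi>}"
      using plaque_web_leaf[OF ik(1) p] unfolding local_leaves_def by blast
  qed
qed

end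

context flat_ruled_surface
begin

lemma flat_web_parallelizable:
  "locally_parallelizable_on 4 S A (S - discriminant \<tau> S \<pi> A)
     (minimal_sections \<tau> S \<pi> A \<union> {{F x z | x. True} | z. True} \<union> fibres \<tau> S \<pi>)"
proof -
  obtain u v where "theta_pair \<tau> u v" using theta_pair_exists[OF tau] by metis
  then interpret flat_theta \<tau> S \<pi> A F u v
    unfolding flat_theta_def using flat_ruled_surface_axioms by blast
  show ?thesis
    unfolding locally_parallelizable_on_def
  proof
    fix q assume q: "q \<in> S - discriminant \<tau> S \<pi> A"
    obtain x0 y0 r where chart: "flat_chart \<tau> S \<pi> A F u v y0 r" and q_eq: "q = F x0 (f0 y0)"
      by (rule chart_exists[OF q])
    interpret c: flat_chart \<tau> S \<pi> A F u v x0 y0 r by (rule chart)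
    show "\<exists>U \<phi> (d :: nat \<Rightarrow> complex \<times> complex). q \<in> U \<and> U \<subseteq> S - discriminant \<tau> S \<pi> A \<and> holomorphic_coordinates S A U \<phi> \<and>
        (\<forall>i<4. d i \<noteq> (0, 0)) \<and>
        (\<forall>i<4. \<forall>j<4. i \<noteq> j \<longrightarrow> fst (d i) * snd (d j) \<noteq> snd (d i) * fst (d j)) \<and>
        local_leaves {\<phi> ` (L \<inter> U) | L. L \<in> minimal_sections \<tau> S \<pi> A \<union> {{F x z | x. True} | z. True} \<union> fibres \<tau> S \<pi>} =
        local_leaves {l \<inter> \<phi> ` U | l i. i < 4 \<and> l \<in> parallel_lines (d i)}"
    proof (rule exI[of _ c.U], rule exI[of _ c.\<phi>], rule exI[of _ web_direction], intro conjI allI impI)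
      show "q \<in> c.U" unfolding c.U_def c.leaf_point_def q_eq using c.r by (intro image_eqI[of _ _ "(x0, y0)"]) auto
      show "c.U \<subseteq> S - discriminant \<tau> S \<pi> A"
        unfolding c.U_def c.leaf_point_def using c.D2_not_lattice discriminant_iff by auto
      show "web_direction i \<noteq> (0, 0)" for i by (simp add: web_direction_def)
      show "fst (web_direction i) * snd (web_direction j) \<noteq> snd (web_direction i) * fst (web_direction j)"
        if "i < 4" "j < 4" "i \<noteq> j" for i j
        using that by (auto simp: web_direction_def)
    qed (rule c.chart_coordinates c.local_leaves_eq)+
  qed
qed

end

section \<open>The suspension\<close>

lemma monodromy_mobius:
  obtains a b c d where "a * d - b * c \<noteq> 0" "monodromy m n = mobius a b c d"
proof -
  have id: "mobius 1 0 0 1 z = z" and neg_inv: "mobius (-1) 0 0 1 (mobius 0 1 1 0 z) = mobius 0 (-1) 1 0 z" for z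
  proof -
    obtain p q where pq: "(p, q) \<noteq> (0 :: complex, 0 :: complex)" "z = proj p q" by (rule sphere_lift)
    have "(q, p) \<noteq> (0, 0)" using pq(1) by auto
    then show "mobius 1 0 0 1 z = z" "mobius (-1) 0 0 1 (mobius 0 1 1 0 z) = mobius 0 (-1) 1 0 z"
      unfolding pq(2) by (simp_all add: mobius_proj[OF pq(1)] mobius_proj)
  qed
  consider "even m" "even n" | "even m" "odd n" | "odd m" "even n" | "odd m" "odd n" by blast
  then show ?thesis
  proof cases
    case 1
    then show ?thesis by (intro that[of 1 1 0 0]) (auto simp: monodromy_def fun_eq_iff id)
  next
    case 2
    then show ?thesis by (intro that[of 0 0 1 1]) (auto simp: monodromy_def fun_eq_iff)
  next
    case 3
    then show ?thesis by (intro that[of "-1" 1 0 0]) (auto simp: monodromy_def fun_eq_iff)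
  next
    case 4
    then show ?thesis by (intro that[of 0 0 "-1" 1]) (auto simp: monodromy_def fun_eq_iff neg_inv)
  qed
qed

text \<open>The matrices of z -> -z and z -> 1/z anticommute, but the sign disappears in homogeneous
  coordinates. The maps therefore commute, and parities add up.\<close>

lemma monodromy_add: "monodromy k l (monodromy m n z) = monodromy (k + m) (l + n) z"
proof -
  define m1 where "m1 = mobius (-1) 0 0 1" define m2 where "m2 = mobius 0 1 1 0"
  have rel: "m1 (m1 z) = z" "m2 (m2 z) = z" "m2 (m1 z) = m1 (m2 z)" for z
  proof -
    obtain p q where pq: "(p, q) \<noteq> (0 :: complex, 0 :: complex)" "z = proj p q" by (rule sphere_lift)
    have pq': "(- p, q) \<noteq> (0, 0)" "(q, p) \<noteq> (0, 0)" using pq(1) by auto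
    have "m1 z = proj (- p) q" "m2 z = proj q p" "m1 (proj (- p) q) = z" "m2 (proj q p) = z"
      "m2 (proj (- p) q) = proj q (- p)" "m1 (proj q p) = proj (- q) p"
      unfolding m1_def m2_def pq(2) mobius_proj[OF pq(1)] mobius_proj[OF pq'(1)] mobius_proj[OF pq'(2)] by simp_all
    moreover have "proj q (- p) = proj (- q) p" by (simp add: proj_def)
    ultimately show "m1 (m1 z) = z" "m2 (m2 z) = z" "m2 (m1 z) = m1 (m2 z)" by simp_all
  qed
  show ?thesis
    unfolding monodromy_def m1_def[symmetric] m2_def[symmetric] by (simp add: rel)
qed

lemma monodromy_0 [simp]: "monodromy 0 0 z = z"
  by (simp add: monodromy_def)

lemma orbit_shift: "orbit \<tau> (x + of_int m + of_int n * \<tau>) (monodromy m n z) = orbit \<tau> x z"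
proof (intro equalityI subsetI)
  fix P assume "P \<in> orbit \<tau> (x + of_int m + of_int n * \<tau>) (monodromy m n z)"
  then obtain k l where "P = (x + of_int m + of_int n * \<tau> + of_int k + of_int l * \<tau>, monodromy k l (monodromy m n z))"
    unfolding orbit_def by blast
  then have "P = (x + of_int (k + m) + of_int (l + n) * \<tau>, monodromy (k + m) (l + n) z)"
    by (simp add: monodromy_add algebra_simps)
  then show "P \<in> orbit \<tau> x z" unfolding orbit_def by blast
next
  fix P assume "P \<in> orbit \<tau> x z"
  then obtain k l where P: "P = (x + of_int k + of_int l * \<tau>, monodromy k l z)"
    unfolding orbit_def by blast
  have "monodromy (k - m) (l - n) (monodromy m n z) = monodromy k l z" by (simp add: monodromy_add)
  then have "P = (x + of_int m + of_int n * \<tau> + of_int (k - m) + of_int (l - n) * \<tau>,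
      monodromy (k - m) (l - n) (monodromy m n z))"
    unfolding P by (simp add: algebra_simps)
  then show "P \<in> orbit \<tau> (x + of_int m + of_int n * \<tau>) (monodromy m n z)" unfolding orbit_def by blast
qed

lemma orbit_lattice:
  assumes "coset \<tau> x = coset \<tau> x'"
  obtains m n where "\<And>y z. orbit \<tau> y z = orbit \<tau> (y + (x' - x)) (monodromy m n z)"
proof -
  obtain m n where mn: "x' - x = of_int m + of_int n * \<tau>"
    using assms unfolding coset_eq_iff lattice_def by blast
  have "orbit \<tau> y z = orbit \<tau> (y + (x' - x)) (monodromy m n z)" for y z
    using orbit_shift[of \<tau> y m n z] unfolding mn by (simp add: add.assoc)
  then show ?thesis by (rule that)
qed

lemma suspension_proj_orbit [simp]: "suspension_proj (orbit \<tau> x z) = coset \<tau> x"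
  unfolding suspension_proj_def orbit_def coset_def by force

text \<open>A period that fixes the base coordinate is trivial, since 1 and \<tau> are linearly
  independent over the reals. So an orbit has only one point with first coordinate
  \<open>x\<close>.\<close>

lemma orbit_eq_iff:
  assumes "Im \<tau> \<noteq> 0" shows "orbit \<tau> x z = orbit \<tau> x z' \<longleftrightarrow> z = z'"
proof
  assume "orbit \<tau> x z = orbit \<tau> x z'"
  moreover have "(x, z) \<in> orbit \<tau> x z"
    unfolding orbit_def by (rule CollectI, rule exI[of _ 0], rule exI[of _ 0]) simp
  ultimately obtain m n where mn: "(x, z) = (x + of_int m + of_int n * \<tau>, monodromy m n z')"
    unfolding orbit_def by blast
  then have eq: "of_real (of_int m) + of_real (of_int n) * \<tau> = (0 :: complex)" by simp
  have "of_int m = (0 :: real)" "of_int n = (0 :: real)"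
    using coord_of[OF assms, of "of_int m" "of_int n", unfolded eq] by (simp_all add: coord1_def coord2_def)
  then show "z = z'" using mn by simp
qed simp

text \<open>Transitions between flat trivializations are monodromy maps, hence given by constant
  matrices.\<close>

lemma flat_triv_in_suspension_atlas:
  assumes tau: "Im \<tau> \<noteq> 0" and U: "open U" "inj_on (coset \<tau>) U"
  shows "(U, orbit \<tau>) \<in> suspension_atlas \<tau>"
proof -
  have "local_triv \<tau> (suspension \<tau>) suspension_proj (U, orbit \<tau>)"
    unfolding local_triv_def prod.case
  proof (intro conjI U ballI bij_betw_imageI)
    fix x
    show "inj (orbit \<tau> x)" by (rule injI) (simp add: orbit_eq_iff[OF tau])
    show "range (orbit \<tau> x) = {q \<in> suspension \<tau>. suspension_proj q = coset \<tau> x}"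
    proof (intro equalityI subsetI)
      fix q assume "q \<in> {q \<in> suspension \<tau>. suspension_proj q = coset \<tau> x}"
      then obtain y z where q: "q = orbit \<tau> y z" "coset \<tau> y = coset \<tau> x" unfolding suspension_def by auto
      obtain m n where "orbit \<tau> y z = orbit \<tau> (y + (x - y)) (monodromy m n z)"
        using orbit_lattice[OF q(2)] by metis
      then show "q \<in> range (orbit \<tau> x)" using q(1) by simp
    qed (auto simp: suspension_def)
  qed
  moreover have compat: "compatible_triv \<tau> (V, orbit \<tau>) (V', orbit \<tau>)" if "open V" "open V'" for V V'
    unfolding compatible_triv_def prod.case
  proof (intro ballI impI)
    fix x x' assume x: "x \<in> V" "x' \<in> V'" "coset \<tau> x = coset \<tau> x'"
    obtain m n where mn: "\<And>y z. orbit \<tau> y z = orbit \<tau> (y + (x' - x)) (monodromy m n z)"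
      by (rule orbit_lattice[OF x(3)]) blast
    obtain a b c d where abcd: "a * d - b * c \<noteq> 0" "monodromy m n = mobius a b c d" by (rule monodromy_mobius)
    let ?N = "V \<inter> (\<lambda>y. y + (x' - x)) -` V'"
    have "open ?N" using that by (intro open_Int open_vimage) (auto intro!: continuous_intros)
    then show "\<exists>N a b c d. open N \<and> x \<in> N \<and> N \<subseteq> V \<and> a holomorphic_on N \<and> b holomorphic_on N \<and>
        c holomorphic_on N \<and> d holomorphic_on N \<and>
        (\<forall>y\<in>N. a y * d y - b y * c y \<noteq> 0 \<and> y + (x' - x) \<in> V' \<and>
          (\<forall>z. orbit \<tau> y z = orbit \<tau> (y + (x' - x)) (mobius (a y) (b y) (c y) (d y) z)))"
      using x abcd mn[unfolded abcd(2)]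
      by (intro exI[of _ ?N] exI[of _ "\<lambda>_. a"] exI[of _ "\<lambda>_. b"] exI[of _ "\<lambda>_. c"] exI[of _ "\<lambda>_. d"]) auto
  qed
  ultimately show ?thesis unfolding suspension_atlas_def using U by blast
qed

section \<open>Invariance under \<tau> -> -\<tau>: these notions depend on \<tau> only through its
  cosets\<close>

lemma ruled_surface_uminus: "ruled_surface (- \<tau>) S \<pi> A = ruled_surface \<tau> S \<pi> A"
  unfolding ruled_surface_def local_triv_def compatible_triv_def curve_def coset_uminus_period ..

lemma holomorphic_section_uminus: "holomorphic_section (- \<tau>) S \<pi> A s = holomorphic_section \<tau> S \<pi> A s"
  unfolding holomorphic_section_def fibre_coord_def curve_def coset_uminus_period ..

lemma self_intersection_uminus: "self_intersection (- \<tau>) A s = self_intersection \<tau> A s"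
  unfolding self_intersection_def meromorphic_normal_field_def normal_field_degree_def normal_field_order_def
    finite_trivs_def transition_deriv_def fibre_coord_def curve_def coset_uminus_period ..

lemma minimal_sections_uminus: "minimal_sections (- \<tau>) S \<pi> A = minimal_sections \<tau> S \<pi> A"
  unfolding minimal_sections_def holomorphic_section_uminus self_intersection_uminus curve_def coset_uminus_period ..

lemma discriminant_uminus: "discriminant (- \<tau>) S \<pi> A = discriminant \<tau> S \<pi> A"
  unfolding discriminant_def minimal_sections_uminus ..

lemma fibres_uminus: "fibres (- \<tau>) S \<pi> = fibres \<tau> S \<pi>"
  unfolding fibres_def curve_def coset_uminus_period ..

text \<open>The orbit map of the suspension is carried over to \<open>S\<close> by the isomorphism.
  If Im \<tau> < 0, the generator -\<tau> is used instead; as z -> 1/z is its own inverse, the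
  equivariance rules keep their form.\<close>

lemma flat_ruled_surface_suspension:
  assumes tau: "Im \<tau> \<noteq> 0" and ruled: "ruled_surface \<tau> S \<pi> A"
    and iso: "ruled_iso S \<pi> A (suspension \<tau>) suspension_proj (suspension_atlas \<tau>) \<Phi>"
  defines "F \<equiv> \<lambda>x z. inv_into S \<Phi> (orbit \<tau> x z)"
  obtains \<tau>' where "\<tau>' = \<tau> \<or> \<tau>' = - \<tau>" "flat_ruled_surface \<tau>' S \<pi> A F"
proof -
  have triv: "(U, F) \<in> A" if "open U" "inj_on (coset \<tau>) U" for U
    using iso flat_triv_in_suspension_atlas[OF tau that] unfolding ruled_iso_def F_def by blast
  have shift: "F (x + of_int m + of_int n * \<tau>) (monodromy m n z) = F x z" for x m n z
    unfolding F_def orbit_shift ..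
  have F1: "F (x + 1) z = F x (mobius (-1) 0 0 1 z)" for x z
    using shift[of x 1 0 "monodromy 1 0 z"] unfolding monodromy_add by (simp add: monodromy_def)
  have Ft: "F (x + \<tau>) z = F x (mobius 0 1 1 0 z)" for x z
    using shift[of x 0 1 "monodromy 0 1 z"] unfolding monodromy_add by (simp add: monodromy_def)
  have Ft': "F (x - \<tau>) z = F x (mobius 0 1 1 0 z)" for x z
    using shift[of x 0 "-1" "monodromy 0 1 z"] unfolding monodromy_add by (simp add: monodromy_def)
  show ?thesis
  proof (cases "Im \<tau> > 0")
    case True
    have "flat_ruled_surface \<tau> S \<pi> A F"
      by unfold_locales (use True ruled triv F1 Ft in auto)
    then show ?thesis using that by blast
  next
    case False
    have "flat_ruled_surface (- \<tau>) S \<pi> A F"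
    proof unfold_locales
      show "Im (- \<tau>) > 0" using False tau by simp
      show "ruled_surface (- \<tau>) S \<pi> A" unfolding ruled_surface_uminus by (rule ruled)
      show "(U, F) \<in> A" if "open U" "inj_on (coset (- \<tau>)) U" for U
        using triv that unfolding coset_uminus_period by blast
      show "F (x + 1) z = F x (mobius (-1) 0 0 1 z)" "F (x + - \<tau>) z = F x (mobius 0 1 1 0 z)" for x z
        using F1 Ft' by simp_all
    qed
    then show ?thesis using that by blast
  qed
qed

theorem theorem3p10:
  fixes \<tau> :: complex and S :: "'a set" and \<pi> :: "'a \<Rightarrow> complex set"
    and A :: "'a triv set" and Ric :: "'a set set"
  assumes "Im \<tau> \<noteq> 0"
    and "stable_ruled_surface \<tau> S \<pi> A"
    and "riccati_foliation \<tau> S \<pi> A Ric"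
  shows "locally_parallelizable_on 4 S A (S - discriminant \<tau> S \<pi> A)
           (minimal_sections \<tau> S \<pi> A \<union> Ric \<union> fibres \<tau> S \<pi>)"
proof -
  obtain \<Phi> where iso: "ruled_iso S \<pi> A (suspension \<tau>) suspension_proj (suspension_atlas \<tau>) \<Phi>"
    and Ric: "Ric = {{q \<in> S. \<exists>x. \<Phi> q = orbit \<tau> x z} | z. True}"
    using assms(3) unfolding riccati_foliation_def by blast
  define F where "F x z = inv_into S \<Phi> (orbit \<tau> x z)" for x z
  have ruled: "ruled_surface \<tau> S \<pi> A" using assms(2) unfolding stable_ruled_surface_def by blast
  have bij: "bij_betw \<Phi> S (suspension \<tau>)" using iso unfolding ruled_iso_def by blast
  have "{q \<in> S. \<exists>x. \<Phi> q = orbit \<tau> x z} = {F x z | x. True}" for z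
  proof (intro equalityI subsetI)
    fix q assume "q \<in> {q \<in> S. \<exists>x. \<Phi> q = orbit \<tau> x z}"
    then obtain x where "q \<in> S" "\<Phi> q = orbit \<tau> x z" by blast
    then have "q = F x z" unfolding F_def using bij_betw_inv_into_left[OF bij] by metis
    then show "q \<in> {F x z | x. True}" by blast
  next
    fix q assume "q \<in> {F x z | x. True}"
    then obtain x where q: "q = F x z" by blast
    have "orbit \<tau> x z \<in> suspension \<tau>" unfolding suspension_def by blast
    then have "q \<in> S" "\<Phi> q = orbit \<tau> x z"
      unfolding q F_def using bij_betw_inv_into_right[OF bij] bij_betwE[OF bij_betw_inv_into[OF bij]] by blast+
    then show "q \<in> {q \<in> S. \<exists>x. \<Phi> q = orbit \<tau> x z}" by blast
  qed
  then have Ric': "Ric = {{F x z | x. True} | z. True}" unfolding Ric by simp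
  obtain \<tau>' where \<tau>': "\<tau>' = \<tau> \<or> \<tau>' = - \<tau>" "flat_ruled_surface \<tau>' S \<pi> A F"
    using flat_ruled_surface_suspension[OF assms(1) ruled iso] unfolding F_def[abs_def] by metis
  have "locally_parallelizable_on 4 S A (S - discriminant \<tau>' S \<pi> A)
      (minimal_sections \<tau>' S \<pi> A \<union> {{F x z | x. True} | z. True} \<union> fibres \<tau>' S \<pi>)"
    by (rule flat_ruled_surface.flat_web_parallelizable[OF \<tau>'(2)])
  then show ?thesis
    using \<tau>'(1) unfolding Ric' by (auto simp: discriminant_uminus minimal_sections_uminus fibres_uminus)
qed

end
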